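(* Let $1\le k<d$ be integers, $(\mathbf A_0,\mathbf t_0)\in\Xi_k$ and $r\in\mathcal S'(\mathbb R^{d-k})$. Then $$\mathrm K_{d-k}\mathcal R_k\{r(\mathbf A_0(\cdot)-\mathbf t_0)\}=[\delta(\cdot-\mathbf A_0)\,r(\cdot-\mathbf t_0)]\in\mathcal S_k',$$ $$\mathcal R_k\{r(\mathbf A_0(\cdot)-\mathbf t_0)\}=[\delta(\cdot-\mathbf A_0)\,(q*r)(\cdot-\mathbf t_0)]\in\big(\mathrm K_{d-k}\mathcal R_k(\mathcal S(\mathbb R^d))\big)',$$ where $q=\mathcal F_{d-k}^{-1}\{\hat K_{d-k}^{-1}\}$ is the impulse response of the inverse filtering operator $\mathrm K_{d-k}^{-1}$ and where the distributions on the right-hand sides are understood as equivalence classes in their respective distribution spaces. Furthermore, if $$\delta(\cdot-\mathbf A_0)\,r(\cdot-\mathbf t_0)\in\mathcal X'=(\mathcal X_k\oplus\mathcal X_k^{c})'\subset\mathcal S'(\Xi_k),$$ where $\mathcal X=\mathcal X_k\oplus\mathcal X_k^{c}$ with complementary Banach spaces $\mathcal X_k$, $\mathcal X_k^{c}$, and where $(\mathcal X_k,\mathcal X_k')$ is a dual pair of $k$-plane-compatible Banach spaces, then the filtered $k$-plane transform has the concrete interpretation $$\mathrm K_{d-k}\mathcal R_k\{r(\mathbf A_0(\cdot)-\mathbf t_0)\}=\mathrm P_k^*\{\delta(\cdot-\mathbf A_0)\,r(\cdot-\mathbf t_0)\}\in\mathcal X_k'.$$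
   Context: Notation. $V_{d-k}(\mathbb R^d)=\{\mathbf A\in\mathbb R^{(d-k)\times d}:\mathbf A\mathbf A^{T}=\mathbf I_{d-k}\}$, with invariant (Haar) measure $\sigma$ of total mass $\prod_{n=k+1}^{d}|\mathbb S^{n-1}|$ ($|\mathbb S^m|$ = surface area, $|\mathbb S^0|=2$). $\Xi_k=V_{d-k}(\mathbb R^d)\times\mathbb R^{d-k}$. $\mathcal S(\Xi_k)$ is the Fréchet space of smooth functions on $\Xi_k$ rapidly decreasing in $\mathbf t$, with dual $\mathcal S'(\Xi_k)$. For $\varphi\in\mathcal S(\mathbb R^d)$, $\mathcal R_k\{\varphi\}(\mathbf A,\mathbf t)=\int_{\{\mathbf A\mathbf x=\mathbf 0\}}\varphi(\mathbf x+\mathbf A^{T}\mathbf t)\,d\mathbf x$; $\mathcal S_k=\mathcal R_k(\mathcal S(\mathbb R^d))\subset\mathcal S(\Xi_k)$ with the inherited topology. On functions $\mathcal R_k^*\{g\}(\mathbf x)=\int g(\mathbf A,\mathbf A\mathbf x)\,d\sigma(\mathbf A)$. $\mathrm K_{d-k}$ is the convolution operator in $\mathbf t$ with frequency response $\hat K_{d-k}(\boldsymbol\omega)=c_{d,k}\|\boldsymbol\omega\|_2^k$, $c_{d,k}=\frac{1}{(2\pi)^k}\frac{|\mathbb S^{k-1}|}{|\mathbb S^{d-k-1}|}\prod_{n=k}^{d-1}|\mathbb S^{n-1}|^{-1}$, and $\mathrm K_{d-k}^{-1}$ has frequency response $\hat K_{d-k}^{-1}(\boldsymbol\omega)=c_{d,k}^{-1}\|\boldsymbol\omega\|_2^{-k}$.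 $\mathcal R_k:\mathcal S(\mathbb R^d)\to\mathcal S_k$ is a homeomorphism with inverse $\mathcal R_k^*\mathrm K_{d-k}$. The space $\mathrm K_{d-k}\mathcal R_k(\mathcal S(\mathbb R^d))$ carries the topology making $\mathcal R_k^*:\mathrm K_{d-k}\mathcal R_k(\mathcal S(\mathbb R^d))\to\mathcal S(\mathbb R^d)$ a homeomorphism. Distributional operators: $\mathcal R_k:\mathcal S'(\mathbb R^d)\to(\mathrm K_{d-k}\mathcal R_k(\mathcal S(\mathbb R^d)))'$ is the dual map of $\mathcal R_k^*:\mathrm K_{d-k}\mathcal R_k(\mathcal S(\mathbb R^d))\to\mathcal S(\mathbb R^d)$; $\mathrm K_{d-k}\mathcal R_k:\mathcal S'(\mathbb R^d)\to\mathcal S_k'$ is the dual map of $\mathcal R_k^*\mathrm K_{d-k}:\mathcal S_k\to\mathcal S(\mathbb R^d)$. $k$-plane ridges: for $r\in\mathcal S'(\mathbb R^{d-k})$ and $\mathbf A\in V_{d-k}(\mathbb R^d)$, the ridge $r_{\mathbf A}=r(\mathbf A(\cdot))\in\mathcal S'(\mathbb R^d)$ is defined by $\langle r_{\mathbf A},\varphi\rangle=\langle r,\mathcal R_k\{\varphi\}(\mathbf A,\cdot)\rangle$, $\varphi\in\mathcal S(\mathbb R^d)$. $r(\mathbf A_0(\cdot)-\mathbf t_0)$ denotes the ridge with profile $r(\cdot-\mathbf t_0)$ and orientation $\mathbf A_0$. Right-hand sides: $\delta(\cdot-\mathbf A_0)\,r(\cdot-\mathbf t_0)\in\mathcal S'(\Xi_k)$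 is $\psi\mapsto\langle r(\cdot-\mathbf t_0),\psi(\mathbf A_0,\cdot)\rangle$. Its class $[\,\cdot\,]$ in $\mathcal S_k'\cong\mathcal S'(\Xi_k)/\{g:\langle g,\psi\rangle=0\ \forall\psi\in\mathcal S_k\}$ is its restriction to $\mathcal S_k$. The class $[\delta(\cdot-\mathbf A_0)(q*r)(\cdot-\mathbf t_0)]$ is the functional $\psi\mapsto\langle r(\cdot-\mathbf t_0),(\mathrm K_{d-k}^{-1}\psi)(\mathbf A_0,\cdot)\rangle$ on $\mathrm K_{d-k}\mathcal R_k(\mathcal S(\mathbb R^d))$. Compatible spaces: $(\mathcal X_k,\mathcal X_k')$ is a dual pair of $k$-plane-compatible Banach spaces if there is a Banach space $\mathcal X$ with $\mathcal S(\Xi_k)\hookrightarrow\mathcal X\hookrightarrow\mathcal S'(\Xi_k)$ densely and continuously, and $\mathcal X_k$ is the completion of $\mathcal S_k$ in $\|\cdot\|_{\mathcal X}$ (its closure in $\mathcal X$). Then $\mathcal X_k'\hookrightarrow\mathcal S_k'$. When $\mathcal X=\mathcal X_k\oplus\mathcal X_k^{c}$, one has $\mathcal X'=\mathcal X_k'\oplus(\mathcal X_k^{c})'$, and $\mathrm P_k^*=\mathrm K_{d-k}\mathcal R_k\mathcal R_k^*:\mathcal X'\to\mathcal X_k'$ is the continuous projector onto $\mathcal X_k'$ along $(\mathcal X_k^{c})'$, where here $\mathcal R_k^*:\mathcal S'(\Xi_k)\to\mathcal S'(\mathbb R^d)$ is the dual map of $\mathcal R_k:\mathcal S(\mathbb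 R^d)\to\mathcal S(\Xi_k)$. *)

theory Defs
  imports "HOL-Analysis.Analysis"
begin

section \<open>Seminorm topologies, duals and concretely embedded Banach spaces\<close>

text \<open>
  All vector spaces below are complex vector spaces of functions with pointwise operations.  A space
  of functions with domain \<open>D\<close> inside a type is represented by total functions that vanish
  outside \<open>D\<close>; likewise a functional on a test space vanishes outside that test space.  Hence two
  such objects agree on their domain iff they are equal, and restriction to a smaller domain is
  truncation by zero.
\<close>

definition complex_subspace :: "('a \<Rightarrow> complex) set \<Rightarrow> bool" where
  "complex_subspace V \<longleftrightarrow> (\<lambda>_. 0) \<in> V \<and>
     (\<forall>f\<in>V. \<forall>g\<in>V. \<forall>a b. (\<lambda>x. a * f x + b * g x) \<in> V)"

definition seminorm_topology ::
  "('a \<Rightarrow> complex) set \<Rightarrow> (('a \<Rightarrow> complex) \<Rightarrow> real) set \<Rightarrow> ('a \<Rightarrow> complex) topology" where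
  "seminorm_topology V P = topology_generated_by
     {{g \<in> V. p (\<lambda>x. g x - f x) < e} | f p e. f \<in> V \<and> p \<in> P \<and> 0 < e}"

definition dual_space :: "('a \<Rightarrow> complex) topology \<Rightarrow> (('a \<Rightarrow> complex) \<Rightarrow> complex) set" where
  "dual_space T = {F. (\<forall>f. f \<notin> topspace T \<longrightarrow> F f = 0) \<and>
     (\<forall>f\<in>topspace T. \<forall>g\<in>topspace T. \<forall>a b. F (\<lambda>x. a * f x + b * g x) = a * F f + b * F g) \<and>
     continuous_map T euclidean F}"

definition weak_star_topology ::
  "('a \<Rightarrow> complex) topology \<Rightarrow> (('a \<Rightarrow> complex) \<Rightarrow> complex) topology" where
  "weak_star_topology T =
     seminorm_topology (dual_space T) {\<lambda>F. norm (F f) | f. f \<in> topspace T}"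

text \<open>Transpose \<open>F \<mapsto> F \<circ> L\<close> of a linear map \<open>L\<close> defined on the test space \<open>D\<close>.  With
  \<open>L = (\<lambda>f. f)\<close> this is the restriction of a functional to \<open>D\<close>.\<close>

definition dual_map :: "'a set \<Rightarrow> ('a \<Rightarrow> 'b) \<Rightarrow> ('b \<Rightarrow> complex) \<Rightarrow> 'a \<Rightarrow> complex" where
  "dual_map D L F = (\<lambda>f. if f \<in> D then F (L f) else 0)"

text \<open>The case distinction makes \<open>norm_dist V N\<close> symmetric and nonnegative on the whole type, as the
  library's abstract metric spaces require, whatever \<open>N\<close> does outside \<open>V\<close>.\<close>

definition norm_dist ::
  "('a \<Rightarrow> complex) set \<Rightarrow> (('a \<Rightarrow> complex) \<Rightarrow> real) \<Rightarrow> ('a \<Rightarrow> complex) \<Rightarrow> ('a \<Rightarrow> complex) \<Rightarrow> real" where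
  "norm_dist V N f g = (if f \<in> V \<and> g \<in> V then N (\<lambda>x. f x - g x) else 0)"

definition norm_topology ::
  "('a \<Rightarrow> complex) set \<Rightarrow> (('a \<Rightarrow> complex) \<Rightarrow> real) \<Rightarrow> ('a \<Rightarrow> complex) topology" where
  "norm_topology V N = Metric_space.mtopology V (norm_dist V N)"

definition complex_banach :: "('a \<Rightarrow> complex) set \<Rightarrow> (('a \<Rightarrow> complex) \<Rightarrow> real) \<Rightarrow> bool" where
  "complex_banach V N \<longleftrightarrow> complex_subspace V \<and>
     (\<forall>f\<in>V. 0 \<le> N f \<and> (N f = 0 \<longleftrightarrow> f = (\<lambda>_. 0))) \<and>
     (\<forall>f\<in>V. \<forall>a. N (\<lambda>x. a * f x) = norm a * N f) \<and>
     (\<forall>f\<in>V. \<forall>g\<in>V. N (\<lambda>x. f x + g x) \<le> N f + N g) \<and>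
     Metric_space.mcomplete V (norm_dist V N)"

definition banach_direct_sum ::
  "('a \<Rightarrow> complex) set \<Rightarrow> (('a \<Rightarrow> complex) \<Rightarrow> real) \<Rightarrow>
   ('a \<Rightarrow> complex) set \<Rightarrow> ('a \<Rightarrow> complex) set \<Rightarrow> bool" where
  "banach_direct_sum X N Y Z \<longleftrightarrow> complex_banach X N \<and> complex_banach Y N \<and> complex_banach Z N \<and>
     X = {\<lambda>x. u x + v x | u v. u \<in> Y \<and> v \<in> Z} \<and> Y \<inter> Z = {\<lambda>_. 0}"

text \<open>For \<open>X = Y \<oplus> Z\<close>, the identification \<open>X' = Y' \<oplus> Z'\<close> writes \<open>G \<in> X'\<close> uniquely as
  \<open>G (u + v) = H u + H' v\<close> with \<open>H \<in> Y'\<close>, \<open>H' \<in> Z'\<close>.  For \<open>H \<in> Y'\<close>, the following predicate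
  says that \<open>H\<close> is the image of \<open>G\<close> under the projector of \<open>X'\<close> onto \<open>Y'\<close> along \<open>Z'\<close>.\<close>

definition dual_component ::
  "(('a \<Rightarrow> complex) \<Rightarrow> real) \<Rightarrow> ('a \<Rightarrow> complex) set \<Rightarrow> ('a \<Rightarrow> complex) set \<Rightarrow>
   (('a \<Rightarrow> complex) \<Rightarrow> complex) \<Rightarrow> (('a \<Rightarrow> complex) \<Rightarrow> complex) \<Rightarrow> bool" where
  "dual_component N Y Z G H \<longleftrightarrow>
     (\<exists>H'\<in>dual_space (norm_topology Z N). \<forall>u\<in>Y. \<forall>v\<in>Z. G (\<lambda>x. u x + v x) = H u + H' v)"


section \<open>Schwartz functions and the Fourier transform on a Euclidean space\<close>

definition ddiff :: "'a::euclidean_space \<Rightarrow> ('a \<Rightarrow> complex) \<Rightarrow> 'a \<Rightarrow> complex" where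
  "ddiff b f x = frechet_derivative f (at x) b"

definition partials :: "'a::euclidean_space list \<Rightarrow> ('a \<Rightarrow> complex) \<Rightarrow> 'a \<Rightarrow> complex" where
  "partials bs f = foldr ddiff bs f"

definition schwartz :: "('a::euclidean_space \<Rightarrow> complex) set" where
  "schwartz = {f. \<forall>bs\<in>lists Basis.
     (\<forall>x. partials bs f differentiable (at x)) \<and>
     (\<forall>n::nat. bdd_above (range (\<lambda>x. (1 + norm x) ^ n * norm (partials bs f x))))}"

definition schwartz_seminorm ::
  "nat \<Rightarrow> 'a::euclidean_space list \<Rightarrow> ('a \<Rightarrow> complex) \<Rightarrow> real" where
  "schwartz_seminorm n bs f = (SUP x. (1 + norm x) ^ n * norm (partials bs f x))"

definition schwartz_topology :: "('a::euclidean_space \<Rightarrow> complex) topology" where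
  "schwartz_topology = seminorm_topology schwartz {schwartz_seminorm n bs | n bs. bs \<in> lists Basis}"

definition fourier :: "('a::euclidean_space \<Rightarrow> complex) \<Rightarrow> 'a \<Rightarrow> complex" where
  "fourier f w = (\<integral>t. cis (- (w \<bullet> t)) * f t \<partial>lborel)"

definition inv_fourier :: "('a::euclidean_space \<Rightarrow> complex) \<Rightarrow> 'a \<Rightarrow> complex" where
  "inv_fourier g t = of_real (1 / (2 * pi) ^ DIM('a)) * (\<integral>w. cis (w \<bullet> t) * g w \<partial>lborel)"


section \<open>The Stiefel manifold and \<open>\<Xi>\<^sub>k\<close>\<close>

text \<open>The dimensions are \<open>d = CARD('d)\<close> and \<open>d - k = CARD('m)\<close>; \<open>k\<close> itself is carried as a
  natural number wherever it occurs in a formula.\<close>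

definition stiefel :: "(real^'d^'m) set" where
  "stiefel = {A. A ** transpose A = mat 1}"

type_synonym ('d, 'm) xi = "(real^'d^'m) \<times> (real^'m)"

definition Xi :: "('d::finite, 'm::finite) xi set" where
  "Xi = stiefel \<times> UNIV"

text \<open>\<open>sphere_area m\<close> is the surface area of the unit sphere of \<open>\<real>\<^bsup>m+1\<^esup>\<close>; it is \<open>2\<close> for \<open>m = 0\<close>.\<close>

definition sphere_area :: "nat \<Rightarrow> real" where
  "sphere_area m = 2 * pi powr (real (m + 1) / 2) / Gamma (real (m + 1) / 2)"

text \<open>The orthogonal group \<open>O(d)\<close> acts transitively on the Stiefel manifold by right
  multiplication, so invariance and total mass determine the measure.\<close>

definition stiefel_haar :: "nat \<Rightarrow> (real^'d^'m) measure \<Rightarrow> bool" where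
  "stiefel_haar k \<sigma> \<longleftrightarrow> sets \<sigma> = sets borel \<and>
     emeasure \<sigma> (- stiefel) = 0 \<and>
     emeasure \<sigma> stiefel = ennreal (\<Prod>n=k+1..CARD('d). sphere_area (n - 1)) \<and>
     (\<forall>U::real^'d^'d. orthogonal_matrix U \<longrightarrow> distr \<sigma> borel (\<lambda>A. A ** U) = \<sigma>)"

text \<open>Rotation by the angle \<open>s\<close> in the coordinate plane of \<open>i \<noteq> j\<close>.\<close>

definition givens :: "'d \<Rightarrow> 'd \<Rightarrow> real \<Rightarrow> real^'d^'d" where
  "givens i j s = (\<chi> a b.
     if i = j then (if a = b then 1 else 0)
     else if (a = i \<and> b = i) \<or> (a = j \<and> b = j) then cos s
     else if a = i \<and> b = j then - sin s
     else if a = j \<and> b = i then sin s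
     else if a = b then 1 else 0)"

text \<open>
  Smoothness on \<open>\<Xi>\<^sub>k\<close> is expressed by vector fields: those generated by \<open>A \<mapsto> A ** givens i j s\<close>
  span the tangent space of the Stiefel manifold at each of its points (the orbit of a point under
  rotations is the whole manifold), and the translations span the directions of \<open>t\<close>.  A function
  is thus \<open>C\<^sup>\<infinity>\<close> iff all its iterated derivatives along these fields exist and are continuous, and
  these derivatives generate all differential operators.
\<close>

datatype ('d, 'm) xi_dir = Rotate 'd 'd | Shift 'm

fun xi_flow :: "('d::finite, 'm::finite) xi_dir \<Rightarrow> real \<Rightarrow> ('d, 'm) xi \<Rightarrow> ('d, 'm) xi" where
  "xi_flow (Rotate i j) s (A, t) = (A ** givens i j s, t)"
| "xi_flow (Shift l) s (A, t) = (A, t + s *\<^sub>R axis l 1)"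

definition xi_diff ::
  "('d::finite, 'm::finite) xi_dir \<Rightarrow> (('d, 'm) xi \<Rightarrow> complex) \<Rightarrow> ('d, 'm) xi \<Rightarrow> complex" where
  "xi_diff D \<psi> p = vector_derivative (\<lambda>s. \<psi> (xi_flow D s p)) (at 0)"

definition xi_partials ::
  "('d::finite, 'm::finite) xi_dir list \<Rightarrow> (('d, 'm) xi \<Rightarrow> complex) \<Rightarrow> ('d, 'm) xi \<Rightarrow> complex" where
  "xi_partials Ds \<psi> = foldr xi_diff Ds \<psi>"

definition xi_schwartz :: "(('d::finite, 'm::finite) xi \<Rightarrow> complex) set" where
  "xi_schwartz = {\<psi>. (\<forall>p. p \<notin> Xi \<longrightarrow> \<psi> p = 0) \<and>
     (\<forall>Ds. continuous_on Xi (xi_partials Ds \<psi>) \<and>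
       (\<forall>D. \<forall>p\<in>Xi. (\<lambda>s. xi_partials Ds \<psi> (xi_flow D s p)) differentiable (at 0)) \<and>
       (\<forall>n::nat. bdd_above ((\<lambda>(A, t). (1 + norm t) ^ n * norm (xi_partials Ds \<psi> (A, t))) ` Xi)))}"

definition xi_seminorm ::
  "nat \<Rightarrow> ('d::finite, 'm::finite) xi_dir list \<Rightarrow> (('d, 'm) xi \<Rightarrow> complex) \<Rightarrow> real" where
  "xi_seminorm n Ds \<psi> = (SUP (A, t)\<in>Xi. (1 + norm t) ^ n * norm (xi_partials Ds \<psi> (A, t)))"

definition xi_schwartz_topology :: "(('d::finite, 'm::finite) xi \<Rightarrow> complex) topology" where
  "xi_schwartz_topology = seminorm_topology xi_schwartz {xi_seminorm n Ds | n Ds. True}"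


section \<open>The \<open>k\<close>-plane transform, its dual and the filtering operators\<close>

text \<open>Lebesgue measure on a linear subspace \<open>W\<close>, in coordinates with respect to an orthonormal
  basis; rotation invariance makes it independent of that basis.\<close>

definition onb_of :: "'a::euclidean_space set \<Rightarrow> 'a set" where
  "onb_of W = (SOME B. pairwise orthogonal B \<and> (\<forall>b\<in>B. norm b = 1) \<and> span B = W)"

definition subspace_lborel :: "'a::euclidean_space set \<Rightarrow> 'a measure" where
  "subspace_lborel W =
     distr (\<Pi>\<^sub>M b\<in>onb_of W. lborel) borel (\<lambda>y. \<Sum>b\<in>onb_of W. y b *\<^sub>R b)"

definition kplane :: "(real^'d \<Rightarrow> complex) \<Rightarrow> ('d::finite, 'm::finite) xi \<Rightarrow> complex" where
  "kplane \<phi> = (\<lambda>(A, t). if A \<in> stiefel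
     then (\<integral>x. \<phi> (x + transpose A *v t) \<partial>subspace_lborel {x. A *v x = 0}) else 0)"

definition kplane_adj ::
  "(real^'d^'m) measure \<Rightarrow> (('d::finite, 'm::finite) xi \<Rightarrow> complex) \<Rightarrow> real^'d \<Rightarrow> complex" where
  "kplane_adj \<sigma> g x = (\<integral>A. g (A, A *v x) \<partial>\<sigma>)"

definition kplane_const :: "nat \<Rightarrow> nat \<Rightarrow> real" where
  "kplane_const d k = 1 / (2 * pi) ^ k * (sphere_area (k - 1) / sphere_area (d - k - 1)) *
     inverse (\<Prod>n=k..d-1. sphere_area (n - 1))"

definition K_response :: "nat \<Rightarrow> nat \<Rightarrow> real^'m \<Rightarrow> real" where
  "K_response d k w = kplane_const d k * norm w ^ k"

definition K_op :: "nat \<Rightarrow> (('d::finite, 'm::finite) xi \<Rightarrow> complex) \<Rightarrow> ('d, 'm) xi \<Rightarrow> complex" where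
  "K_op k g = (\<lambda>(A, t).
     inv_fourier (\<lambda>w. of_real (K_response CARD('d) k w) * fourier (\<lambda>s. g (A, s)) w) t)"

definition K_inv :: "nat \<Rightarrow> (('d::finite, 'm::finite) xi \<Rightarrow> complex) \<Rightarrow> ('d, 'm) xi \<Rightarrow> complex" where
  "K_inv k g = (\<lambda>(A, t).
     inv_fourier (\<lambda>w. of_real (inverse (K_response CARD('d) k w)) * fourier (\<lambda>s. g (A, s)) w) t)"

definition S_k :: "(('d::finite, 'm::finite) xi \<Rightarrow> complex) set" where
  "S_k = kplane ` schwartz"

definition S_k_topology :: "(('d::finite, 'm::finite) xi \<Rightarrow> complex) topology" where
  "S_k_topology = subtopology xi_schwartz_topology S_k"

definition KR_range :: "nat \<Rightarrow> (('d::finite, 'm::finite) xi \<Rightarrow> complex) set" where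
  "KR_range k = (\<lambda>\<phi>. K_op k (kplane \<phi>)) ` schwartz"

text \<open>The dual transform is a bijection of \<open>KR_range k\<close> onto the Schwartz space, so it is a
  homeomorphism for the pullback topology.\<close>

definition KR_topology ::
  "nat \<Rightarrow> (real^'d^'m) measure \<Rightarrow> (('d::finite, 'm::finite) xi \<Rightarrow> complex) topology" where
  "KR_topology k \<sigma> = pullback_topology (KR_range k) (kplane_adj \<sigma>) schwartz_topology"


section \<open>Distributional operators and ridges\<close>

definition kplane_dist ::
  "nat \<Rightarrow> (real^'d^'m) measure \<Rightarrow> ((real^'d \<Rightarrow> complex) \<Rightarrow> complex) \<Rightarrow>
   (('d::finite, 'm::finite) xi \<Rightarrow> complex) \<Rightarrow> complex" where
  "kplane_dist k \<sigma> = dual_map (KR_range k) (kplane_adj \<sigma>)"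

definition filtered_kplane_dist ::
  "nat \<Rightarrow> (real^'d^'m) measure \<Rightarrow> ((real^'d \<Rightarrow> complex) \<Rightarrow> complex) \<Rightarrow>
   (('d::finite, 'm::finite) xi \<Rightarrow> complex) \<Rightarrow> complex" where
  "filtered_kplane_dist k \<sigma> = dual_map S_k (\<lambda>\<psi>. kplane_adj \<sigma> (K_op k \<psi>))"

definition kplane_adj_dist ::
  "((('d::finite, 'm::finite) xi \<Rightarrow> complex) \<Rightarrow> complex) \<Rightarrow> (real^'d \<Rightarrow> complex) \<Rightarrow> complex" where
  "kplane_adj_dist = dual_map schwartz kplane"

definition Pk_star ::
  "nat \<Rightarrow> (real^'d^'m) measure \<Rightarrow> ((('d::finite, 'm::finite) xi \<Rightarrow> complex) \<Rightarrow> complex) \<Rightarrow>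
   (('d, 'm) xi \<Rightarrow> complex) \<Rightarrow> complex" where
  "Pk_star k \<sigma> g = filtered_kplane_dist k \<sigma> (kplane_adj_dist g)"

definition translate_dist ::
  "'a::euclidean_space \<Rightarrow> (('a \<Rightarrow> complex) \<Rightarrow> complex) \<Rightarrow> ('a \<Rightarrow> complex) \<Rightarrow> complex" where
  "translate_dist t0 = dual_map schwartz (\<lambda>\<phi> t. \<phi> (t + t0))"

definition ridge ::
  "((real^'m \<Rightarrow> complex) \<Rightarrow> complex) \<Rightarrow> real^'d^'m \<Rightarrow> (real^'d \<Rightarrow> complex) \<Rightarrow> complex" where
  "ridge r A = dual_map schwartz (\<lambda>\<phi> t. kplane \<phi> (A, t)) r"

definition delta_ridge ::
  "real^'d^'m \<Rightarrow> real^'m \<Rightarrow> ((real^'m \<Rightarrow> complex) \<Rightarrow> complex) \<Rightarrow>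
   (('d::finite, 'm::finite) xi \<Rightarrow> complex) \<Rightarrow> complex" where
  "delta_ridge A0 t0 r = dual_map xi_schwartz (\<lambda>\<psi> t. \<psi> (A0, t)) (translate_dist t0 r)"

definition S_k_class ::
  "((('d::finite, 'm::finite) xi \<Rightarrow> complex) \<Rightarrow> complex) \<Rightarrow> (('d, 'm) xi \<Rightarrow> complex) \<Rightarrow> complex" where
  "S_k_class = dual_map S_k (\<lambda>\<psi>. \<psi>)"

text \<open>The class of \<open>\<delta>(\<cdot> - A\<^sub>0) (q * r)(\<cdot> - t\<^sub>0)\<close>: since \<open>q\<close> is even, the convolution with \<open>q\<close> is moved
  to the test function, where it is the inverse filter.\<close>

definition filtered_delta_ridge_class ::
  "nat \<Rightarrow> real^'d^'m \<Rightarrow> real^'m \<Rightarrow> ((real^'m \<Rightarrow> complex) \<Rightarrow> complex) \<Rightarrow>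
   (('d::finite, 'm::finite) xi \<Rightarrow> complex) \<Rightarrow> complex" where
  "filtered_delta_ridge_class k A0 t0 r =
     dual_map (KR_range k) (\<lambda>\<psi> t. K_inv k \<psi> (A0, t)) (translate_dist t0 r)"


section \<open>Compatible Banach spaces\<close>

text \<open>The canonical embedding of test functions into distributions on \<open>\<Xi>\<^sub>k\<close>.\<close>

definition xi_embed ::
  "(real^'d^'m) measure \<Rightarrow> (('d::finite, 'm::finite) xi \<Rightarrow> complex) \<Rightarrow>
   (('d, 'm) xi \<Rightarrow> complex) \<Rightarrow> complex" where
  "xi_embed \<sigma> f = (\<lambda>\<psi>. if \<psi> \<in> xi_schwartz then (\<integral>p. f p * \<psi> p \<partial>(\<sigma> \<Otimes>\<^sub>M lborel)) else 0)"

text \<open>A Banach space continuously embedded in the distributions is taken to be a set of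
  distributions with its own norm.\<close>

definition xi_compatible ::
  "(real^'d^'m) measure \<Rightarrow> ((('d::finite, 'm::finite) xi \<Rightarrow> complex) \<Rightarrow> complex) set \<Rightarrow>
   (((('d, 'm) xi \<Rightarrow> complex) \<Rightarrow> complex) \<Rightarrow> real) \<Rightarrow> bool" where
  "xi_compatible \<sigma> X N \<longleftrightarrow> complex_banach X N \<and>
     X \<subseteq> dual_space xi_schwartz_topology \<and>
     xi_embed \<sigma> ` xi_schwartz \<subseteq> X \<and>
     continuous_map xi_schwartz_topology (norm_topology X N) (xi_embed \<sigma>) \<and>
     norm_topology X N closure_of (xi_embed \<sigma> ` xi_schwartz) = X \<and>
     continuous_map (norm_topology X N) (weak_star_topology xi_schwartz_topology) (\<lambda>f. f) \<and>
     weak_star_topology xi_schwartz_topology closure_of X = dual_space xi_schwartz_topology"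

definition X_k ::
  "(real^'d^'m) measure \<Rightarrow> ((('d::finite, 'm::finite) xi \<Rightarrow> complex) \<Rightarrow> complex) set \<Rightarrow>
   (((('d, 'm) xi \<Rightarrow> complex) \<Rightarrow> complex) \<Rightarrow> real) \<Rightarrow> ((('d, 'm) xi \<Rightarrow> complex) \<Rightarrow> complex) set" where
  "X_k \<sigma> X N = norm_topology X N closure_of (xi_embed \<sigma> ` S_k)"

text \<open>The injections of \<open>X'\<close> into the distributions on \<open>\<Xi>\<^sub>k\<close> and of \<open>X\<^sub>k'\<close> into \<open>S\<^sub>k'\<close> are the
  transposes of the dense embeddings of the test spaces.\<close>

definition X_dual_embed ::
  "(real^'d^'m) measure \<Rightarrow> (((('d::finite, 'm::finite) xi \<Rightarrow> complex) \<Rightarrow> complex) \<Rightarrow> complex) \<Rightarrow>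
   (('d, 'm) xi \<Rightarrow> complex) \<Rightarrow> complex" where
  "X_dual_embed \<sigma> = dual_map xi_schwartz (xi_embed \<sigma>)"

definition X_k_dual_embed ::
  "(real^'d^'m) measure \<Rightarrow> (((('d::finite, 'm::finite) xi \<Rightarrow> complex) \<Rightarrow> complex) \<Rightarrow> complex) \<Rightarrow>
   (('d, 'm) xi \<Rightarrow> complex) \<Rightarrow> complex" where
  "X_k_dual_embed \<sigma> = dual_map S_k (xi_embed \<sigma>)"

end

theory Submission
  imports Defs "HOL-Probability.Probability"
begin

text \<open>Everything is reduced to the inversion formula \<open>R\<^sup>* K R \<phi> = \<phi>\<close>: a ridge tested against
  \<open>R\<^sup>* K \<psi>\<close> with \<open>\<psi> = R \<phi>\<close> is the profile tested against the slice of \<open>R R\<^sup>* K R \<phi> = \<psi>\<close>.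
  By the Fourier slice theorem the formula amounts to
  \<open>\<integral>\<integral> norm w ^ k * F (A\<^sup>T w) dw d\<sigma>(A) = c * \<integral> F\<close> for \<open>F\<close> the Fourier transform of a Schwartz
  function.  Invariance of \<open>\<sigma>\<close> under right multiplication, with an exchange of two Stiefel
  matrices, shows that \<open>\<integral> cis (- (w \<bullet> A y)) d\<sigma>(A)\<close> depends on \<open>norm w * norm y\<close> only, and both
  sides become the same radial integral.  That \<open>K\<^sup>-\<^sup>1 K\<close> is the identity needs the filtered
  slices to be integrable although \<open>norm w ^ k\<close> is not smooth for odd \<open>k\<close>; the last claim is obtained
  by restricting the functional to the two summands.\<close>

section \<open>Schwartz functions\<close>

text \<open>Averaging over the rotations of the full space would identify the two radial integrals
  at once, but only \<sigma> is given. Its substitute: for fixed \<open>w\<close> the vectors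
  \<open>transpose A *v w\<close> sweep the sphere of radius \<open>norm w\<close>, so one radial
  function \<open>hankel \<psi>\<close> describes the averages of the Fourier transform in dimension
  d - k and, after a cutoff to balls that makes Fubini legitimate, in dimension d as well. The power
  k of the filter is the difference of the two dimensions; the constant collects the ratio of two
  sphere areas, the mass of \<sigma> and the powers of 2 pi. Functionals take the value 0 outside
  their test space. The identities therefore say what they should only once slices are known to be
  Schwartz functions and \<open>S_k\<close> to lie in \<open>xi_schwartz\<close>. Both facts are
  obtained on the Fourier side, where a slice is the inverse transform of a Schwartz function
  composed with an isometric embedding, and where derivatives on \<open>Xi\<close> act on the
  integrand.\<close>

lemma tendsto_integral_dominated:
  fixes f :: "'p::first_countable_topology \<Rightarrow> 'x \<Rightarrow> 'b::{banach, second_countable_topology}"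
  assumes lim: "\<And>x. x \<in> space M \<Longrightarrow> ((\<lambda>p. f p x) \<longlongrightarrow> l x) (at a within S)"
    and bd: "\<And>p x. p \<in> S \<Longrightarrow> x \<in> space M \<Longrightarrow> norm (f p x) \<le> g x"
    and meas: "\<And>p. p \<in> S \<Longrightarrow> f p \<in> borel_measurable M" "l \<in> borel_measurable M"
    and g: "integrable M g"
  shows "((\<lambda>p. \<integral>x. f p x \<partial>M) \<longlongrightarrow> (\<integral>x. l x \<partial>M)) (at a within S)"
  unfolding tendsto_at_iff_sequentially comp_def
proof (intro allI impI)
  fix X :: "nat \<Rightarrow> 'p"
  assume X: "\<forall>i. X i \<in> S - {a}" "X \<longlonglongrightarrow> a"
  show "(\<lambda>i. \<integral>x. f (X i) x \<partial>M) \<longlonglongrightarrow> (\<integral>x. l x \<partial>M)"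
  proof (rule integral_dominated_convergence[where w = g])
    show "AE x in M. (\<lambda>i. f (X i) x) \<longlonglongrightarrow> l x"
      using lim X by (intro AE_I2) (auto simp: tendsto_at_iff_sequentially comp_def)
    show "\<And>i. AE x in M. norm (f (X i) x) \<le> g x"
      using bd X(1) by (intro AE_I2) auto
  qed (use X(1) meas g in auto)
qed

text \<open>The mean value inequality bounds the difference quotients for s in [-1, 1] by
  \<open>g\<close>, and dominated convergence does the rest. Restricting s to this interval keeps
  translations by s v within a bounded distance, which polynomial weights tolerate.\<close>

lemma has_vector_derivative_integral:
  fixes u :: "real \<Rightarrow> 'x \<Rightarrow> complex"
  assumes int: "\<And>s. integrable M (u s)"
    and deriv: "\<And>s x. x \<in> space M \<Longrightarrow> ((\<lambda>s. u s x) has_vector_derivative u' s x) (at s)"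
    and bd: "\<And>s x. x \<in> space M \<Longrightarrow> \<bar>s\<bar> \<le> 1 \<Longrightarrow> norm (u' s x) \<le> g x"
    and meas: "u' 0 \<in> borel_measurable M"
    and g: "integrable M g"
  shows "((\<lambda>s. \<integral>x. u s x \<partial>M) has_vector_derivative (\<integral>x. u' 0 x \<partial>M)) (at 0)"
proof -
  have int': "integrable M (u' 0)"
    by (rule Bochner_Integration.integrable_bound[OF g meas]) (use bd in \<open>auto intro!: AE_I2 order_trans[OF _ abs_ge_self]\<close>)
  have quotient: "((f has_vector_derivative D) (at 0 within S)) \<longleftrightarrow> ((\<lambda>y. (f y - f 0) /\<^sub>R y - D) \<longlongrightarrow> 0) (at 0 within S)"
    for f :: "real \<Rightarrow> complex" and D S
  proof -
    have "norm ((1 / norm (y - 0)) *\<^sub>R (f y - (f 0 + (y - 0) *\<^sub>R D))) = norm ((f y - f 0) /\<^sub>R y - D)" if "y \<noteq> 0" for y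
    proof -
      have "(f y - f 0) /\<^sub>R y - D = (f y - (f 0 + y *\<^sub>R D)) /\<^sub>R y"
        using that by (simp add: algebra_simps)
      then show ?thesis by (simp add: divide_inverse)
    qed
    then have "((\<lambda>y. norm ((1 / norm (y - 0)) *\<^sub>R (f y - (f 0 + (y - 0) *\<^sub>R D)))) \<longlongrightarrow> 0) (at 0 within S) \<longleftrightarrow>
        ((\<lambda>y. norm ((f y - f 0) /\<^sub>R y - D)) \<longlongrightarrow> 0) (at 0 within S)"
      by (intro filterlim_cong refl) (auto simp: eventually_at_filter)
    then show ?thesis
      unfolding has_vector_derivative_def has_derivative_within tendsto_norm_zero_iff
      by (simp add: bounded_linear_scaleR_left)
  qed
  have "((\<lambda>s. \<integral>x. (u s x - u 0 x) /\<^sub>R s \<partial>M) \<longlongrightarrow> (\<integral>x. u' 0 x \<partial>M)) (at 0 within {-1..1})"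
  proof (rule tendsto_integral_dominated[where g = g])
    fix x assume x: "x \<in> space M"
    have "((\<lambda>s. u s x) has_vector_derivative u' 0 x) (at 0 within {-1..1})"
      using deriv[OF x] has_vector_derivative_at_within by blast
    then have "((\<lambda>y. (u y x - u 0 x) /\<^sub>R y - u' 0 x) \<longlongrightarrow> 0) (at 0 within {-1..1})"
      unfolding quotient .
    then show "((\<lambda>s. (u s x - u 0 x) /\<^sub>R s) \<longlongrightarrow> u' 0 x) (at 0 within {-1..1})"
      by (rule LIM_zero_cancel)
  next
    fix s :: real and x assume s: "s \<in> {-1..1}" and x: "x \<in> space M"
    have "norm (u s x - u 0 x) \<le> g x * norm (s - 0)"
    proof (rule differentiable_bound[where S = "{-1..1}" and f' = "\<lambda>y h. h *\<^sub>R u' y x"])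
      show "((\<lambda>s. u s x) has_derivative (\<lambda>h. h *\<^sub>R u' y x)) (at y within {- 1..1})" for y
        using deriv[OF x, of y] has_derivative_at_withinI unfolding has_vector_derivative_def by blast
      show "onorm (\<lambda>h. h *\<^sub>R u' y x) \<le> g x" if "y \<in> {-1..1}" for y :: real
        using that by (intro onorm_le) (use bd[OF x] in \<open>auto intro!: mult_left_mono simp: mult.commute[of "g x"]\<close>)
    qed (use s in auto)
    then show "norm ((u s x - u 0 x) /\<^sub>R s) \<le> g x"
      using order_trans[OF norm_ge_zero bd[OF x, of 0]]
      by (cases "s = 0") (auto simp: divide_simps mult.commute)
  qed (use int meas g in auto)
  moreover have "at 0 within {-1..1::real} = at 0"
    by (rule at_within_interior) (simp add: interior_atLeastAtMost_real)
  moreover have "(\<lambda>s. \<integral>x. (u s x - u 0 x) /\<^sub>R s \<partial>M) = (\<lambda>s. ((\<integral>x. u s x \<partial>M) - (\<integral>x. u 0 x \<partial>M)) /\<^sub>R s)"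
    by (simp only: integral_scaleR_right Bochner_Integration.integral_diff[OF int int])
  ultimately have *: "((\<lambda>s. ((\<integral>x. u s x \<partial>M) - (\<integral>x. u 0 x \<partial>M)) /\<^sub>R s) \<longlongrightarrow> (\<integral>x. u' 0 x \<partial>M)) (at 0)"
    by metis
  from LIM_zero[OF *] show ?thesis unfolding quotient .
qed

text \<open>A remainder of second order is what \<open>cis_approx\<close> provides when the Fourier
  integral is differentiated.\<close>

lemma has_derivative_quadratic:
  fixes f :: "'a::real_normed_vector \<Rightarrow> 'b::real_normed_vector"
  assumes "bounded_linear f'" and bd: "\<And>h. norm (f (x + h) - f x - f' h) \<le> C * (norm h)\<^sup>2"
  shows "(f has_derivative f') (at x)"
  unfolding has_derivative_at
proof (intro conjI)
  show "(\<lambda>h. norm (f (x + h) - f x - f' h) / norm h) \<midarrow>0\<rightarrow> 0"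
  proof (rule tendsto_sandwich[of "\<lambda>_. 0" _ _ "\<lambda>h. C * norm h"])
    show "\<forall>\<^sub>F h in at 0. norm (f (x + h) - f x - f' h) / norm h \<le> C * norm h"
      unfolding eventually_at_filter
      by (rule always_eventually) (use bd in \<open>auto simp: divide_simps power2_eq_square mult_ac\<close>)
    show "(\<lambda>h. C * norm h) \<midarrow>0\<rightarrow> 0"
      by (auto intro!: tendsto_eq_intros)
  qed auto
qed fact

text \<open>Peetre's inequality: |x| \<le> |x + a| + |a|, and the product on the right only adds a
  nonnegative term. It carries polynomial decay through translations.\<close>

lemma weight_translate:
  fixes x a :: "'a::real_normed_vector"
  shows "(1 + norm x) ^ n \<le> (1 + norm a) ^ n * (1 + norm (x + a)) ^ n"
proof -
  have "norm x \<le> norm (x + a) + norm a"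
    using norm_triangle_ineq4[of "x + a" a] by simp
  moreover have "0 \<le> norm a * norm (x + a)" by simp
  ultimately have "1 + norm x \<le> (1 + norm a) * (1 + norm (x + a))"
    unfolding distrib_left distrib_right by linarith
  then show ?thesis
    unfolding power_mult_distrib[symmetric] by (intro power_mono) auto
qed

lemma ddiff_eq: "(f has_derivative f') (at x) \<Longrightarrow> ddiff b f x = f' b"
  unfolding ddiff_def using frechet_derivative_at by metis

lemma has_derivative_ddiff:
  "f differentiable (at x) \<Longrightarrow> (f has_derivative (\<lambda>h. ddiff h f x)) (at x)"
  unfolding ddiff_def by (simp add: frechet_derivative_works)

lemma ddiff_basis:
  fixes f :: "'a::euclidean_space \<Rightarrow> complex"
  assumes "f differentiable (at x)"
  shows "ddiff v f x = (\<Sum>b\<in>Basis. of_real (v \<bullet> b) * ddiff b f x)"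
proof -
  interpret linear "\<lambda>h. ddiff h f x"
    using has_derivative_ddiff[OF assms] by (rule has_derivative_linear)
  have "ddiff v f x = ddiff (\<Sum>b\<in>Basis. (v \<bullet> b) *\<^sub>R b) f x"
    by (simp add: euclidean_representation)
  also have "\<dots> = (\<Sum>b\<in>Basis. of_real (v \<bullet> b) * ddiff b f x)"
    by (simp only: sum scaleR scaleR_conv_of_real)
  finally show ?thesis .
qed

lemma partials_Nil [simp]: "partials [] f = f"
  and partials_Cons [simp]: "partials (b # bs) f = ddiff b (partials bs f)"
  and partials_append: "partials (bs @ cs) f = partials bs (partials cs f)"
  by (simp_all add: partials_def)

text \<open>Membership is shown by exhibiting a class \<open>M\<close> stable under the basis
  derivatives, which avoids formulas for iterated derivatives of a particular function. The
  induction over the list of directions happens once, here.\<close>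

lemma schwartzI:
  assumes "f \<in> M"
    and diff: "\<And>g x. g \<in> M \<Longrightarrow> g differentiable (at x)"
    and closed: "\<And>g b. g \<in> M \<Longrightarrow> b \<in> Basis \<Longrightarrow> ddiff b g \<in> M"
    and bd: "\<And>g n. g \<in> M \<Longrightarrow> \<exists>C. \<forall>x. (1 + norm x) ^ n * norm (g x) \<le> C"
  shows "f \<in> schwartz"
proof -
  have "partials bs f \<in> M" if "bs \<in> lists Basis" for bs
    using that by induction (use assms(1) closed in auto)
  then show ?thesis
    using diff bd unfolding schwartz_def bdd_above_def by fastforce
qed

lemma schwartz_differentiable: "f \<in> schwartz \<Longrightarrow> f differentiable (at x)"
  unfolding schwartz_def using partials_Nil lists.Nil by (metis (no_types, lifting) mem_Collect_eq)

lemma schwartz_partials: "f \<in> schwartz \<Longrightarrow> cs \<in> lists Basis \<Longrightarrow> partials cs f \<in> schwartz"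
  unfolding schwartz_def by (auto simp: partials_append[symmetric])

lemma schwartz_ddiff_Basis: "f \<in> schwartz \<Longrightarrow> b \<in> Basis \<Longrightarrow> ddiff b f \<in> schwartz"
  using schwartz_partials[of f "[b]"] by auto

lemma schwartz_bound:
  assumes "f \<in> schwartz"
  obtains C where "0 \<le> C" "\<And>x. (1 + norm x) ^ n * norm (f x) \<le> C"
proof -
  have "\<forall>bs\<in>lists Basis. bdd_above (range (\<lambda>x. (1 + norm x) ^ n * norm (partials bs f x)))"
    using assms unfolding schwartz_def by simp
  from bspec[OF this lists.Nil] have "bdd_above (range (\<lambda>x. (1 + norm x) ^ n * norm (f x)))"
    by simp
  then obtain C where C: "\<And>x. (1 + norm x) ^ n * norm (f x) \<le> C"
    unfolding bdd_above_def by auto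
  have "0 \<le> (1 + norm (0::'a)) ^ n * norm (f 0)" by simp
  then have "0 \<le> C" using C[of 0] by linarith
  then show ?thesis using C that by blast
qed

lemma schwartz_decay:
  fixes f :: "'a::euclidean_space \<Rightarrow> complex"
  assumes "f \<in> schwartz"
  obtains C where "0 \<le> C" "\<And>x. norm (f x) \<le> C * inverse ((1 + norm x) ^ n)"
proof -
  obtain C where C: "0 \<le> C" "\<And>x. (1 + norm x) ^ n * norm (f x) \<le> C"
    using schwartz_bound[OF assms] by blast
  have "norm (f x) \<le> C * inverse ((1 + norm x) ^ n)" for x :: 'a
  proof -
    have "(1 + norm x) ^ n > 0" by (intro zero_less_power) (smt (verit) norm_ge_zero)
    then show ?thesis using C(2)[of x] by (simp add: field_simps)
  qed
  then show ?thesis using C that by blast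
qed

lemma schwartz_continuous: "f \<in> schwartz \<Longrightarrow> continuous_on S f"
  by (meson continuous_at_imp_continuous_on differentiable_imp_continuous_within schwartz_differentiable)

lemma schwartz_measurable [measurable_dest]: "f \<in> schwartz \<Longrightarrow> f \<in> borel_measurable borel"
  by (rule borel_measurable_continuous_onI) (rule schwartz_continuous)

lemma schwartz_lincomb:
  fixes f g :: "'a::euclidean_space \<Rightarrow> complex"
  assumes "f \<in> schwartz" "g \<in> schwartz"
  shows "(\<lambda>x. a * f x + b * g x) \<in> schwartz"
proof -
  let ?M = "{\<lambda>x. a * f x + b * g x | f g :: 'a \<Rightarrow> complex. f \<in> schwartz \<and> g \<in> schwartz}"
  show ?thesis
  proof (rule schwartzI[of _ ?M])
    fix h x assume "h \<in> ?M"
    then show "h differentiable (at x)"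
      using schwartz_differentiable by (auto intro!: derivative_intros)
  next
    fix h and c :: 'a assume "h \<in> ?M" and c: "c \<in> Basis"
    then obtain f g :: "'a \<Rightarrow> complex" where fg: "f \<in> schwartz" "g \<in> schwartz"
      and h: "h = (\<lambda>x. a * f x + b * g x)" by blast
    have "ddiff c h x = a * ddiff c f x + b * ddiff c g x" for x
      unfolding h by (rule ddiff_eq) (auto intro!: derivative_eq_intros has_derivative_ddiff schwartz_differentiable fg)
    then have "ddiff c h = (\<lambda>x. a * ddiff c f x + b * ddiff c g x)" by blast
    then show "ddiff c h \<in> ?M"
      using schwartz_ddiff_Basis[OF fg(1) c] schwartz_ddiff_Basis[OF fg(2) c] by blast
  next
    fix h and n :: nat assume "h \<in> ?M"
    then obtain f g :: "'a \<Rightarrow> complex" where fg: "f \<in> schwartz" "g \<in> schwartz"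
      and h: "h = (\<lambda>x. a * f x + b * g x)" by blast
    obtain C where C: "0 \<le> C" "\<And>x. (1 + norm x) ^ n * norm (f x) \<le> C"
      using schwartz_bound[OF fg(1)] by blast
    obtain D where D: "0 \<le> D" "\<And>x. (1 + norm x) ^ n * norm (g x) \<le> D"
      using schwartz_bound[OF fg(2)] by blast
    have "(1 + norm x) ^ n * norm (h x) \<le> norm a * C + norm b * D" for x
    proof -
      have "(1 + norm x) ^ n * norm (h x) \<le> (1 + norm x) ^ n * (norm a * norm (f x) + norm b * norm (g x))"
        unfolding h by (intro mult_left_mono order_trans[OF norm_triangle_ineq]) (auto simp: norm_mult)
      also have "\<dots> = norm a * ((1 + norm x) ^ n * norm (f x)) + norm b * ((1 + norm x) ^ n * norm (g x))"
        by (simp add: algebra_simps)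
      also have "\<dots> \<le> norm a * C + norm b * D"
        using C D by (intro add_mono mult_left_mono) auto
      finally show ?thesis .
    qed
    then show "\<exists>C. \<forall>x. (1 + norm x) ^ n * norm (h x) \<le> C" by blast
  qed (use assms in blast)
qed

lemma schwartz_zero: "(\<lambda>_. 0) \<in> schwartz"
proof (rule schwartzI[of _ "{\<lambda>_. 0}"])
  fix g :: "'a \<Rightarrow> complex" and b assume g: "g \<in> {\<lambda>_. 0}"
  then have "g = (\<lambda>_. 0)" by simp
  then show "ddiff b g \<in> {\<lambda>_. 0}"
    by (auto simp: ddiff_def)
qed auto

lemma schwartz_scale: "f \<in> schwartz \<Longrightarrow> (\<lambda>x. a * f x) \<in> schwartz"
  using schwartz_lincomb[OF _ schwartz_zero, of f a 0] by simp

lemma schwartz_add: "f \<in> schwartz \<Longrightarrow> g \<in> schwartz \<Longrightarrow> (\<lambda>x. f x + g x) \<in> schwartz"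
  using schwartz_lincomb[of f g 1 1] by simp

lemma schwartz_diff: "f \<in> schwartz \<Longrightarrow> g \<in> schwartz \<Longrightarrow> (\<lambda>x. f x - g x) \<in> schwartz"
  using schwartz_lincomb[of f g 1 "-1"] by simp

lemma schwartz_sum:
  "finite I \<Longrightarrow> (\<And>i. i \<in> I \<Longrightarrow> f i \<in> schwartz) \<Longrightarrow> (\<lambda>x. \<Sum>i\<in>I. f i x) \<in> schwartz"
  by (induction I rule: finite_induct) (auto intro: schwartz_zero schwartz_add)

lemma schwartz_ddiff:
  assumes "f \<in> schwartz"
  shows "ddiff v f \<in> schwartz"
proof -
  have "ddiff v f = (\<lambda>x. \<Sum>b\<in>Basis. of_real (v \<bullet> b) * ddiff b f x)"
    using ddiff_basis schwartz_differentiable[OF assms] by blast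
  then show ?thesis
    by (simp add: schwartz_sum schwartz_scale schwartz_ddiff_Basis assms)
qed

lemma schwartz_mult_inner:
  fixes f :: "'a::euclidean_space \<Rightarrow> complex"
  assumes "f \<in> schwartz"
  shows "(\<lambda>x. of_real (x \<bullet> v) * f x) \<in> schwartz"
proof -
  have dh: "((\<lambda>x. of_real (x \<bullet> v) * f x + g x) has_derivative
      (\<lambda>h. of_real (x \<bullet> v) * ddiff h f x + of_real (h \<bullet> v) * f x + ddiff h g x)) (at x)"
    if "f \<in> schwartz" "g \<in> schwartz" for f g :: "'a \<Rightarrow> complex" and x
    using that
    by (intro has_derivative_add has_derivative_mult has_derivative_of_real has_derivative_inner_left
      has_derivative_ident has_derivative_ddiff schwartz_differentiable)
  \<comment> \<open>The product rule leaves a term without the factor x \<bullet> v, so the class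
    needs the extra summand g to be stable.\<close>
  let ?M = "{\<lambda>x. of_real (x \<bullet> v) * f x + g x | f g :: 'a \<Rightarrow> complex. f \<in> schwartz \<and> g \<in> schwartz}"
  show ?thesis
  proof (rule schwartzI[of _ ?M])
    show "(\<lambda>x. of_real (x \<bullet> v) * f x) \<in> ?M"
      using assms schwartz_zero by force
  next
    fix h x assume "h \<in> ?M"
    then obtain f g :: "'a \<Rightarrow> complex" where fg: "f \<in> schwartz" "g \<in> schwartz"
      and h: "h = (\<lambda>x. of_real (x \<bullet> v) * f x + g x)" by blast
    show "h differentiable (at x)" unfolding h differentiable_def
      using dh[OF fg] by blast
  next
    fix h and c :: 'a assume "h \<in> ?M" and c: "c \<in> Basis"
    then obtain f g :: "'a \<Rightarrow> complex" where fg: "f \<in> schwartz" "g \<in> schwartz"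
      and h: "h = (\<lambda>x. of_real (x \<bullet> v) * f x + g x)" by blast
    have "ddiff c h x = of_real (x \<bullet> v) * ddiff c f x + (of_real (c \<bullet> v) * f x + ddiff c g x)" for x
      unfolding h using ddiff_eq[OF dh[OF fg]] by simp
    then have "ddiff c h = (\<lambda>x. of_real (x \<bullet> v) * ddiff c f x + (of_real (c \<bullet> v) * f x + ddiff c g x))" by blast
    moreover have "(\<lambda>x. of_real (c \<bullet> v) * f x + ddiff c g x) \<in> schwartz"
      using schwartz_lincomb[OF fg(1) schwartz_ddiff_Basis[OF fg(2) c], of "of_real (c \<bullet> v)" 1] by simp
    ultimately show "ddiff c h \<in> ?M"
      using schwartz_ddiff_Basis[OF fg(1) c]
      by (intro CollectI exI[of _ "ddiff c f"] exI[of _ "\<lambda>x. of_real (c \<bullet> v) * f x + ddiff c g x"]) simp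
  next
    fix h and n :: nat assume "h \<in> ?M"
    then obtain f g :: "'a \<Rightarrow> complex" where fg: "f \<in> schwartz" "g \<in> schwartz"
      and h: "h = (\<lambda>x. of_real (x \<bullet> v) * f x + g x)" by blast
    obtain C where C: "0 \<le> C" "\<And>x. (1 + norm x) ^ (Suc n) * norm (f x) \<le> C"
      using schwartz_bound[OF fg(1)] by blast
    obtain D where D: "0 \<le> D" "\<And>x. (1 + norm x) ^ n * norm (g x) \<le> D"
      using schwartz_bound[OF fg(2)] by blast
    have "(1 + norm x) ^ n * norm (h x) \<le> norm v * C + D" for x
    proof -
      have "\<bar>x \<bullet> v\<bar> \<le> norm v * (1 + norm x)"
        using Cauchy_Schwarz_ineq2[of x v] by (simp add: algebra_simps) (smt (verit) norm_ge_zero)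
      then have "norm (h x) \<le> norm v * (1 + norm x) * norm (f x) + norm (g x)"
        unfolding h by (intro order_trans[OF norm_triangle_ineq]) (auto simp: norm_mult intro!: mult_right_mono)
      then have "(1 + norm x) ^ n * norm (h x) \<le> (1 + norm x) ^ n * (norm v * (1 + norm x) * norm (f x) + norm (g x))"
        by (intro mult_left_mono) auto
      also have "\<dots> = norm v * ((1 + norm x) ^ (Suc n) * norm (f x)) + ((1 + norm x) ^ n * norm (g x))"
        by (simp add: algebra_simps)
      also have "\<dots> \<le> norm v * C + D"
        using C D by (intro add_mono mult_left_mono) auto
      finally show ?thesis .
    qed
    then show "\<exists>C. \<forall>x. (1 + norm x) ^ n * norm (h x) \<le> C" by blast
  qed
qed

text \<open>Since \<open>L\<close> preserves norms, decay survives the composition, and derivatives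
  along \<open>v\<close> become derivatives along \<open>L v\<close>. The dimensions may differ:
  besides translation and reflection this covers the embedding of w as
  \<open>transpose A *v w\<close>.\<close>

lemma schwartz_affine:
  fixes f :: "'b::euclidean_space \<Rightarrow> complex" and L :: "'a::euclidean_space \<Rightarrow> 'b"
  assumes "f \<in> schwartz" and L: "linear L" "\<And>x. norm (L x) = norm x"
  shows "(\<lambda>x. f (L x + a)) \<in> schwartz"
    and "ddiff v (\<lambda>x. f (L x + a)) x = ddiff (L v) f (L x + a)"
proof -
  have dd: "((\<lambda>x. f (L x + a)) has_derivative (\<lambda>h. ddiff (L h) f (L x + a))) (at x)"
    if "f \<in> schwartz" for f x
  proof -
    have "((\<lambda>x. L x + a) has_derivative L) (at x)"
      using bounded_linear_imp_has_derivative[OF linear_conv_bounded_linear[THEN iffD1, OF L(1)], of "at x"]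
      by (auto intro!: derivative_eq_intros)
    from diff_chain_at[OF this has_derivative_ddiff[OF schwartz_differentiable[OF that]]]
    show ?thesis by (simp add: o_def)
  qed
  show "ddiff v (\<lambda>x. f (L x + a)) x = ddiff (L v) f (L x + a)"
    using ddiff_eq[OF dd[OF assms(1)]] .
  let ?M = "{\<lambda>x. f (L x + a) | f. f \<in> schwartz}"
  show "(\<lambda>x. f (L x + a)) \<in> schwartz"
  proof (rule schwartzI[of _ ?M])
    fix h x assume "h \<in> ?M"
    then show "h differentiable (at x)" using dd unfolding differentiable_def by blast
  next
    fix h and c :: 'a assume "h \<in> ?M" and c: "c \<in> Basis"
    then obtain f where f: "f \<in> schwartz" "h = (\<lambda>x. f (L x + a))" by blast
    have "ddiff c h = (\<lambda>x. ddiff (L c) f (L x + a))"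
      unfolding f using ddiff_eq[OF dd[OF f(1)]] by blast
    then show "ddiff c h \<in> ?M" using schwartz_ddiff[OF f(1)] by blast
  next
    fix h and n :: nat assume "h \<in> ?M"
    then obtain f where f: "f \<in> schwartz" "h = (\<lambda>x. f (L x + a))" by blast
    obtain C where C: "0 \<le> C" "\<And>x. (1 + norm x) ^ n * norm (f x) \<le> C"
      using schwartz_bound[OF f(1)] by blast
    have "(1 + norm x) ^ n * norm (h x) \<le> (1 + norm a) ^ n * C" for x
    proof -
      have "(1 + norm x) ^ n * norm (h x) \<le> (1 + norm a) ^ n * (1 + norm (L x + a)) ^ n * norm (h x)"
        using weight_translate[of "L x" n a] L(2) by (intro mult_right_mono) auto
      also have "\<dots> = (1 + norm a) ^ n * ((1 + norm (L x + a)) ^ n * norm (f (L x + a)))"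
        by (simp add: f mult_ac)
      also have "\<dots> \<le> (1 + norm a) ^ n * C"
        using C by (intro mult_left_mono) auto
      finally show ?thesis .
    qed
    then show "\<exists>C. \<forall>x. (1 + norm x) ^ n * norm (h x) \<le> C" by blast
  qed (use assms in blast)
qed

lemma schwartz_translate: "f \<in> schwartz \<Longrightarrow> (\<lambda>x. f (x + a)) \<in> schwartz"
  using schwartz_affine(1)[of f "\<lambda>x. x" a] by (simp add: linear_iff)

lemma ddiff_translate: "f \<in> schwartz \<Longrightarrow> ddiff v (\<lambda>x. f (x + a)) x = ddiff v f (x + a)"
  using schwartz_affine(2)[of f "\<lambda>x. x" v a] by (simp add: linear_iff)

section \<open>Integrable weights in orthonormal coordinates\<close>

lemma integrable_inverse_1_plus_abs: "integrable lborel (\<lambda>x::real. inverse ((1 + \<bar>x\<bar>) ^ 2))"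
proof (rule Bochner_Integration.integrable_bound[where f = "\<lambda>x::real. inverse (1 + x\<^sup>2)"])
  show "integrable lborel (\<lambda>x::real. inverse (1 + x\<^sup>2))"
    using integrable_inverse_1_plus_square by (simp add: set_integrable_def)
  show "AE x in lborel. norm (inverse ((1 + \<bar>x\<bar>)\<^sup>2)) \<le> norm (inverse (1 + (x::real)\<^sup>2))"
    by (intro AE_I2) (auto simp: power2_eq_square algebra_simps intro!: le_imp_inverse_le add_pos_nonneg)
qed simp

definition orthonormal :: "'a::euclidean_space set \<Rightarrow> bool" where
  "orthonormal B \<longleftrightarrow> pairwise orthogonal B \<and> (\<forall>b\<in>B. norm b = 1)"

lemma orthonormal_finite: "orthonormal B \<Longrightarrow> finite B"
  unfolding orthonormal_def
  by (metis independent_bound_general norm_zero pairwise_orthogonal_independent zero_neq_one)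

lemma orthonormal_inner_sum:
  assumes "orthonormal B" "b \<in> B"
  shows "(\<Sum>c\<in>B. y c *\<^sub>R c) \<bullet> b = y b"
proof -
  have "(\<Sum>c\<in>B. y c *\<^sub>R c) \<bullet> b = (\<Sum>c\<in>B. if c = b then y b else 0)"
    unfolding inner_sum_left
    using assms by (intro sum.cong) (auto simp: orthonormal_def pairwise_def orthogonal_def dot_square_norm)
  then show ?thesis using assms(2) orthonormal_finite[OF assms(1)] by (simp add: sum.delta)
qed

text \<open>Every coordinate is at most the norm of the vector, so two powers of the radial weight
  pay for each coordinate. The product on the right splits into one-dimensional integrals.\<close>

lemma weight_product_bound:
  assumes "orthonormal B"
  shows "inverse ((1 + norm (\<Sum>b\<in>B. y b *\<^sub>R b)) ^ (2 * card B)) \<le> (\<Prod>b\<in>B. inverse ((1 + \<bar>y b\<bar>) ^ 2))"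
proof -
  have le: "\<bar>y b\<bar> \<le> norm (\<Sum>b\<in>B. y b *\<^sub>R b)" if "b \<in> B" for b
    using Cauchy_Schwarz_ineq2[of "\<Sum>b\<in>B. y b *\<^sub>R b" b] orthonormal_inner_sum[OF assms that] assms that
    by (simp add: orthonormal_def)
  have "(\<Prod>b\<in>B. (1 + \<bar>y b\<bar>) ^ 2) \<le> (\<Prod>b\<in>B. (1 + norm (\<Sum>b\<in>B. y b *\<^sub>R b)) ^ 2)"
    using le by (intro prod_mono) (auto intro!: power_mono)
  also have "\<dots> = (1 + norm (\<Sum>b\<in>B. y b *\<^sub>R b)) ^ (2 * card B)"
    by (simp add: power_mult)
  finally show ?thesis
    unfolding prod_inversef[unfolded o_def]
    by (intro le_imp_inverse_le) (auto intro!: prod_pos zero_less_power add_pos_nonneg)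
qed

definition weight_const :: real where
  "weight_const = (\<integral>x. inverse ((1 + \<bar>x\<bar>) ^ 2) \<partial>lborel)"

interpretation lborel_PiM: product_sigma_finite "\<lambda>_. lborel :: real measure"
  by standard

text \<open>The bound depends on \<open>B\<close> only through its cardinality, which makes the
  estimates of plane integrals uniform in the orientation.\<close>

lemma integrable_weight_PiM:
  assumes "orthonormal B"
  shows "integrable (\<Pi>\<^sub>M b\<in>B. lborel) (\<lambda>y. inverse ((1 + norm (\<Sum>b\<in>B. y b *\<^sub>R b)) ^ (2 * card B)))"
    and "(\<integral>y. inverse ((1 + norm (\<Sum>b\<in>B. y b *\<^sub>R b)) ^ (2 * card B)) \<partial>(\<Pi>\<^sub>M b\<in>B. lborel)) \<le> weight_const ^ card B"
proof -
  note fin = orthonormal_finite[OF assms]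
  have i: "integrable (\<Pi>\<^sub>M b\<in>B. lborel) (\<lambda>y. \<Prod>b\<in>B. inverse ((1 + \<bar>y b\<bar> :: real) ^ 2))"
    using lborel_PiM.product_integrable_prod[of B "\<lambda>_ x. inverse ((1 + \<bar>x\<bar> :: real) ^ 2)"] fin integrable_inverse_1_plus_abs
    by blast
  show j: "integrable (\<Pi>\<^sub>M b\<in>B. lborel) (\<lambda>y. inverse ((1 + norm (\<Sum>b\<in>B. y b *\<^sub>R b)) ^ (2 * card B)))"
    using i by (rule Bochner_Integration.integrable_bound)
      (use weight_product_bound[OF assms] in \<open>auto intro!: AE_I2 order_trans[OF _ abs_ge_self]\<close>)
  have "(\<integral>y. inverse ((1 + norm (\<Sum>b\<in>B. y b *\<^sub>R b)) ^ (2 * card B)) \<partial>(\<Pi>\<^sub>M b\<in>B. lborel))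
      \<le> (\<integral>y. (\<Prod>b\<in>B. inverse ((1 + \<bar>y b\<bar>) ^ 2)) \<partial>(\<Pi>\<^sub>M b\<in>B. lborel))"
    by (intro integral_mono i j weight_product_bound assms)
  also have "\<dots> = weight_const ^ card B"
    unfolding weight_const_def
    using lborel_PiM.product_integral_prod[OF fin, of "\<lambda>_ x. inverse ((1 + \<bar>x\<bar> :: real) ^ 2)"] integrable_inverse_1_plus_abs
    by simp
  finally show "(\<integral>y. inverse ((1 + norm (\<Sum>b\<in>B. y b *\<^sub>R b)) ^ (2 * card B)) \<partial>(\<Pi>\<^sub>M b\<in>B. lborel)) \<le> weight_const ^ card B" .
qed

lemma orthonormal_Basis: "orthonormal Basis"
  by (auto simp: orthonormal_def pairwise_def orthogonal_def inner_Basis)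

lemma integrable_weight:
  "integrable (lborel :: 'a::euclidean_space measure) (\<lambda>x. inverse ((1 + norm x) ^ (2 * DIM('a) + n)))"
proof (rule Bochner_Integration.integrable_bound)
  show "integrable lborel (\<lambda>x::'a. inverse ((1 + norm x) ^ (2 * DIM('a))))"
    by (subst lborel_eq, subst integrable_distr_eq) (use integrable_weight_PiM(1)[OF orthonormal_Basis] in auto)
  show "AE x in lborel. norm (inverse ((1 + norm (x::'a)) ^ (2 * DIM('a) + n))) \<le> norm (inverse ((1 + norm x) ^ (2 * DIM('a))))"
    by (intro AE_I2) (auto intro!: le_imp_inverse_le power_increasing zero_less_power add_pos_nonneg)
qed simp

lemma schwartz_integrable_weighted:
  fixes f :: "'a::euclidean_space \<Rightarrow> complex"
  assumes "f \<in> schwartz"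
  shows "integrable lborel (\<lambda>x. (1 + norm x) ^ n * norm (f x))"
proof -
  obtain C where C: "0 \<le> C" "\<And>x. norm (f x) \<le> C * inverse ((1 + norm x) ^ (2 * DIM('a) + n))"
    using schwartz_decay[OF assms] by blast
  show ?thesis
  proof (rule Bochner_Integration.integrable_bound)
    show "integrable lborel (\<lambda>x::'a. C * inverse ((1 + norm x) ^ (2 * DIM('a) + 0)))"
      by (intro integrable_mult_right integrable_weight)
    show "AE x in lborel. norm ((1 + norm x) ^ n * norm (f x)) \<le> norm (C * inverse ((1 + norm x) ^ (2 * DIM('a) + 0)))"
    proof (intro AE_I2)
      fix x :: 'a
      have pos: "1 + norm x > 0" by (smt (verit) norm_ge_zero)
      have "(1 + norm x) ^ n * norm (f x) \<le> (1 + norm x) ^ n * (C * inverse ((1 + norm x) ^ (2 * DIM('a) + n)))"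
        using C pos by (intro mult_left_mono) auto
      also have "\<dots> = C * inverse ((1 + norm x) ^ (2 * DIM('a)))"
        using pos by (simp add: power_add field_simps)
      finally show "norm ((1 + norm x) ^ n * norm (f x)) \<le> norm (C * inverse ((1 + norm x) ^ (2 * DIM('a) + 0)))"
        using C pos by (simp add: abs_mult)
    qed
  qed (use assms in measurable)
qed

lemma schwartz_integrable: "f \<in> schwartz \<Longrightarrow> integrable lborel f"
  using schwartz_integrable_weighted[of f 0] integrable_norm_iff[of f lborel]
  by (simp add: schwartz_measurable)

section \<open>The Fourier transform\<close>

lemma cis_measurable [measurable]: "cis \<in> borel_measurable borel"
  by (intro borel_measurable_continuous_onI continuous_intros)

text \<open>The bound is asked only almost everywhere in the first variable because estimates under
  the Haar measure hold on the Stiefel manifold, not on the whole matrix space.\<close>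

lemma integrable_pair_bound:
  fixes f :: "'x \<times> 'y \<Rightarrow> 'b::{banach, second_countable_topology}"
  assumes "sigma_finite_measure M1" "sigma_finite_measure M2"
    and [measurable]: "f \<in> borel_measurable (M1 \<Otimes>\<^sub>M M2)"
    and g: "integrable M1 g1" "integrable M2 g2"
    and bd: "AE x in M1. \<forall>y\<in>space M2. norm (f (x, y)) \<le> g1 x * g2 y"
  shows "integrable (M1 \<Otimes>\<^sub>M M2) f"
proof -
  interpret pair_sigma_finite M1 M2 using assms(1,2) by (simp add: pair_sigma_finite_def)
  have i: "AE x in M1. integrable M2 (\<lambda>y. f (x, y))"
    using bd AE_space
  proof eventually_elim
    case (elim x)
    show ?case
      by (rule Bochner_Integration.integrable_bound[OF integrable_mult_right[OF g(2), of "g1 x"]])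
        (use elim in \<open>auto intro!: AE_I2 order_trans[OF _ abs_ge_self]\<close>)
  qed
  show ?thesis
  proof (rule Fubini_integrable)
    show "integrable M1 (\<lambda>x. \<integral>y. norm (f (x, y)) \<partial>M2)"
    proof (rule Bochner_Integration.integrable_bound[OF integrable_mult_left[OF g(1), of "integral\<^sup>L M2 g2"]])
      show "AE x in M1. norm (\<integral>y. norm (f (x, y)) \<partial>M2) \<le> norm (g1 x * integral\<^sup>L M2 g2)"
        using bd i
      proof eventually_elim
        case (elim x)
        have "(\<integral>y. norm (f (x, y)) \<partial>M2) \<le> (\<integral>y. g1 x * g2 y \<partial>M2)"
          using elim g by (intro integral_mono) auto
        then have "norm (\<integral>y. norm (f (x, y)) \<partial>M2) \<le> (\<integral>y. g1 x * g2 y \<partial>M2)" by simp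
        also have "\<dots> = g1 x * integral\<^sup>L M2 g2" by simp
        also have "\<dots> \<le> norm (g1 x * integral\<^sup>L M2 g2)"
          unfolding real_norm_def by (rule abs_ge_self)
        finally show ?case .
      qed
    qed measurable
  qed (use i in simp_all)
qed

lemma fubini_swap:
  fixes f :: "'x \<Rightarrow> 'y \<Rightarrow> 'b::{banach, second_countable_topology}"
  assumes "sigma_finite_measure M1" "sigma_finite_measure M2"
    and "(\<lambda>(x, y). f x y) \<in> borel_measurable (M1 \<Otimes>\<^sub>M M2)"
    and "integrable M1 g1" "integrable M2 g2"
    and "AE x in M1. \<forall>y\<in>space M2. norm (f x y) \<le> g1 x * g2 y"
  shows "(\<integral>y. \<integral>x. f x y \<partial>M1 \<partial>M2) = (\<integral>x. \<integral>y. f x y \<partial>M2 \<partial>M1)"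
proof -
  interpret pair_sigma_finite M1 M2 using assms(1,2) by (simp add: pair_sigma_finite_def)
  show ?thesis
    by (rule Fubini_integral, rule integrable_pair_bound[OF assms(1-5)]) (use assms(6) in simp)
qed

lemma integral_translate:
  fixes f :: "'a::euclidean_space \<Rightarrow> 'b::{banach, second_countable_topology}"
  assumes "f \<in> borel_measurable borel"
  shows "(\<integral>t. f (t + a) \<partial>lborel) = (\<integral>t. f t \<partial>lborel)"
proof -
  have "(\<integral>t. f t \<partial>lborel) = (\<integral>t. f t \<partial>distr lborel borel ((+) a))"
    by (simp add: lborel_distr_plus)
  also have "\<dots> = (\<integral>t. f (a + t) \<partial>lborel)"
    by (rule integral_distr) (use assms in auto)
  finally show ?thesis by (simp add: add.commute)
qed

lemma integral_scale:
  fixes f :: "'a::euclidean_space \<Rightarrow> complex"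
  assumes [measurable]: "f \<in> borel_measurable borel" and "c \<noteq> 0"
  shows "(\<integral>t. f t \<partial>lborel) = of_real (\<bar>c\<bar> ^ DIM('a)) * (\<integral>t. f (c *\<^sub>R t) \<partial>lborel)"
proof -
  have "(\<integral>t. f t \<partial>lborel) = (\<integral>t. f t \<partial>density (distr lborel borel (\<lambda>x::'a. 0 + c *\<^sub>R x)) (\<lambda>_. ennreal (\<bar>c\<bar> ^ DIM('a))))"
    using lborel_affine[OF assms(2), of "0::'a"] by (simp add: ennreal_power)
  also have "\<dots> = (\<integral>t. \<bar>c\<bar> ^ DIM('a) *\<^sub>R f t \<partial>(distr lborel borel (\<lambda>x::'a. 0 + c *\<^sub>R x)))"
    by (rule integral_density) auto
  also have "\<dots> = (\<integral>t. \<bar>c\<bar> ^ DIM('a) *\<^sub>R f (c *\<^sub>R t) \<partial>lborel)"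
    by (subst integral_distr) auto
  finally show ?thesis by (simp add: scaleR_conv_of_real)
qed

lemma integrable_cis_mult:
  fixes w :: "'a::euclidean_space"
  assumes "integrable lborel f"
  shows "integrable lborel (\<lambda>t. cis (- (w \<bullet> t)) * f t)"
    and "integrable lborel (\<lambda>t. cis (w \<bullet> t) * f t)"
  using assms by (auto intro!: Bochner_Integration.integrable_bound[OF assms] AE_I2 simp: norm_mult)

lemma norm_fourier_le: "norm (fourier f w) \<le> (\<integral>t. norm (f t) \<partial>lborel)"
  unfolding fourier_def by (rule order_trans[OF integral_norm_bound]) (simp add: norm_mult)

lemma fourier_scale: "fourier (\<lambda>x. a * f x) w = a * fourier f w"
proof -
  have "(\<lambda>t. cis (- (w \<bullet> t)) * (a * f t)) = (\<lambda>t. a * (cis (- (w \<bullet> t)) * f t))"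
    by (simp add: mult_ac)
  then show ?thesis unfolding fourier_def by simp
qed

lemma fourier_add:
  assumes "integrable lborel f" "integrable lborel g"
  shows "fourier (\<lambda>x. f x + g x) w = fourier f w + fourier g w"
  unfolding fourier_def using integrable_cis_mult(1)[OF assms(1), of w] integrable_cis_mult(1)[OF assms(2), of w]
  by (simp add: distrib_left)

lemma fourier_continuous:
  assumes "integrable lborel f"
  shows "continuous_on UNIV (fourier f)"
  unfolding continuous_on_def fourier_def
proof (intro ballI tendsto_integral_dominated[where g = "\<lambda>x. norm (f x)"])
  fix w t :: 'a
  have "continuous_on UNIV (\<lambda>w. cis (- (w \<bullet> t)) * f t)" by (intro continuous_intros)
  then show "((\<lambda>w. cis (- (w \<bullet> t)) * f t) \<longlongrightarrow> cis (- (w \<bullet> t)) * f t) (at w within UNIV)"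
    unfolding continuous_on_def by blast
qed (use assms in \<open>auto simp: norm_mult\<close>)

lemma inv_fourier_eq_fourier:
  fixes g :: "'a::euclidean_space \<Rightarrow> complex"
  shows "inv_fourier g t = of_real (1 / (2 * pi) ^ DIM('a)) * fourier g (- t)"
  by (simp add: inv_fourier_def fourier_def inner_commute)

lemma cis_approx: "norm (cis a - 1 - \<i> * of_real a) \<le> a\<^sup>2"
proof -
  have "norm (cis a - 1 - \<i> * of_real a) \<le> \<bar>a\<bar> ^ Suc 1 / fact (Suc 1)"
    using iexp_approx1[of a 1] by (simp add: cis_conv_exp diff_diff_eq)
  also have "\<dots> \<le> a\<^sup>2" by (simp add: power2_eq_square)
  finally show ?thesis .
qed

lemma schwartz_mult_norm2_integrable:
  fixes f :: "'a::euclidean_space \<Rightarrow> complex"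
  assumes "f \<in> schwartz"
  shows "integrable lborel (\<lambda>t. (norm t)\<^sup>2 * norm (f t))"
  by (rule Bochner_Integration.integrable_bound[OF schwartz_integrable_weighted[OF assms, of 2]])
    (use assms in \<open>auto intro!: AE_I2 mult_right_mono power_mono\<close>)

text \<open>Expanding \<open>cis\<close> to first order leaves a remainder below
  \<open>(norm h)\<^sup>2 * ((norm t)\<^sup>2 * norm (f t))\<close>, which is integrable in t for a
  Schwartz function.\<close>

lemma fourier_has_derivative:
  fixes f :: "'a::euclidean_space \<Rightarrow> complex"
  assumes f: "f \<in> schwartz"
  shows "(fourier f has_derivative (\<lambda>h. fourier (\<lambda>t. - \<i> * (of_real (t \<bullet> h) * f t)) w)) (at w)"
proof (rule has_derivative_quadratic)
  have sch: "(\<lambda>t. - \<i> * (of_real (t \<bullet> h) * f t)) \<in> schwartz" for h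
    by (intro schwartz_scale schwartz_mult_inner f)
  have "linear (\<lambda>h. fourier (\<lambda>t. - \<i> * (of_real (t \<bullet> h) * f t)) w)"
  proof (rule linearI)
    fix h h' show "fourier (\<lambda>t. - \<i> * (of_real (t \<bullet> (h + h')) * f t)) w = fourier (\<lambda>t. - \<i> * (of_real (t \<bullet> h) * f t)) w + fourier (\<lambda>t. - \<i> * (of_real (t \<bullet> h') * f t)) w"
      by (subst fourier_add[OF schwartz_integrable[OF sch] schwartz_integrable[OF sch], symmetric])
        (simp add: algebra_simps inner_add_right)
  next
    fix c :: real and h show "fourier (\<lambda>t. - \<i> * (of_real (t \<bullet> (c *\<^sub>R h)) * f t)) w = c *\<^sub>R fourier (\<lambda>t. - \<i> * (of_real (t \<bullet> h) * f t)) w"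
      unfolding scaleR_conv_of_real by (subst fourier_scale[symmetric]) (auto simp: mult_ac)
  qed
  then show "bounded_linear (\<lambda>h. fourier (\<lambda>t. - \<i> * (of_real (t \<bullet> h) * f t)) w)"
    by (simp add: linear_conv_bounded_linear)
  fix h
  let ?D = "\<lambda>t. cis (- ((w + h) \<bullet> t)) * f t - cis (- (w \<bullet> t)) * f t - cis (- (w \<bullet> t)) * (- \<i> * (of_real (t \<bullet> h) * f t))"
  note ic = integrable_cis_mult(1)[OF schwartz_integrable[OF f]] integrable_cis_mult(1)[OF schwartz_integrable[OF sch]]
  have eq: "fourier f (w + h) - fourier f w - fourier (\<lambda>t. - \<i> * (of_real (t \<bullet> h) * f t)) w = (\<integral>t. ?D t \<partial>lborel)"
    unfolding fourier_def by (simp only: Bochner_Integration.integral_diff Bochner_Integration.integrable_diff ic)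
  have bd: "norm (?D t) \<le> (norm h)\<^sup>2 * ((norm t)\<^sup>2 * norm (f t))" for t
  proof -
    have "?D t = cis (- (w \<bullet> t)) * f t * (cis (- (t \<bullet> h)) - 1 - \<i> * of_real (- (t \<bullet> h)))"
    proof -
      have "cis (- ((w + h) \<bullet> t)) = cis (- (w \<bullet> t)) * cis (- (t \<bullet> h))"
        by (simp add: cis_mult inner_add_left inner_commute[of h])
      then show ?thesis by (simp only:) (simp add: algebra_simps)
    qed
    then have "norm (?D t) = norm (f t) * norm (cis (- (t \<bullet> h)) - 1 - \<i> * of_real (- (t \<bullet> h)))"
      by (simp only: norm_mult norm_cis mult_1_left)
    also have "\<dots> \<le> norm (f t) * (- (t \<bullet> h))\<^sup>2"
      by (intro mult_left_mono cis_approx) auto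
    also have "\<dots> \<le> norm (f t) * (norm t * norm h)\<^sup>2"
      by (intro mult_left_mono) (use Cauchy_Schwarz_ineq2[of t h] in \<open>auto intro: power2_le_imp_le simp: abs_le_square_iff[symmetric] abs_mult\<close>)
    finally show ?thesis by (simp add: power_mult_distrib mult_ac)
  qed
  have "norm (\<integral>t. ?D t \<partial>lborel) \<le> (\<integral>t. (norm h)\<^sup>2 * ((norm t)\<^sup>2 * norm (f t)) \<partial>lborel)"
    by (rule Bochner_Integration.integral_norm_bound_integral) (use bd schwartz_mult_norm2_integrable[OF f] ic in auto)
  then show "norm (fourier f (w + h) - fourier f w - fourier (\<lambda>t. - \<i> * (of_real (t \<bullet> h) * f t)) w)
      \<le> (\<integral>t. (norm t)\<^sup>2 * norm (f t) \<partial>lborel) * (norm h)\<^sup>2"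
    unfolding eq by (simp add: mult.commute)
qed

lemma ddiff_fourier:
  "f \<in> schwartz \<Longrightarrow> ddiff v (fourier f) w = fourier (\<lambda>t. - \<i> * (of_real (t \<bullet> v) * f t)) w"
  by (rule ddiff_eq) (rule fourier_has_derivative)

lemma schwartz_has_vector_derivative:
  assumes "f \<in> schwartz" "(\<gamma> has_vector_derivative v) (at s)"
  shows "((\<lambda>s. f (\<gamma> s)) has_vector_derivative ddiff v f (\<gamma> s)) (at s)"
proof -
  from diff_chain_at[OF assms(2)[unfolded has_vector_derivative_def] has_derivative_ddiff[OF schwartz_differentiable[OF assms(1)]]]
  have *: "((\<lambda>s. f (\<gamma> s)) has_derivative (\<lambda>x. ddiff (x *\<^sub>R v) f (\<gamma> s))) (at s)" by (simp add: o_def)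
  interpret linear "\<lambda>h. ddiff h f (\<gamma> s)"
    using has_derivative_ddiff[OF schwartz_differentiable[OF assms(1)]] by (rule has_derivative_linear)
  show ?thesis unfolding has_vector_derivative_def using * by (simp add: scaleR)
qed

text \<open>Instead of integrating by parts, the transform of the translate f (t + s v) is
  differentiated at s = 0. Under the integral this gives the transform of the derivative; by
  translation invariance the same function of s is \<open>cis (s * (w \<bullet> v))\<close> times
  the transform of \<open>f\<close>.\<close>

lemma fourier_ddiff:
  fixes f :: "'a::euclidean_space \<Rightarrow> complex"
  assumes f: "f \<in> schwartz"
  shows "fourier (ddiff v f) w = \<i> * of_real (w \<bullet> v) * fourier f w"
proof -
  note [measurable] = schwartz_measurable[OF f] schwartz_measurable[OF schwartz_ddiff[OF f]]
  obtain C where C: "0 \<le> C" "\<And>x. norm (ddiff v f x) \<le> C * inverse ((1 + norm x) ^ (2 * DIM('a) + 0))"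
    using schwartz_decay[OF schwartz_ddiff[OF f]] by blast
  let ?N = "2 * DIM('a) + 0"
  have "((\<lambda>s. \<integral>t. cis (- (w \<bullet> t)) * f (t + s *\<^sub>R v) \<partial>lborel) has_vector_derivative
      (\<integral>t. cis (- (w \<bullet> t)) * ddiff v f (t + 0 *\<^sub>R v) \<partial>lborel)) (at 0)"
  \<comment> \<open>For |s| \<le> 1 \<open>weight_translate\<close> replaces the weight at t + s v
    by the one at t, at the cost of the factor (1 + |v|)^N.\<close>
  proof (rule has_vector_derivative_integral[where g = "\<lambda>t. C * (1 + norm v) ^ ?N * inverse ((1 + norm t) ^ ?N)"])
    show "integrable lborel (\<lambda>t. cis (- (w \<bullet> t)) * f (t + s *\<^sub>R v))" for s
      by (intro integrable_cis_mult(1) schwartz_integrable schwartz_translate f)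
    show "((\<lambda>s. cis (- (w \<bullet> t)) * f (t + s *\<^sub>R v)) has_vector_derivative cis (- (w \<bullet> t)) * ddiff v f (t + s *\<^sub>R v)) (at s)" for s t
      by (intro has_vector_derivative_mult_right schwartz_has_vector_derivative f)
        (auto intro!: derivative_eq_intros)
    show "norm (cis (- (w \<bullet> t)) * ddiff v f (t + s *\<^sub>R v)) \<le> C * (1 + norm v) ^ ?N * inverse ((1 + norm t) ^ ?N)"
      if s: "\<bar>s\<bar> \<le> 1" for s t
    proof -
      have "(1 + norm (s *\<^sub>R v)) ^ ?N \<le> (1 + norm v) ^ ?N"
        using s by (intro power_mono) (auto simp: mult_left_le_one_le)
      then have le: "(1 + norm t) ^ ?N \<le> (1 + norm v) ^ ?N * (1 + norm (t + s *\<^sub>R v)) ^ ?N"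
        using weight_translate[of t ?N "s *\<^sub>R v"] by (meson mult_right_mono order_trans zero_le_power add_nonneg_nonneg norm_ge_zero zero_le_one)
      have pos: "(1 + norm t) ^ ?N > 0" "(1 + norm (t + s *\<^sub>R v)) ^ ?N > 0"
        by (auto intro!: zero_less_power add_pos_nonneg)
      have "inverse ((1 + norm (t + s *\<^sub>R v)) ^ ?N) \<le> (1 + norm v) ^ ?N * inverse ((1 + norm t) ^ ?N)"
        using le pos by (simp add: divide_simps)
      then have "C * inverse ((1 + norm (t + s *\<^sub>R v)) ^ ?N) \<le> C * ((1 + norm v) ^ ?N * inverse ((1 + norm t) ^ ?N))"
        using C(1) by (rule mult_left_mono)
      then show ?thesis using C(2)[of "t + s *\<^sub>R v"] by (simp add: norm_mult mult.assoc)
    qed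
    show "integrable lborel (\<lambda>t::'a. C * (1 + norm v) ^ ?N * inverse ((1 + norm t) ^ ?N))"
      by (intro integrable_mult_right integrable_weight)
  qed measurable
  then have 1: "((\<lambda>s. \<integral>t. cis (- (w \<bullet> t)) * f (t + s *\<^sub>R v) \<partial>lborel) has_vector_derivative fourier (ddiff v f) w) (at 0)"
    by (simp add: fourier_def)
  have "(\<integral>t. cis (- (w \<bullet> t)) * f (t + s *\<^sub>R v) \<partial>lborel) = cis (s * (w \<bullet> v)) * fourier f w" for s
  proof -
    have "(\<integral>t. cis (- (w \<bullet> t)) * f (t + s *\<^sub>R v) \<partial>lborel) = (\<integral>t. (cis (s * (w \<bullet> v)) * (cis (- (w \<bullet> (t + s *\<^sub>R v))) * f (t + s *\<^sub>R v))) \<partial>lborel)"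
      by (intro Bochner_Integration.integral_cong refl) (simp add: inner_add_right mult.assoc[symmetric] cis_mult)
    also have "\<dots> = (\<integral>t. (cis (s * (w \<bullet> v)) * (cis (- (w \<bullet> t)) * f t)) \<partial>lborel)"
      by (rule integral_translate[where f = "\<lambda>t. cis (s * (w \<bullet> v)) * (cis (- (w \<bullet> t)) * f t)"]) measurable
    finally show ?thesis by (simp add: fourier_def)
  qed
  moreover have "((\<lambda>s. cis (s * (w \<bullet> v)) * fourier f w) has_vector_derivative \<i> * of_real (w \<bullet> v) * fourier f w) (at 0)"
  proof -
    have "((\<lambda>s. cis (s * (w \<bullet> v))) has_vector_derivative \<i> * of_real (w \<bullet> v)) (at 0)"
      unfolding has_vector_derivative_def by (auto intro!: derivative_eq_intros simp: scaleR_conv_of_real mult_ac)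
    from has_vector_derivative_mult_left[OF this] show ?thesis .
  qed
  ultimately show ?thesis using 1 vector_derivative_unique_at by fastforce
qed

lemma one_plus_norm_le: "1 + norm x \<le> 1 + (\<Sum>b\<in>Basis. \<bar>x \<bullet> b\<bar>)"
  by (simp add: norm_le_l1)

lemma schwartz_fourier:
  fixes f :: "'a::euclidean_space \<Rightarrow> complex"
  assumes "f \<in> schwartz"
  shows "fourier f \<in> schwartz"
proof (rule schwartzI[of _ "fourier ` schwartz"])
  fix g :: "'a \<Rightarrow> complex" and x assume "g \<in> fourier ` schwartz"
  then show "g differentiable (at x)"
    using fourier_has_derivative unfolding differentiable_def by blast
next
  fix g :: "'a \<Rightarrow> complex" and b assume "g \<in> fourier ` schwartz"
  then obtain f :: "'a \<Rightarrow> complex" where f: "f \<in> schwartz" "g = fourier f" by blast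
  have "ddiff b g = fourier (\<lambda>t. - \<i> * (of_real (t \<bullet> b) * f t))"
    unfolding f using ddiff_fourier[OF f(1)] by blast
  then show "ddiff b g \<in> fourier ` schwartz"
    using schwartz_scale[OF schwartz_mult_inner[OF f(1)]] by blast
next
  fix g :: "'a \<Rightarrow> complex" and n assume "g \<in> fourier ` schwartz"
  \<comment> \<open>Induction on the weight: one more factor 1 + |x| is at most 1 plus the sum of
    the |x \<bullet> b|, and |x \<bullet> b| times the modulus of the transform is the modulus of
    the transform of a derivative, to which the hypothesis for n applies.\<close>
  then show "\<exists>C. \<forall>x. (1 + norm x) ^ n * norm (g x) \<le> C"
  proof (induction n arbitrary: g)
    case 0
    then show ?case using norm_fourier_le by auto
  next
    case (Suc n)
    then obtain f :: "'a \<Rightarrow> complex" where f: "f \<in> schwartz" "g = fourier f" by blast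
    obtain C where C: "\<And>x. (1 + norm x) ^ n * norm (g x) \<le> C" using Suc by blast
    have "\<exists>C. \<forall>x. (1 + norm x) ^ n * norm (fourier (ddiff b f) x) \<le> C" if "b \<in> Basis" for b
      using Suc.IH schwartz_ddiff[OF f(1)] by blast
    then obtain D where D: "\<And>b x. b \<in> Basis \<Longrightarrow> (1 + norm x) ^ n * norm (fourier (ddiff b f) x) \<le> D b"
      by metis
    have "(1 + norm x) ^ Suc n * norm (g x) \<le> C + (\<Sum>b\<in>Basis. D b)" for x
    proof -
      have "(1 + norm x) ^ Suc n * norm (g x) \<le> (1 + (\<Sum>b\<in>Basis. \<bar>x \<bullet> b\<bar>)) * ((1 + norm x) ^ n * norm (g x))"
        unfolding power_Suc mult.assoc by (intro mult_right_mono one_plus_norm_le) auto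
      also have "\<dots> = (1 + norm x) ^ n * norm (g x) + (\<Sum>b\<in>Basis. (1 + norm x) ^ n * (\<bar>x \<bullet> b\<bar> * norm (g x)))"
        by (simp only: distrib_right mult_1_left sum_distrib_right) (simp add: mult_ac)
      also have "\<dots> \<le> C + (\<Sum>b\<in>Basis. D b)"
      proof (intro add_mono C sum_mono)
        fix b :: 'a assume "b \<in> Basis"
        have "\<bar>x \<bullet> b\<bar> * norm (g x) = norm (fourier (ddiff b f) x)"
          unfolding fourier_ddiff[OF f(1)] f(2) by (simp add: norm_mult)
        then show "(1 + norm x) ^ n * (\<bar>x \<bullet> b\<bar> * norm (g x)) \<le> D b"
          using D[OF \<open>b \<in> Basis\<close>] by simp
      qed
      finally show ?thesis .
    qed
    then show ?case by blast
  qed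
qed (use assms in blast)

lemma schwartz_reflect: "f \<in> schwartz \<Longrightarrow> (\<lambda>x. f (- x)) \<in> schwartz"
  using schwartz_affine(1)[of f "\<lambda>x. - x" 0] by (simp add: linear_iff)

lemma schwartz_inv_fourier:
  fixes f :: "'a::euclidean_space \<Rightarrow> complex"
  assumes "f \<in> schwartz"
  shows "inv_fourier f \<in> schwartz"
  unfolding inv_fourier_eq_fourier[abs_def]
  by (intro schwartz_scale schwartz_reflect schwartz_fourier assms)

section \<open>Gaussian summation and Fourier inversion\<close>

definition gauss :: "'a::euclidean_space \<Rightarrow> real" where
  "gauss x = exp (- (norm x)\<^sup>2 / 2)"

lemma gauss_nonneg [simp]: "0 \<le> gauss x"
  by (simp add: gauss_def)

lemma gauss_measurable [measurable]: "gauss \<in> borel_measurable borel"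
  unfolding gauss_def by measurable

lemma gauss_prod:
  fixes y :: "'a::euclidean_space \<Rightarrow> real"
  shows "gauss (\<Sum>b\<in>Basis. y b *\<^sub>R b) = sqrt (2 * pi) ^ DIM('a) * (\<Prod>b\<in>(Basis::'a set). std_normal_density (y b))"
proof -
  have "(norm (\<Sum>b\<in>Basis. y b *\<^sub>R b))\<^sup>2 = (\<Sum>b\<in>(Basis::'a set). (y b)\<^sup>2)"
    unfolding power2_norm_eq_inner
    by (subst euclidean_inner) (simp add: power2_eq_square inner_sum_left_Basis)
  then show ?thesis
    by (simp add: gauss_def std_normal_density_def exp_sum[symmetric] prod_dividef sum_divide_distrib sum_negf prod.distrib)
qed

lemma std_normal_fourier:
  "(\<integral>x. cis (a * x) * of_real (std_normal_density x) \<partial>lborel) = of_real (exp (- a\<^sup>2 / 2))"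
  "integrable lborel (\<lambda>x. cis (a * x) * of_real (std_normal_density x))"
proof -
  have "char std_normal_distribution a = (\<integral>x. std_normal_density x *\<^sub>R iexp (a * x) \<partial>lborel)"
    unfolding char_def by (rule integral_density) auto
  then show "(\<integral>x. cis (a * x) * of_real (std_normal_density x) \<partial>lborel) = of_real (exp (- a\<^sup>2 / 2))"
    by (simp add: char_std_normal_distribution cis_conv_exp scaleR_conv_of_real mult_ac)
  have "integrable lborel std_normal_density" by (rule integrable_normal_density) simp
  then show "integrable lborel (\<lambda>x. cis (a * x) * of_real (std_normal_density x))"
    by (rule Bochner_Integration.integrable_bound) (auto simp: norm_mult)
qed

text \<open>In coordinates both the Gaussian and the character factor, and each one-dimensional
  integral is the characteristic function of the standard normal distribution.\<close>

lemma gauss_fourier: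
  fixes w :: "'a::euclidean_space"
  shows "(\<integral>z. cis (w \<bullet> z) * of_real (gauss z) \<partial>lborel) = of_real (sqrt (2 * pi) ^ DIM('a) * gauss w)"
    and "integrable lborel (gauss :: 'a \<Rightarrow> real)"
proof -
  have eq: "cis (w \<bullet> (\<Sum>b\<in>Basis. y b *\<^sub>R b)) * of_real (gauss (\<Sum>b\<in>Basis. y b *\<^sub>R b)) =
     of_real (sqrt (2 * pi) ^ DIM('a)) * (\<Prod>b\<in>Basis. cis ((w \<bullet> b) * y b) * of_real (std_normal_density (y b)))" 
    for y and w :: 'a
  proof -
    have "cis (w \<bullet> (\<Sum>b\<in>Basis. y b *\<^sub>R b)) = (\<Prod>b\<in>Basis. cis ((w \<bullet> b) * y b))"
      by (simp add: cis_conv_exp inner_sum_right exp_sum[symmetric] sum_distrib_left mult_ac)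
    then show ?thesis unfolding gauss_prod by (simp add: prod.distrib mult_ac)
  qed
  have i: "integrable lborel (\<lambda>z. cis (w \<bullet> z) * of_real (gauss z))" for w :: 'a
    unfolding lborel_eq[where 'a='a]
    apply (subst integrable_distr_eq)
      apply simp
     apply simp
    apply (subst eq)
    by (intro integrable_mult_right lborel_PiM.product_integrable_prod std_normal_fourier(2) finite_Basis)
  show "integrable lborel (gauss :: 'a \<Rightarrow> real)"
    using integrable_norm[OF i[of 0]] by (simp add: gauss_def[abs_def])
  have "(\<integral>z. cis (w \<bullet> z) * of_real (gauss z) \<partial>lborel) =
      of_real (sqrt (2 * pi) ^ DIM('a)) * (\<Prod>b\<in>Basis. \<integral>x. cis ((w \<bullet> b) * x) * of_real (std_normal_density x) \<partial>lborel)"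
    unfolding lborel_eq[where 'a='a]
    apply (subst integral_distr)
      apply simp
     apply simp
    apply (subst eq)
    apply (subst lborel_PiM.product_integral_prod[symmetric])
    by (auto intro: std_normal_fourier(2))
  also have "\<dots> = of_real (sqrt (2 * pi) ^ DIM('a) * gauss w)"
  proof -
    have "(norm w)\<^sup>2 = (\<Sum>b\<in>Basis. (w \<bullet> b)\<^sup>2)"
      unfolding power2_norm_eq_inner by (subst euclidean_inner) (simp add: power2_eq_square)
    then show ?thesis
      unfolding std_normal_fourier(1) by (simp add: gauss_def exp_sum[symmetric] sum_divide_distrib sum_negf flip: of_real_prod)
  qed
  finally show "(\<integral>z. cis (w \<bullet> z) * of_real (gauss z) \<partial>lborel) = of_real (sqrt (2 * pi) ^ DIM('a) * gauss w)" .
qed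

lemma gauss_integral: "(\<integral>z. gauss (z::'a::euclidean_space) \<partial>lborel) = sqrt (2 * pi) ^ DIM('a)"
proof -
  have "of_real (\<integral>z. gauss (z::'a) \<partial>lborel) = (of_real (sqrt (2 * pi) ^ DIM('a)) :: complex)"
    using gauss_fourier(1)[of "0::'a"] by (simp add: gauss_def[of 0])
  then show ?thesis by (simp only: of_real_eq_iff)
qed

text \<open>Proved by Gaussian summation. The hypotheses stay below the Schwartz class because the
  theorem is applied to slices before they are known to be Schwartz, and to functions with a factor
  \<open>norm w ^ k\<close> that need not be smooth.\<close>

theorem fourier_inversion:
  fixes f :: "'a::euclidean_space \<Rightarrow> complex"
  assumes f: "integrable lborel f" "continuous_on UNIV f" "\<And>x. norm (f x) \<le> B"
    and fh: "integrable lborel (fourier f)"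
  shows "inv_fourier (fourier f) x = f x"
proof -
  let ?K = "sqrt (2 * pi) ^ DIM('a)"
  have [measurable]: "f \<in> borel_measurable borel" using f(1) by auto
  have [measurable]: "fourier f \<in> borel_measurable borel" using fh by auto
  \<comment> \<open>The inversion integral with a Gaussian cutoff of scale 1 / e; its limit for e ->
    0 is computed in two ways.\<close>
  define A where "A e = (\<integral>w. fourier f w * cis (w \<bullet> x) * of_real (gauss (e *\<^sub>R w)) \<partial>lborel)" for e :: real
  have gi: "integrable lborel (\<lambda>w::'a. gauss (e *\<^sub>R w))" if "e > 0" for e
  proof -
    have "(\<lambda>w::'a. gauss (e *\<^sub>R w)) = (\<lambda>w. Re (cis 0 * of_real (gauss (e *\<^sub>R w))))" by simp
    have "integrable (density (distr lborel borel (\<lambda>x::'a. 0 + e *\<^sub>R x)) (\<lambda>_. ennreal (\<bar>e\<bar> ^ DIM('a)))) (gauss::'a\<Rightarrow>real)"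
      using gauss_fourier(2) lborel_affine[of e "0::'a"] that by (simp add: ennreal_power)
    then have "integrable (distr lborel borel (\<lambda>x::'a. 0 + e *\<^sub>R x)) (\<lambda>x. \<bar>e\<bar> ^ DIM('a) *\<^sub>R gauss x)"
      by (subst (asm) integrable_density) auto
    then have "integrable lborel (\<lambda>x::'a. \<bar>e\<bar> ^ DIM('a) *\<^sub>R gauss (e *\<^sub>R x))"
      by (subst (asm) integrable_distr_eq) auto
    then show ?thesis using that by simp
  qed
  \<comment> \<open>By Fubini the cutoff becomes a Gaussian of width e around x, and the
    substitution t = x + e z turns the integral into a Gaussian mean of \<open>f\<close> near
    x.\<close>
  have Ae: "A e = of_real ?K * (\<integral>z. f (x + e *\<^sub>R z) * of_real (gauss z) \<partial>lborel)" if e: "e > 0" for e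
  proof -
    have "A e = (\<integral>w. \<integral>t. f t * cis (w \<bullet> (x - t)) * of_real (gauss (e *\<^sub>R w)) \<partial>lborel \<partial>lborel)"
      unfolding A_def fourier_def
    proof (intro Bochner_Integration.integral_cong refl)
      fix w
      have "cis (w \<bullet> (x - t)) = cis (- (w \<bullet> t)) * cis (w \<bullet> x)" for t
        by (simp add: cis_mult inner_diff_right)
      then have "f t * cis (w \<bullet> (x - t)) * of_real (gauss (e *\<^sub>R w)) = cis (- (w \<bullet> t)) * f t * cis (w \<bullet> x) * of_real (gauss (e *\<^sub>R w))" for t
        by (simp only: mult_ac)
      then show "(\<integral>t. cis (- (w \<bullet> t)) * f t \<partial>lborel) * cis (w \<bullet> x) * of_real (gauss (e *\<^sub>R w)) = (\<integral>t. f t * cis (w \<bullet> (x - t)) * of_real (gauss (e *\<^sub>R w)) \<partial>lborel)"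
        by (simp only: integral_mult_left_zero)
    qed
    also have "\<dots> = (\<integral>t. \<integral>w. f t * cis (w \<bullet> (x - t)) * of_real (gauss (e *\<^sub>R w)) \<partial>lborel \<partial>lborel)"
      by (rule fubini_swap[where ?g1.0 = "\<lambda>t. norm (f t)" and ?g2.0 = "\<lambda>w. gauss (e *\<^sub>R w)"])
        (use f gi[OF e] in \<open>auto simp: norm_mult gauss_def intro: lborel.sigma_finite_measure_axioms\<close>)
    also have "\<dots> = (\<integral>t. f t * (of_real (\<bar>inverse e\<bar> ^ DIM('a)) * of_real (?K * gauss ((x - t) /\<^sub>R e))) \<partial>lborel)"
    proof (intro Bochner_Integration.integral_cong refl)
      fix t
      have "(\<integral>w. cis (w \<bullet> (x - t)) * of_real (gauss (e *\<^sub>R w)) \<partial>lborel) =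
          of_real (\<bar>inverse e\<bar> ^ DIM('a)) * (\<integral>w. cis ((inverse e *\<^sub>R w) \<bullet> (x - t)) * of_real (gauss (e *\<^sub>R inverse e *\<^sub>R w)) \<partial>lborel)"
        by (rule integral_scale) (use e in auto)
      also have "(\<integral>w. cis ((inverse e *\<^sub>R w) \<bullet> (x - t)) * of_real (gauss (e *\<^sub>R inverse e *\<^sub>R w)) \<partial>lborel) = (\<integral>w. cis (((x - t) /\<^sub>R e) \<bullet> w) * of_real (gauss w) \<partial>lborel)"
        using e by (intro Bochner_Integration.integral_cong refl) (simp add: inner_commute)
      also have "\<dots> = of_real (?K * gauss ((x - t) /\<^sub>R e))" by (rule gauss_fourier(1))
      finally show "(\<integral>w. f t * cis (w \<bullet> (x - t)) * of_real (gauss (e *\<^sub>R w)) \<partial>lborel) = f t * (of_real (\<bar>inverse e\<bar> ^ DIM('a)) * of_real (?K * gauss ((x - t) /\<^sub>R e)))"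
        by (simp add: mult.assoc)
    qed
    also have "\<dots> = (\<integral>t. f (t + x) * (of_real (\<bar>inverse e\<bar> ^ DIM('a)) * of_real (?K * gauss ((x - (t + x)) /\<^sub>R e))) \<partial>lborel)"
      by (rule integral_translate[symmetric, where f = "\<lambda>t. f t * (of_real (\<bar>inverse e\<bar> ^ DIM('a)) * of_real (?K * gauss ((x - t) /\<^sub>R e)))"]) measurable
    also have "\<dots> = of_real (\<bar>e\<bar> ^ DIM('a)) * (\<integral>t. f (e *\<^sub>R t + x) * (of_real (\<bar>inverse e\<bar> ^ DIM('a)) * of_real (?K * gauss ((x - (e *\<^sub>R t + x)) /\<^sub>R e))) \<partial>lborel)"
      by (rule integral_scale) (use e in auto)
    also have "\<dots> = of_real (\<bar>e\<bar> ^ DIM('a)) * (\<integral>t. of_real (\<bar>inverse e\<bar> ^ DIM('a)) * (of_real ?K * (f (x + e *\<^sub>R t) * of_real (gauss t))) \<partial>lborel)"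
    proof -
      have "gauss ((x - (e *\<^sub>R z + x)) /\<^sub>R e) = gauss z" for z :: 'a
        using e by (simp add: gauss_def)
      then have "f (e *\<^sub>R z + x) * (of_real (\<bar>inverse e\<bar> ^ DIM('a)) * of_real (?K * gauss ((x - (e *\<^sub>R z + x)) /\<^sub>R e))) =
          of_real (\<bar>inverse e\<bar> ^ DIM('a)) * (of_real ?K * (f (x + e *\<^sub>R z) * of_real (gauss z)))" for z
        by (simp add: add.commute mult_ac)
      then show ?thesis by (simp only:)
    qed
    also have "\<dots> = of_real (\<bar>e\<bar> ^ DIM('a) * \<bar>inverse e\<bar> ^ DIM('a)) * (of_real ?K * (\<integral>t. (f (x + e *\<^sub>R t) * of_real (gauss t)) \<partial>lborel))"
      by simp
    also have "\<bar>e\<bar> ^ DIM('a) * \<bar>inverse e\<bar> ^ DIM('a) = 1"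
      using e by (simp add: power_mult_distrib[symmetric])
    finally show ?thesis by simp
  qed
  have B: "0 \<le> B" using f(3)[of 0] norm_ge_zero order_trans by blast
  have l1: "((\<lambda>e. of_real ?K * (\<integral>z. f (x + e *\<^sub>R z) * of_real (gauss z) \<partial>lborel)) \<longlongrightarrow>
      of_real ?K * (\<integral>z. f x * of_real (gauss (z::'a)) \<partial>lborel)) (at_right 0)"
  proof (intro tendsto_intros tendsto_integral_dominated[where g = "\<lambda>z. B * gauss z"])
    fix z :: 'a
    have "((\<lambda>e. f (x + e *\<^sub>R z)) \<longlongrightarrow> f x) (at_right 0)"
      using f(2) by (intro continuous_on_tendsto_compose[of UNIV f]) (auto intro!: tendsto_eq_intros)
    then show "((\<lambda>e. f (x + e *\<^sub>R z)) \<longlongrightarrow> f x) (at_right 0)" .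
  qed (use f(3) B gauss_fourier(2)[where 'a='a] in \<open>auto simp: norm_mult intro!: mult_right_mono\<close>)
  have l2: "(A \<longlongrightarrow> (\<integral>w. fourier f w * cis (w \<bullet> x) * of_real (gauss (0 *\<^sub>R w)) \<partial>lborel)) (at_right 0)"
    unfolding A_def
  proof (rule tendsto_integral_dominated[where g = "\<lambda>w. norm (fourier f w)"])
    show "((\<lambda>e. fourier f w * cis (w \<bullet> x) * complex_of_real (gauss (e *\<^sub>R w))) \<longlongrightarrow>
          fourier f w * cis (w \<bullet> x) * complex_of_real (gauss (0 *\<^sub>R w))) (at_right 0)" for w
      unfolding gauss_def by (intro tendsto_intros) auto
    show "norm (fourier f w * cis (w \<bullet> x) * of_real (gauss (e *\<^sub>R w))) \<le> norm (fourier f w)" for e w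
      by (auto simp: norm_mult gauss_def mult_le_cancel_left1 intro!: mult_right_le_one_le)
  qed (use fh in auto)
  have "\<forall>\<^sub>F e in at_right 0. of_real ?K * (\<integral>z. f (x + e *\<^sub>R z) * of_real (gauss z) \<partial>lborel) = A e"
    using Ae by (auto simp: eventually_at_filter)
  then have "(A \<longlongrightarrow> of_real ?K * (\<integral>z. f x * of_real (gauss (z::'a)) \<partial>lborel)) (at_right 0)"
    using l1 Lim_transform_eventually by blast
  then have eq: "(\<integral>w. fourier f w * cis (w \<bullet> x) * of_real (gauss (0 *\<^sub>R w)) \<partial>lborel) = of_real ?K * (\<integral>z. f x * of_real (gauss (z::'a)) \<partial>lborel)"
    using l2 tendsto_unique trivial_limit_at_right_real by blast
  have eq1: "(\<integral>z. f x * of_real (gauss (z::'a)) \<partial>lborel) = f x * of_real ?K"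
    by (simp only: integral_mult_right_zero integral_complex_of_real gauss_integral)
  have eq2: "(\<integral>w. fourier f w * cis (w \<bullet> x) * of_real (gauss (0 *\<^sub>R w)) \<partial>lborel) = (\<integral>w. cis (w \<bullet> x) * fourier f w \<partial>lborel)"
    by (simp add: gauss_def mult.commute)
  have "(\<integral>w. cis (w \<bullet> x) * fourier f w \<partial>lborel) = of_real (?K * ?K) * f x"
    using eq unfolding eq1 eq2 of_real_mult by (simp only: mult_ac)
  \<comment> \<open>One factor \<open>?K\<close> comes from the transform of the Gaussian, the other
    is its mass.\<close>
  moreover have "?K * ?K = (2 * pi) ^ DIM('a)"
    by (simp only: power_mult_distrib[symmetric] real_sqrt_mult_self) simp
  ultimately show ?thesis
    by (simp add: inv_fourier_def inner_commute)
qed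

lemma inv_fourier_fourier:
  assumes "f \<in> schwartz"
  shows "inv_fourier (fourier f) = f"
proof
  fix x
  obtain B where "\<And>x. norm (f x) \<le> B" using schwartz_bound[OF assms, of 0] by auto
  then show "inv_fourier (fourier f) x = f x"
    by (intro fourier_inversion) (use assms in \<open>auto intro: schwartz_continuous schwartz_integrable schwartz_fourier\<close>)
qed

text \<open>The inverse transform is the reflected and rescaled transform, so reflecting the outer
  integral reduces the claim to \<open>fourier_inversion\<close>. This order of the two transforms
  is the one that undoes the filter, whose output on a slice is an inverse transform.\<close>

lemma fourier_inv_fourier_integrable:
  fixes g :: "'a::euclidean_space \<Rightarrow> complex"
  assumes g: "integrable lborel g" "continuous_on UNIV g" "\<And>x. norm (g x) \<le> B"
    and gh: "integrable lborel (inv_fourier g)"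
  shows "fourier (inv_fourier g) w = g w"
proof -
  let ?c = "of_real (1 / (2 * pi) ^ DIM('a)) :: complex"
  have rfl: "integrable lborel (\<lambda>x::'a. f (- x)) \<longleftrightarrow> integrable lborel f" "(\<integral>x. f (- x) \<partial>lborel) = (\<integral>x. f x \<partial>lborel)"
    if [measurable]: "f \<in> borel_measurable borel" for f :: "'a \<Rightarrow> complex"
  proof -
    have *: "distr lborel borel (uminus :: 'a \<Rightarrow> 'a) = lborel"
      using lborel_affine[of "-1" "0::'a"] by (simp add: density_1)
    show "integrable lborel (\<lambda>x::'a. f (- x)) \<longleftrightarrow> integrable lborel f"
      by (subst (2) *[symmetric], subst integrable_distr_eq) auto
    show "(\<integral>x. f (- x) \<partial>lborel) = (\<integral>x. f x \<partial>lborel)"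
      by (subst (2) *[symmetric], subst integral_distr) auto
  qed
  have c0: "?c \<noteq> 0" by simp
  have [measurable]: "fourier g \<in> borel_measurable borel"
    using fourier_continuous[OF g(1)] by (rule borel_measurable_continuous_onI)
  have "integrable lborel (\<lambda>t. ?c * fourier g (- t))"
    using gh unfolding inv_fourier_eq_fourier[abs_def] .
  then have "integrable lborel (\<lambda>t. fourier g (- t))"
    using integrable_mult_right[of "inverse ?c" lborel "\<lambda>t. ?c * fourier g (- t)"] c0 by simp
  then have fi: "integrable lborel (fourier g)" by (simp add: rfl(1))
  have "fourier (inv_fourier g) w = ?c * (\<integral>t. cis (- (w \<bullet> t)) * fourier g (- t) \<partial>lborel)"
    unfolding inv_fourier_eq_fourier[abs_def] fourier_scale by (simp add: fourier_def)
  also have "(\<integral>t. cis (- (w \<bullet> t)) * fourier g (- t) \<partial>lborel) = (\<integral>t. cis (w \<bullet> t) * fourier g t \<partial>lborel)"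
    using rfl(2)[of "\<lambda>t. cis (w \<bullet> t) * fourier g t"] by simp
  also have "?c * \<dots> = inv_fourier (fourier g) w"
    by (simp add: inv_fourier_def inner_commute)
  finally show ?thesis using fourier_inversion[OF g fi] by simp
qed

lemma fourier_inv_fourier:
  assumes "f \<in> schwartz"
  shows "fourier (inv_fourier f) = f"
proof
  fix x
  obtain B where "\<And>x. norm (f x) \<le> B" using schwartz_bound[OF assms, of 0] by auto
  then show "fourier (inv_fourier f) x = f x"
    by (intro fourier_inv_fourier_integrable) (use assms in \<open>auto intro: schwartz_continuous schwartz_integrable schwartz_inv_fourier\<close>)
qed

section \<open>Integration over planes\<close>

lemma nn_integral_translate:
  fixes f :: "'a::euclidean_space \<Rightarrow> ennreal"
  assumes [measurable]: "f \<in> borel_measurable borel"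
  shows "(\<integral>\<^sup>+t. f (t + a) \<partial>lborel) = (\<integral>\<^sup>+t. f t \<partial>lborel)"
proof -
  have "(\<integral>\<^sup>+t. f t \<partial>lborel) = (\<integral>\<^sup>+t. f t \<partial>distr lborel borel ((+) a))"
    by (simp add: lborel_distr_plus)
  also have "\<dots> = (\<integral>\<^sup>+t. f (a + t) \<partial>lborel)"
    by (rule nn_integral_distr) auto
  finally show ?thesis by (simp add: add.commute)
qed

text \<open>The uniqueness argument for Haar measures: the double integral of f (x + U y) g (U y),
  with g the indicator of the unit ball, is evaluated in both orders. The ball is symmetric and
  invariant under \<open>U\<close>, and its finite positive volume can be cancelled.\<close>

lemma lborel_distr_isometry:
  fixes U V :: "'a::euclidean_space \<Rightarrow> 'a"
  assumes U: "linear U" "\<And>x. norm (U x) = norm x" and V: "\<And>x. U (V x) = x"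
  shows "distr lborel borel U = lborel"
proof (rule measure_eqI)
  have [measurable]: "U \<in> borel_measurable borel"
    using linear_continuous_on[OF U(1)[unfolded linear_conv_bounded_linear]]
    by (rule borel_measurable_continuous_onI)
  fix S assume "S \<in> sets (distr lborel borel U)"
  then have [measurable]: "S \<in> sets borel" by simp
  define f :: "'a \<Rightarrow> ennreal" where "f = indicator S"
  define g :: "'a \<Rightarrow> ennreal" where "g = indicator (cball 0 1)"
  have [measurable]: "f \<in> borel_measurable borel" "g \<in> borel_measurable borel"
    unfolding f_def g_def by (auto intro!: borel_measurable_indicator)
  have gU: "g (U y) = g y" for y using U(2) by (simp add: g_def indicator_def)
  have gm: "g (- x) = g x" for x by (simp add: g_def indicator_def)
  have gi: "(\<integral>\<^sup>+x. g x \<partial>lborel) = ennreal (unit_ball_vol DIM('a))"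
    unfolding g_def by (simp add: emeasure_cball)
  have ginv: "(\<integral>\<^sup>+x. g (y - x) \<partial>lborel) = (\<integral>\<^sup>+x. g x \<partial>lborel)" for y
  proof -
    have "g (y - x) = g (x + - y)" for x using gm[of "y - x"] by simp
    then show ?thesis using nn_integral_translate[of g "- y"] by simp
  qed
  have "(\<integral>\<^sup>+x. f x \<partial>lborel) * (\<integral>\<^sup>+y. g y \<partial>lborel) = (\<integral>\<^sup>+y. \<integral>\<^sup>+x. f x * g (U y) \<partial>lborel \<partial>lborel)"
    unfolding gU by (simp add: nn_integral_multc nn_integral_cmult)
  also have "\<dots> = (\<integral>\<^sup>+y. \<integral>\<^sup>+x. f (x + U y) * g (U y) \<partial>lborel \<partial>lborel)"
  proof (rule nn_integral_cong)
    fix y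
    show "(\<integral>\<^sup>+x. f x * g (U y) \<partial>lborel) = (\<integral>\<^sup>+x. f (x + U y) * g (U y) \<partial>lborel)"
      by (rule nn_integral_translate[symmetric, where f = "\<lambda>x. f x * g (U y)"]) measurable
  qed
  also have "\<dots> = (\<integral>\<^sup>+x. \<integral>\<^sup>+y. f (x + U y) * g (U y) \<partial>lborel \<partial>lborel)"
    by (rule lborel_pair.Fubini') measurable
  also have "\<dots> = (\<integral>\<^sup>+x. \<integral>\<^sup>+y. f (U y) * g (U y - x) \<partial>lborel \<partial>lborel)"
  proof (rule nn_integral_cong)
    \<comment> \<open>Shifting y by \<open>V x\<close> shifts \<open>U y\<close> by x; this is where
      the right inverse enters.\<close>
    fix x
    have "(\<integral>\<^sup>+y. f (U y) * g (U y - x) \<partial>lborel) = (\<integral>\<^sup>+y. f (U (y + V x)) * g (U (y + V x) - x) \<partial>lborel)"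
      by (rule nn_integral_translate[symmetric, where f = "\<lambda>y. f (U y) * g (U y - x)"]) measurable
    then show "(\<integral>\<^sup>+y. f (x + U y) * g (U y) \<partial>lborel) = (\<integral>\<^sup>+y. f (U y) * g (U y - x) \<partial>lborel)"
      by (simp add: linear_add[OF U(1)] V add.commute)
  qed
  also have "\<dots> = (\<integral>\<^sup>+y. \<integral>\<^sup>+x. f (U y) * g (U y - x) \<partial>lborel \<partial>lborel)"
    by (rule lborel_pair.Fubini') measurable
  also have "\<dots> = (\<integral>\<^sup>+y. f (U y) \<partial>lborel) * (\<integral>\<^sup>+y. g y \<partial>lborel)"
    by (simp add: nn_integral_cmult ginv nn_integral_multc)
  finally have "(\<integral>\<^sup>+x. f x \<partial>lborel) = (\<integral>\<^sup>+y. f (U y) \<partial>lborel)"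
    unfolding gi mult_right_ennreal_cancel
    using unit_ball_vol_pos[of "real DIM('a)"] by linarith
  also have "\<dots> = (\<integral>\<^sup>+y. f y \<partial>distr lborel borel U)"
    by (rule nn_integral_distr[symmetric]) measurable
  finally show "emeasure (distr lborel borel U) S = emeasure lborel S"
    by (simp add: f_def)
qed simp

lemma integral_rotate:
  fixes U :: "real^'n \<Rightarrow> real^'n" and f :: "real^'n \<Rightarrow> 'b::{banach, second_countable_topology}"
  assumes U: "orthogonal_transformation U" and [measurable]: "f \<in> borel_measurable borel"
  shows "(\<integral>x. f (U x) \<partial>lborel) = (\<integral>x. f x \<partial>lborel)"
proof -
  obtain V where V: "\<And>x. U (V x) = x"
    using orthogonal_transformation_surj[OF U] by (metis surj_def)
  have l: "linear U" and n: "\<And>x. norm (U x) = norm x"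
    using U unfolding orthogonal_transformation by blast+
  have [measurable]: "U \<in> borel_measurable borel"
    using linear_continuous_on[OF l[unfolded linear_conv_bounded_linear]] by (rule borel_measurable_continuous_onI)
  have "(\<integral>x. f x \<partial>lborel) = (\<integral>x. f x \<partial>distr lborel borel U)"
    by (simp only: lborel_distr_isometry[OF l n V])
  also have "\<dots> = (\<integral>x. f (U x) \<partial>lborel)" by (rule integral_distr) auto
  finally show ?thesis ..
qed

lemma PiM_lborel_reindex:
  fixes h :: "'i \<Rightarrow> 'j"
  assumes "finite I" and h: "bij_betw h I J"
  shows "distr (\<Pi>\<^sub>M i\<in>I. lborel) (\<Pi>\<^sub>M j\<in>J. lborel) (\<lambda>f. \<lambda>j\<in>J. f (inv_into I h j)) = (\<Pi>\<^sub>M j\<in>J. (lborel :: real measure))"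
proof (rule lborel_PiM.PiM_eqI)
  let ?g = "inv_into I h"
  have g: "\<And>j. j \<in> J \<Longrightarrow> ?g j \<in> I" "\<And>i. i \<in> I \<Longrightarrow> ?g (h i) = i" "\<And>i. i \<in> I \<Longrightarrow> h i \<in> J"
    using h by (auto simp: bij_betw_def inv_into_into)
  show "finite J" using assms bij_betw_finite by blast
  have m: "(\<lambda>f. \<lambda>j\<in>J. f (?g j)) \<in> measurable (\<Pi>\<^sub>M i\<in>I. lborel) (\<Pi>\<^sub>M j\<in>J. (lborel :: real measure))"
    by (rule measurable_restrict) (use g in auto)
  fix A :: "'j \<Rightarrow> real set" assume A: "\<And>j. j \<in> J \<Longrightarrow> A j \<in> sets lborel"
  have "emeasure (distr (\<Pi>\<^sub>M i\<in>I. lborel) (\<Pi>\<^sub>M j\<in>J. lborel) (\<lambda>f. \<lambda>j\<in>J. f (?g j))) (Pi\<^sub>E J A) =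
      emeasure (\<Pi>\<^sub>M i\<in>I. lborel) ((\<lambda>f. \<lambda>j\<in>J. f (?g j)) -` (Pi\<^sub>E J A) \<inter> space (\<Pi>\<^sub>M i\<in>I. lborel))"
    by (rule emeasure_distr[OF m]) (use A \<open>finite J\<close> in \<open>auto intro!: sets_PiM_I_finite\<close>)
  also have "(\<lambda>f. \<lambda>j\<in>J. f (?g j)) -` (Pi\<^sub>E J A) \<inter> space (\<Pi>\<^sub>M i\<in>I. (lborel :: real measure)) = Pi\<^sub>E I (\<lambda>i. A (h i))"
  proof (rule set_eqI)
    fix f
    have hg: "h (?g j) = j" if "j \<in> J" for j
      using that h by (simp add: bij_betw_def f_inv_into_f)
    have "(\<forall>j\<in>J. f (?g j) \<in> A j) \<longleftrightarrow> (\<forall>i\<in>I. f i \<in> A (h i))"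
      using g hg by metis
    then show "f \<in> (\<lambda>f. \<lambda>j\<in>J. f (?g j)) -` (Pi\<^sub>E J A) \<inter> space (\<Pi>\<^sub>M i\<in>I. (lborel :: real measure)) \<longleftrightarrow> f \<in> Pi\<^sub>E I (\<lambda>i. A (h i))"
      by (auto simp: space_PiM PiE_iff)
  qed
  also have "emeasure (\<Pi>\<^sub>M i\<in>I. lborel) (Pi\<^sub>E I (\<lambda>i. A (h i))) = (\<Prod>i\<in>I. emeasure lborel (A (h i)))"
    using A g assms(1) by (intro lborel_PiM.emeasure_PiM) auto
  also have "\<dots> = (\<Prod>j\<in>J. emeasure lborel (A j))"
    using prod.reindex_bij_betw[OF h, of "\<lambda>j. emeasure lborel (A j)"] .
  finally show "emeasure (distr (\<Pi>\<^sub>M i\<in>I. lborel) (\<Pi>\<^sub>M j\<in>J. lborel) (\<lambda>f. \<lambda>j\<in>J. f (?g j))) (Pi\<^sub>E J A) = (\<Prod>j\<in>J. emeasure lborel (A j))" .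
qed simp

text \<open>Transports a product of lines indexed by \<open>J\<close> to a Euclidean space of
  dimension \<open>card J\<close>, so that its images become images of \<open>lborel\<close>. The
  vectors \<open>F j\<close> may lie in a larger space, as the rows of a Stiefel matrix do.\<close>

lemma distr_PiM_reindex_sum:
  fixes h :: "'a::euclidean_space \<Rightarrow> 'b::euclidean_space" and F :: "'b \<Rightarrow> 'c::euclidean_space"
  assumes h: "bij_betw h Basis J"
  shows "distr (\<Pi>\<^sub>M j\<in>J. lborel) borel (\<lambda>y. \<Sum>j\<in>J. y j *\<^sub>R F j) = distr lborel borel (\<lambda>x. \<Sum>b\<in>Basis. (x \<bullet> b) *\<^sub>R F (h b))"
proof -
  let ?g = "inv_into Basis h"
  have g: "\<And>j. j \<in> J \<Longrightarrow> ?g j \<in> Basis" "\<And>i. i \<in> Basis \<Longrightarrow> ?g (h i) = i" "\<And>i. i \<in> Basis \<Longrightarrow> h i \<in> J"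
    using h by (auto simp: bij_betw_def inv_into_into)
  have m: "(\<lambda>f. \<lambda>j\<in>J. f (?g j)) \<in> measurable (\<Pi>\<^sub>M i\<in>Basis. lborel) (\<Pi>\<^sub>M j\<in>J. (lborel :: real measure))"
    by (rule measurable_restrict) (use g in auto)
  have "distr (\<Pi>\<^sub>M j\<in>J. lborel) borel (\<lambda>y. \<Sum>j\<in>J. y j *\<^sub>R F j) =
      distr (distr (\<Pi>\<^sub>M i\<in>Basis. lborel) (\<Pi>\<^sub>M j\<in>J. lborel) (\<lambda>f. \<lambda>j\<in>J. f (?g j))) borel (\<lambda>y. \<Sum>j\<in>J. y j *\<^sub>R F j)"
    by (subst PiM_lborel_reindex[OF finite_Basis h]) simp
  also have "\<dots> = distr (\<Pi>\<^sub>M i\<in>Basis. lborel) borel ((\<lambda>y. \<Sum>j\<in>J. y j *\<^sub>R F j) \<circ> (\<lambda>f. \<lambda>j\<in>J. f (?g j)))"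
    by (rule distr_distr) (use m in \<open>auto intro!: borel_measurable_sum\<close>)
  also have "((\<lambda>y. \<Sum>j\<in>J. y j *\<^sub>R F j) \<circ> (\<lambda>f. \<lambda>j\<in>J. f (?g j))) = (\<lambda>f. \<Sum>b\<in>Basis. f b *\<^sub>R F (h b))"
    using g by (auto simp: fun_eq_iff sum.reindex_bij_betw[OF h, symmetric] intro!: sum.cong)
  also have "\<dots> = (\<lambda>x. \<Sum>b\<in>Basis. (x \<bullet> b) *\<^sub>R F (h b)) \<circ> (\<lambda>f. \<Sum>b\<in>Basis. f b *\<^sub>R b)"
    by (auto simp: fun_eq_iff inner_sum_left_Basis intro!: sum.cong)
  also have "distr (\<Pi>\<^sub>M i\<in>Basis. lborel) borel \<dots> = distr lborel borel (\<lambda>x. \<Sum>b\<in>Basis. (x \<bullet> b) *\<^sub>R F (h b))"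
    by (subst (2) lborel_eq, rule distr_distr[symmetric]) auto
  finally show ?thesis .
qed

lemma orthonormal_norm_sum:
  assumes "orthonormal B"
  shows "(norm (\<Sum>b\<in>B. y b *\<^sub>R b))\<^sup>2 = (\<Sum>b\<in>B. (y b)\<^sup>2)"
proof -
  have "(norm (\<Sum>b\<in>B. y b *\<^sub>R b))\<^sup>2 = (\<Sum>c\<in>B. y c * ((\<Sum>b\<in>B. y b *\<^sub>R b) \<bullet> c))"
    unfolding power2_norm_eq_inner by (simp add: inner_sum_right)
  also have "\<dots> = (\<Sum>c\<in>B. (y c)\<^sup>2)"
    by (intro sum.cong refl) (simp add: orthonormal_inner_sum[OF assms] power2_eq_square)
  finally show ?thesis .
qed

lemma orthonormal_span_representation:
  assumes "orthonormal B" "x \<in> span B"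
  shows "(\<Sum>b\<in>B. (x \<bullet> b) *\<^sub>R b) = x"
proof -
  obtain u where x: "x = (\<Sum>b\<in>B. u b *\<^sub>R b)"
    using assms(2) span_finite[OF orthonormal_finite[OF assms(1)]] by auto
  show ?thesis unfolding x
    by (intro sum.cong refl) (simp add: orthonormal_inner_sum[OF assms(1)])
qed

lemma orthonormal_independent: "orthonormal B \<Longrightarrow> independent B"
  unfolding orthonormal_def
  by (metis norm_zero pairwise_orthogonal_independent zero_neq_one)

text \<open>The linear map taking the standard basis to \<open>B\<close> is a surjective isometry,
  so \<open>lborel_distr_isometry\<close> applies.\<close>

lemma distr_orthonormal_basis:
  fixes B :: "'a::euclidean_space set"
  assumes B: "orthonormal B" "span B = UNIV"
  shows "distr (\<Pi>\<^sub>M b\<in>B. lborel) borel (\<lambda>y. \<Sum>b\<in>B. y b *\<^sub>R b) = lborel"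
proof -
  have "card B = DIM('a)"
    using orthonormal_independent[OF B(1)] B(2) by (metis dim_UNIV dim_eq_card span_UNIV)
  then obtain h where h: "bij_betw h (Basis :: 'a set) B"
    using finite_same_card_bij[OF finite_Basis orthonormal_finite[OF B(1)]] by auto
  define U where "U x = (\<Sum>b\<in>Basis. (x \<bullet> b) *\<^sub>R h b)" for x :: 'a
  define V where "V x = (\<Sum>b\<in>Basis. (x \<bullet> h b) *\<^sub>R b)" for x :: 'a
  have hi: "inj_on h Basis" "h ` Basis = B" using h by (auto simp: bij_betw_def)
  have Uy: "U (\<Sum>b\<in>Basis. y (h b) *\<^sub>R b) = (\<Sum>b\<in>B. y b *\<^sub>R b)" for y
    unfolding U_def by (simp add: inner_sum_left_Basis sum.reindex_bij_betw[OF h, symmetric])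
  have "distr lborel borel U = lborel"
  proof (rule lborel_distr_isometry[where V = V])
    show "linear U" unfolding U_def
      by (intro linear_compose_sum) (auto intro!: linearI simp: inner_add_left scaleR_add_left)
    show "norm (U x) = norm x" for x
    proof -
      have "U x = (\<Sum>c\<in>B. (x \<bullet> inv_into Basis h c) *\<^sub>R c)"
        unfolding U_def sum.reindex_bij_betw[OF h, symmetric] by (intro sum.cong) (use hi in auto)
      then have "(norm (U x))\<^sup>2 = (\<Sum>c\<in>B. (x \<bullet> inv_into Basis h c)\<^sup>2)"
        using orthonormal_norm_sum[OF B(1)] by simp
      also have "\<dots> = (\<Sum>b\<in>Basis. (x \<bullet> b)\<^sup>2)"
        unfolding sum.reindex_bij_betw[OF h, symmetric] by (intro sum.cong) (use hi in auto)
      also have "\<dots> = (norm x)\<^sup>2"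
        unfolding power2_norm_eq_inner by (subst (2) euclidean_inner) (simp add: power2_eq_square)
      finally show ?thesis by (simp add: power2_eq_iff_nonneg)
    qed
    show "U (V x) = x" for x
      unfolding V_def using Uy[of "\<lambda>c. x \<bullet> c"] orthonormal_span_representation[OF B(1), of x] B(2) by simp
  qed
  then show ?thesis
    using distr_PiM_reindex_sum[OF h, of "\<lambda>x. x"] unfolding U_def[abs_def] by simp
qed

section \<open>Stiefel matrices and orthonormal bases of their kernels\<close>

lemma stiefelD:
  assumes "A \<in> stiefel"
  shows stiefel_mult: "A *v (transpose A *v t) = t"
    and stiefel_norm: "norm (transpose A *v t) = norm t"
proof -
  show 1: "A *v (transpose A *v t) = t" for t
    using assms by (simp only: matrix_vector_mul_assoc stiefel_def mem_Collect_eq matrix_vector_mul_lid)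
  have "(transpose A *v t) \<bullet> (transpose A *v t) = t \<bullet> (A *v (transpose A *v t))"
    by (simp add: dot_lmul_matrix)
  then show "norm (transpose A *v t) = norm t" unfolding 1 by (simp add: norm_eq_sqrt_inner)
qed

lemma inner_transpose: "(transpose A *v t) \<bullet> x = t \<bullet> ((A :: real^'n^'m) *v x)"
  by (simp add: dot_lmul_matrix)

abbreviation nullspace :: "real^'d^'m \<Rightarrow> (real^'d) set" where
  "nullspace A \<equiv> {x. A *v x = 0}"

lemma onb_of:
  fixes W :: "'a::euclidean_space set"
  assumes "subspace W"
  shows "orthonormal (onb_of W)" "span (onb_of W) = W"
proof -
  have "\<exists>B. pairwise orthogonal B \<and> (\<forall>b\<in>B. norm b = 1) \<and> span B = W"
    using orthonormal_basis_subspace[OF assms] by metis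
  from someI_ex[OF this] show "orthonormal (onb_of W)" "span (onb_of W) = W"
    unfolding onb_of_def orthonormal_def by auto
qed

lemma subspace_kernel: "subspace (nullspace A)"
  by (auto simp: subspace_def matrix_vector_right_distrib matrix_vector_mult_scaleR)

lemma onb_kernel: "orthonormal (onb_of (nullspace A))" "span (onb_of (nullspace A)) = nullspace A"
  using onb_of[OF subspace_kernel] by auto

lemma onb_kernel_mult: "A *v (\<Sum>b\<in>onb_of (nullspace A). y b *\<^sub>R b) = 0"
proof -
  have "(\<Sum>b\<in>onb_of (nullspace A). y b *\<^sub>R b) \<in> span (onb_of (nullspace A))"
    by (intro span_sum span_scale span_base)
  then show ?thesis using onb_kernel(2) by blast
qed

lemma transpose_linear: "linear (\<lambda>t. transpose A *v (t :: real^'m))"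
  by (rule matrix_vector_mul_linear)

lemma transpose_measurable [measurable]: "(\<lambda>t. transpose A *v (t :: real^'m)) \<in> borel_measurable borel"
  by (intro borel_measurable_continuous_onI linear_continuous_on) (use transpose_linear linear_conv_bounded_linear in blast)

text \<open>An orthonormal basis of the kernel of \<open>A\<close>, completed by the rows of \<open>A\<close>, is an orthonormal
  basis of the whole space.\<close>

lemma stiefel_fubini:
  fixes f :: "real^'d \<Rightarrow> complex" and A :: "real^'d^'m"
  assumes A: "A \<in> stiefel" and f: "integrable lborel f"
  shows "(\<integral>x. f x \<partial>lborel) =
    (\<integral>t. \<integral>y. f ((\<Sum>b\<in>onb_of (nullspace A). y b *\<^sub>R b) + transpose A *v t) \<partial>(\<Pi>\<^sub>M b\<in>onb_of (nullspace A). lborel) \<partial>lborel)"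
proof -
  let ?B = "onb_of (nullspace A)"
  define a where "a = (\<lambda>t. transpose A *v (t :: real^'m))"
  define C where "C = a ` Basis"
  have [measurable]: "f \<in> borel_measurable borel" using f by auto
  have aa: "a s \<bullet> a t = s \<bullet> t" for s t
    unfolding a_def inner_transpose stiefel_mult[OF A] ..
  have inj: "inj_on a Basis"
    by (metis (no_types, lifting) A a_def inj_onI stiefel_mult)
  have la: "linear a" unfolding a_def by (rule transpose_linear)
  have onC: "orthonormal C"
    unfolding orthonormal_def C_def pairwise_def orthogonal_def
    by (auto simp: aa norm_eq_sqrt_inner inner_Basis)
  have BC: "b \<bullet> c = 0" if b: "b \<in> ?B" and c: "c \<in> C" for b c
  proof -
    obtain e where e: "c = a e" using c unfolding C_def by blast
    have "A *v b = 0" using span_base[OF b] onb_kernel(2)[of A] by blast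
    then show ?thesis unfolding e a_def inner_commute[of b] inner_transpose by simp
  qed
  have disj: "C \<inter> ?B = {}"
    using BC onC unfolding orthonormal_def by (metis disjoint_iff inner_eq_zero_iff norm_zero zero_neq_one)
  have onb: "orthonormal (C \<union> ?B)"
    using onC onb_kernel(1)[of A] BC
    unfolding orthonormal_def pairwise_def orthogonal_def by (metis Un_iff inner_commute)
  have span: "span (C \<union> ?B) = UNIV"
  proof -
    \<comment> \<open>\<open>a (A *v x)\<close> is the orthogonal projection to the row space, and
      its difference from x is annihilated by \<open>A\<close>.\<close>
    have "x \<in> span (C \<union> ?B)" for x
    proof -
      have "A *v (x - a (A *v x)) = 0"
        unfolding a_def by (simp only: matrix_vector_mult_diff_distrib stiefel_mult[OF A]) simp
      then have "x - a (A *v x) \<in> span ?B" using onb_kernel(2) by blast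
      then have 1: "x - a (A *v x) \<in> span (C \<union> ?B)" using span_mono by blast
      have "a (A *v x) = a (\<Sum>e\<in>Basis. ((A *v x) \<bullet> e) *\<^sub>R e)"
        by (simp add: euclidean_representation)
      also have "\<dots> = (\<Sum>e\<in>Basis. ((A *v x) \<bullet> e) *\<^sub>R a e)"
        by (simp add: linear_sum[OF la] linear_cmul[OF la])
      also have "\<dots> \<in> span (C \<union> ?B)"
        by (intro span_sum span_scale span_base) (auto simp: C_def)
      finally show ?thesis using span_add[OF 1, of "a (A *v x)"] by simp
    qed
    then show ?thesis by blast
  qed
  have fin: "finite C" "finite ?B" using orthonormal_finite onC onb_kernel(1) by blast+
  have hC: "bij_betw a Basis C" using inj by (simp add: C_def bij_betw_def)
  let ?S = "\<lambda>y. \<Sum>b\<in>C \<union> ?B. y b *\<^sub>R b"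
  have "(\<integral>x. f x \<partial>lborel) = (\<integral>y. f (?S y) \<partial>(\<Pi>\<^sub>M b\<in>C \<union> ?B. lborel))"
    by (subst distr_orthonormal_basis[OF onb span, symmetric], rule integral_distr) auto
  also have "\<dots> = (\<integral>z. \<integral>y. f (?S (merge C ?B (z, y))) \<partial>(\<Pi>\<^sub>M b\<in>?B. lborel) \<partial>(\<Pi>\<^sub>M b\<in>C. lborel))"
  proof (rule lborel_PiM.product_integral_fold[OF disj fin])
    show "integrable (\<Pi>\<^sub>M b\<in>C \<union> ?B. lborel) (\<lambda>y. f (?S y))"
      by (rule integrable_distr[of ?S _ borel]) (use f distr_orthonormal_basis[OF onb span] in auto)
  qed
  also have "\<dots> = (\<integral>z. \<integral>y. f ((\<Sum>c\<in>C. z c *\<^sub>R c) + (\<Sum>b\<in>?B. y b *\<^sub>R b)) \<partial>(\<Pi>\<^sub>M b\<in>?B. lborel) \<partial>(\<Pi>\<^sub>M b\<in>C. lborel))"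
  proof -
    have "?S (merge C ?B (z, y)) = (\<Sum>c\<in>C. z c *\<^sub>R c) + (\<Sum>b\<in>?B. y b *\<^sub>R b)" for z y
      using disj unfolding sum.union_disjoint[OF fin disj]
      by (intro arg_cong2[where f = "(+)"] sum.cong) (auto simp: merge_def)
    then show ?thesis by simp
  qed
  also have "\<dots> = (\<integral>u. \<integral>y. f (u + (\<Sum>b\<in>?B. y b *\<^sub>R b)) \<partial>(\<Pi>\<^sub>M b\<in>?B. lborel) \<partial>(distr (\<Pi>\<^sub>M b\<in>C. lborel) borel (\<lambda>z. \<Sum>c\<in>C. z c *\<^sub>R c)))"
  proof (rule integral_distr[symmetric])
    interpret sigma_finite_measure "\<Pi>\<^sub>M b\<in>?B. (lborel :: real measure)"
      using lborel_PiM.sigma_finite[OF fin(2)] .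
    show "(\<lambda>u. \<integral>y. f (u + (\<Sum>b\<in>?B. y b *\<^sub>R b)) \<partial>(\<Pi>\<^sub>M b\<in>?B. lborel)) \<in> borel_measurable borel"
      by measurable
  qed auto
  also have "distr (\<Pi>\<^sub>M b\<in>C. lborel) borel (\<lambda>z. \<Sum>c\<in>C. z c *\<^sub>R c) = distr lborel borel a"
  proof -
    have "(\<Sum>b\<in>Basis. (x \<bullet> b) *\<^sub>R a b) = a x" for x
      using linear_sum[OF la, of "\<lambda>b. (x \<bullet> b) *\<^sub>R b" Basis] by (simp add: linear_cmul[OF la] euclidean_representation)
    then show ?thesis using distr_PiM_reindex_sum[OF hC, of "\<lambda>x. x"] by simp
  qed
  also have "(\<integral>u. \<integral>y. f (u + (\<Sum>b\<in>?B. y b *\<^sub>R b)) \<partial>(\<Pi>\<^sub>M b\<in>?B. lborel) \<partial>(distr lborel borel a)) =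
     (\<integral>t. \<integral>y. f (a t + (\<Sum>b\<in>?B. y b *\<^sub>R b)) \<partial>(\<Pi>\<^sub>M b\<in>?B. lborel) \<partial>lborel)"
  proof (rule integral_distr)
    interpret sigma_finite_measure "\<Pi>\<^sub>M b\<in>?B. (lborel :: real measure)"
      using lborel_PiM.sigma_finite[OF fin(2)] .
    show "(\<lambda>u. \<integral>y. f (u + (\<Sum>b\<in>?B. y b *\<^sub>R b)) \<partial>(\<Pi>\<^sub>M b\<in>?B. lborel)) \<in> borel_measurable borel"
      by measurable
    show "a \<in> measurable lborel borel" unfolding a_def by simp
  qed
  finally show ?thesis by (simp only: a_def add.commute)
qed

section \<open>The transform of Schwartz functions and the Fourier slice theorem\<close>

lemma kplane_eq:
  fixes \<phi> :: "real^'d \<Rightarrow> complex" and A :: "real^'d^'m"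
  assumes A: "A \<in> stiefel" and [measurable]: "\<phi> \<in> borel_measurable borel"
  shows "kplane \<phi> (A, t) =
    (\<integral>y. \<phi> ((\<Sum>b\<in>onb_of (nullspace A). y b *\<^sub>R b) + transpose A *v t) \<partial>(\<Pi>\<^sub>M b\<in>onb_of (nullspace A). lborel))"
proof -
  have [measurable]: "(\<lambda>y. \<Sum>b\<in>onb_of (nullspace A). y b *\<^sub>R b) \<in> measurable (\<Pi>\<^sub>M b\<in>onb_of (nullspace A). lborel) borel"
    by (intro borel_measurable_sum) auto
  show ?thesis
    unfolding kplane_def subspace_lborel_def using A
    by (simp del: transpose_matrix_vector) (subst integral_distr, auto simp del: transpose_matrix_vector)
qed

text \<open>A bound on the integral of \<open>(1 + norm x) ^ (- 2 j)\<close> over any \<open>j\<close>-dimensional subspace.\<close>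

definition plane_const :: "nat \<Rightarrow> real" where
  "plane_const d = (max 1 weight_const) ^ d"

lemma plane_const_nonneg: "0 \<le> plane_const d"
  by (simp add: plane_const_def)

text \<open>A point of the plane is the sum of a kernel vector and \<open>transpose A *v t\<close>,
  which are orthogonal, so by Pythagoras its norm dominates both. Hence n powers of the weight
  control t, and the remaining \<open>2 * CARD('d)\<close> make the integral over the plane
  converge, with a constant independent of \<open>A\<close>.\<close>

lemma kplane_bound:
  fixes \<phi> :: "real^'d \<Rightarrow> complex" and A :: "real^'d^'m"
  assumes A: "A \<in> stiefel" and [measurable]: "\<phi> \<in> borel_measurable borel" and "0 \<le> C"
    and C: "\<And>x. (1 + norm x) ^ (n + 2 * CARD('d)) * norm (\<phi> x) \<le> C"
  shows "(1 + norm t) ^ n * norm (kplane \<phi> (A, t)) \<le> C * plane_const CARD('d)"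
    and "norm (\<phi> ((\<Sum>b\<in>onb_of (nullspace A). y b *\<^sub>R b) + transpose A *v t))
       \<le> C * inverse ((1 + norm (\<Sum>b\<in>onb_of (nullspace A). y b *\<^sub>R b)) ^ (2 * card (onb_of (nullspace A))))"
    and "integrable (\<Pi>\<^sub>M b\<in>onb_of (nullspace A). lborel) (\<lambda>y. \<phi> ((\<Sum>b\<in>onb_of (nullspace A). y b *\<^sub>R b) + transpose A *v t))"
proof -
  let ?B = "onb_of (nullspace A)"
  let ?S = "\<lambda>y. \<Sum>b\<in>?B. y b *\<^sub>R b"
  let ?M = "\<Pi>\<^sub>M b\<in>?B. (lborel :: real measure)"
  have cB: "card ?B \<le> CARD('d)"
    using independent_card_le[OF orthonormal_independent[OF onb_kernel(1), of A]] by simp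
  have [measurable]: "?S \<in> measurable ?M borel"
    by (intro borel_measurable_sum) auto
  have bd: "(1 + norm t) ^ n * norm (\<phi> (?S y + transpose A *v t)) \<le> C * inverse ((1 + norm (?S y)) ^ (2 * card ?B))" for y t
  proof -
    let ?x = "?S y + transpose A *v t"
    have o: "orthogonal (?S y) (transpose A *v t)"
      unfolding orthogonal_def inner_commute[of "?S y"] inner_transpose onb_kernel_mult by simp
    have "(norm ?x)\<^sup>2 = (norm (?S y))\<^sup>2 + (norm t)\<^sup>2"
      using norm_add_Pythagorean[OF o] by (simp only: stiefel_norm[OF A])
    then have le: "norm (?S y) \<le> norm ?x" "norm t \<le> norm ?x"
      by (simp_all add: power2_le_imp_le)
    have "(1 + norm t) ^ n * (1 + norm (?S y)) ^ (2 * card ?B) \<le> (1 + norm ?x) ^ n * (1 + norm ?x) ^ (2 * card ?B)"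
      using le by (intro mult_mono power_mono) auto
    also have "\<dots> \<le> (1 + norm ?x) ^ (n + 2 * CARD('d))"
      unfolding power_add[symmetric] using cB by (intro power_increasing) auto
    finally have "((1 + norm t) ^ n * (1 + norm (?S y)) ^ (2 * card ?B)) * norm (\<phi> ?x) \<le> (1 + norm ?x) ^ (n + 2 * CARD('d)) * norm (\<phi> ?x)"
      by (rule mult_right_mono) simp
    also have "\<dots> \<le> C" by (rule C)
    finally have "((1 + norm t) ^ n * norm (\<phi> ?x)) * (1 + norm (?S y)) ^ (2 * card ?B) \<le> C" by (simp add: mult_ac)
    moreover have "(1 + norm (?S y)) ^ (2 * card ?B) > 0" by (auto intro!: zero_less_power add_pos_nonneg)
    ultimately show ?thesis by (simp add: field_simps)
  qed
  show bd1: "norm (\<phi> (?S y + transpose A *v t)) \<le> C * inverse ((1 + norm (?S y)) ^ (2 * card ?B))" for y t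
  proof -
    have "1 * norm (\<phi> (?S y + transpose A *v t)) \<le> (1 + norm t) ^ n * norm (\<phi> (?S y + transpose A *v t))"
      by (intro mult_right_mono one_le_power) auto
    then show ?thesis using bd[of t y] by linarith
  qed
  note wi = integrable_weight_PiM[OF onb_kernel(1)[of A]]
  show i: "integrable ?M (\<lambda>y. \<phi> (?S y + transpose A *v t))" for t
    by (rule Bochner_Integration.integrable_bound[OF integrable_mult_right[OF wi(1), of C]])
      (use bd1 in \<open>auto intro!: AE_I2 order_trans[OF _ abs_ge_self] simp del: transpose_matrix_vector\<close>)
  have "norm (kplane \<phi> (A, t)) \<le> (\<integral>y. norm (\<phi> (?S y + transpose A *v t)) \<partial>?M)"
    by (subst kplane_eq[OF A]) (auto intro!: integral_norm_bound simp del: transpose_matrix_vector)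
  then have "(1 + norm t) ^ n * norm (kplane \<phi> (A, t)) \<le> (1 + norm t) ^ n * (\<integral>y. norm (\<phi> (?S y + transpose A *v t)) \<partial>?M)"
    by (rule mult_left_mono) simp
  also have "\<dots> = (\<integral>y. (1 + norm t) ^ n * norm (\<phi> (?S y + transpose A *v t)) \<partial>?M)" by simp
  also have "\<dots> \<le> (\<integral>y. C * inverse ((1 + norm (?S y)) ^ (2 * card ?B)) \<partial>?M)"
    by (intro integral_mono bd integrable_mult_right integrable_norm i wi(1))
  also have "\<dots> = C * (\<integral>y. inverse ((1 + norm (?S y)) ^ (2 * card ?B)) \<partial>?M)" by simp
  also have "\<dots> \<le> C * plane_const CARD('d)"
  proof (intro mult_left_mono \<open>0 \<le> C\<close>)
    have w: "0 \<le> weight_const" unfolding weight_const_def by (intro integral_nonneg_AE AE_I2) auto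
    have "weight_const ^ card ?B \<le> (max 1 weight_const) ^ card ?B"
      using w by (intro power_mono) auto
    also have "\<dots> \<le> plane_const CARD('d)"
      unfolding plane_const_def using cB by (intro power_increasing) auto
    finally show "(\<integral>y. inverse ((1 + norm (?S y)) ^ (2 * card ?B)) \<partial>?M) \<le> plane_const CARD('d)"
      using wi(2) by linarith
  qed
  finally show "(1 + norm t) ^ n * norm (kplane \<phi> (A, t)) \<le> C * plane_const CARD('d)" .
qed

lemma kplane_off [simp]: "A \<notin> stiefel \<Longrightarrow> kplane \<phi> (A, t) = 0"
  by (simp add: kplane_def)

lemma kplane_lincomb:
  fixes \<phi> \<phi>' :: "real^'d \<Rightarrow> complex"
  assumes "\<phi> \<in> schwartz" "\<phi>' \<in> schwartz"
  shows "kplane (\<lambda>x. a * \<phi> x + b * \<phi>' x) p = a * kplane \<phi> p + b * kplane \<phi>' p"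
proof (cases p)
  case (Pair A t)
  show ?thesis
  proof (cases "A \<in> stiefel")
    case True
    have i: "integrable (\<Pi>\<^sub>M b\<in>onb_of (nullspace A). lborel) (\<lambda>y. f ((\<Sum>b\<in>onb_of (nullspace A). y b *\<^sub>R b) + transpose A *v t))"
      if f: "f \<in> schwartz" for f :: "real^'d \<Rightarrow> complex"
    proof -
      obtain C where C: "0 \<le> C" "\<And>x. (1 + norm x) ^ (0 + 2 * CARD('d)) * norm (f x) \<le> C"
        using schwartz_bound[OF f] by blast
      show ?thesis by (rule kplane_bound(3)[OF True schwartz_measurable[OF f] C])
    qed
    have m: "(\<lambda>x. a * \<phi> x + b * \<phi>' x) \<in> borel_measurable borel"
      using assms by (intro schwartz_measurable schwartz_lincomb)
    show ?thesis unfolding Pair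
      using i[OF assms(1)] i[OF assms(2)]
      by (simp only: kplane_eq[OF True m] kplane_eq[OF True schwartz_measurable[OF assms(1)]] kplane_eq[OF True schwartz_measurable[OF assms(2)]]
          Bochner_Integration.integral_add integral_mult_right_zero integrable_mult_right)
  qed (simp add: Pair)
qed

text \<open>The last claim is the Fourier slice theorem: \<open>stiefel_fubini\<close> splits the
  integral into plane and offset, and the character of frequency \<open>transpose A *v w\<close> is
  constant along the plane.\<close>

lemma kplane_slice:
  fixes \<phi> :: "real^'d \<Rightarrow> complex" and A :: "real^'d^'m"
  assumes A: "A \<in> stiefel" and \<phi>: "\<phi> \<in> schwartz"
  shows "continuous_on UNIV (\<lambda>t. kplane \<phi> (A, t))"
    and "integrable lborel (\<lambda>t. kplane \<phi> (A, t))"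
    and "fourier (\<lambda>t. kplane \<phi> (A, t)) w = fourier \<phi> (transpose A *v w)"
proof -
  let ?B = "onb_of (nullspace A)"
  let ?S = "\<lambda>y. \<Sum>b\<in>?B. y b *\<^sub>R b"
  let ?M = "\<Pi>\<^sub>M b\<in>?B. (lborel :: real measure)"
  note [measurable] = schwartz_measurable[OF \<phi>]
  have [measurable]: "?S \<in> measurable ?M borel"
    by (intro borel_measurable_sum) auto
  \<comment> \<open>The exponent adds what integrability in t needs,
    \<open>2 * DIM(real^'m)\<close>, to what \<open>kplane_bound\<close> consumes.\<close>
  obtain C where C: "0 \<le> C" "\<And>x. (1 + norm x) ^ ((2 * DIM(real^'m) + 0) + 2 * CARD('d)) * norm (\<phi> x) \<le> C"
    using schwartz_bound[OF \<phi>] by blast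
  note kb = kplane_bound[OF A schwartz_measurable[OF \<phi>] C]
  show cont: "continuous_on UNIV (\<lambda>t. kplane \<phi> (A, t))"
    unfolding continuous_on_def kplane_eq[OF A schwartz_measurable[OF \<phi>]]
  proof (intro ballI tendsto_integral_dominated[where g = "\<lambda>y. C * inverse ((1 + norm (?S y)) ^ (2 * card ?B))"])
    fix t y
    have "continuous_on UNIV (\<lambda>t. \<phi> (?S y + transpose A *v t))"
      by (intro continuous_on_compose2[OF schwartz_continuous[OF \<phi>, of UNIV]] continuous_intros
          linear_continuous_on transpose_linear[unfolded linear_conv_bounded_linear]) auto
    then show "((\<lambda>t. \<phi> (?S y + transpose A *v t)) \<longlongrightarrow> \<phi> (?S y + transpose A *v t)) (at t within UNIV)"
      unfolding continuous_on_def by blast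
  qed (use kb(2) integrable_weight_PiM(1)[OF onb_kernel(1)[of A]] in auto)
  show int: "integrable lborel (\<lambda>t. kplane \<phi> (A, t))"
  proof (rule Bochner_Integration.integrable_bound[OF integrable_mult_right[OF integrable_weight[where 'a = "real^'m" and n = 0], of "C * plane_const CARD('d)"]])
    show "(\<lambda>t. kplane \<phi> (A, t)) \<in> borel_measurable lborel"
      using cont borel_measurable_continuous_onI by simp
    show "AE t in lborel. norm (kplane \<phi> (A, t)) \<le> norm (C * plane_const CARD('d) * inverse ((1 + norm t) ^ (2 * DIM(real^'m) + 0)))"
    proof (intro AE_I2)
      fix t :: "real^'m"
      have "(1 + norm t) ^ (2 * DIM(real^'m) + 0) > 0" by (auto intro!: zero_less_power add_pos_nonneg)
      then have "norm (kplane \<phi> (A, t)) \<le> C * plane_const CARD('d) * inverse ((1 + norm t) ^ (2 * DIM(real^'m) + 0))"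
        using kb(1)[of t] by (simp add: field_simps)
      then show "norm (kplane \<phi> (A, t)) \<le> norm (C * plane_const CARD('d) * inverse ((1 + norm t) ^ (2 * DIM(real^'m) + 0)))"
        unfolding real_norm_def using abs_ge_self order_trans by blast
    qed
  qed
  have "fourier \<phi> (transpose A *v w) = (\<integral>t. \<integral>y. cis (- ((transpose A *v w) \<bullet> (?S y + transpose A *v t))) * \<phi> (?S y + transpose A *v t) \<partial>?M \<partial>lborel)"
    unfolding fourier_def by (rule stiefel_fubini[OF A integrable_cis_mult(1)[OF schwartz_integrable[OF \<phi>]]])
  also have "\<dots> = (\<integral>t. cis (- (w \<bullet> t)) * kplane \<phi> (A, t) \<partial>lborel)"
  proof (intro Bochner_Integration.integral_cong refl)
    fix t
    have "(transpose A *v w) \<bullet> (?S y + transpose A *v t) = w \<bullet> t" for y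
      by (simp only: inner_transpose matrix_vector_right_distrib onb_kernel_mult stiefel_mult[OF A] add_0_left)
    then show "(\<integral>y. cis (- ((transpose A *v w) \<bullet> (?S y + transpose A *v t))) * \<phi> (?S y + transpose A *v t) \<partial>?M) = cis (- (w \<bullet> t)) * kplane \<phi> (A, t)"
      by (simp only: kplane_eq[OF A schwartz_measurable[OF \<phi>]] integral_mult_right_zero)
  qed
  finally show "fourier (\<lambda>t. kplane \<phi> (A, t)) w = fourier \<phi> (transpose A *v w)"
    by (simp add: fourier_def)
qed

lemma schwartz_transpose:
  fixes A :: "real^'d^'m"
  assumes "A \<in> stiefel" "h \<in> schwartz"
  shows "(\<lambda>w. h (transpose A *v w)) \<in> schwartz"
  using schwartz_affine(1)[OF assms(2) transpose_linear stiefel_norm[OF assms(1)], of 0] by simp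

text \<open>Inverting the slice theorem shows that a slice is Schwartz without differentiating plane
  integrals, since \<open>transpose A\<close> embeds isometrically and the composed transform is
  Schwartz.\<close>

lemma kplane_inv_fourier:
  fixes \<phi> :: "real^'d \<Rightarrow> complex" and A :: "real^'d^'m"
  assumes A: "A \<in> stiefel" and \<phi>: "\<phi> \<in> schwartz"
  shows "(\<lambda>t. kplane \<phi> (A, t)) = inv_fourier (\<lambda>w. fourier \<phi> (transpose A *v w))"
    and "(\<lambda>t. kplane \<phi> (A, t)) \<in> schwartz"
proof -
  have fe: "fourier (\<lambda>t. kplane \<phi> (A, t)) = (\<lambda>w. fourier \<phi> (transpose A *v w))"
    using kplane_slice(3)[OF A \<phi>] by blast
  have s: "(\<lambda>w. fourier \<phi> (transpose A *v w)) \<in> schwartz"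
    by (intro schwartz_transpose A schwartz_fourier \<phi>)
  obtain C where C: "0 \<le> C" "\<And>x. (1 + norm x) ^ (0 + 2 * CARD('d)) * norm (\<phi> x) \<le> C"
    using schwartz_bound[OF \<phi>] by blast
  have bd: "norm (kplane \<phi> (A, t)) \<le> C * plane_const CARD('d)" for t :: "real^'m"
    using kplane_bound(1)[OF A schwartz_measurable[OF \<phi>] C, of t] by simp
  have "inv_fourier (fourier (\<lambda>t. kplane \<phi> (A, t))) t = kplane \<phi> (A, t)" for t
    by (rule fourier_inversion[OF kplane_slice(2,1)[OF A \<phi>] bd]) (use fe s schwartz_integrable in simp)
  then show *: "(\<lambda>t. kplane \<phi> (A, t)) = inv_fourier (\<lambda>w. fourier \<phi> (transpose A *v w))"
    unfolding fe by (simp only: fun_eq_iff) metis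
  show "(\<lambda>t. kplane \<phi> (A, t)) \<in> schwartz"
    unfolding * by (rule schwartz_inv_fourier[OF s])
qed

section \<open>Radial integrals\<close>

lemma distr_norm_lborel:
  "distr (lborel :: 'a::euclidean_space measure) borel norm =
    density lborel (\<lambda>r. ennreal (real DIM('a) * unit_ball_vol DIM('a) * r ^ (DIM('a) - 1)) * indicator {0..} r)"
  (is "?L = density lborel ?d")
proof (rule measure_eqI_generator_eq[where E = "range atMost" and A = "\<lambda>n. {..real n}" and \<Omega> = UNIV])
  let ?V = "unit_ball_vol DIM('a)"
  fix X :: "real set" assume "X \<in> range atMost"
  then obtain r where X: "X = {..r}" by blast
  have L: "emeasure ?L X = emeasure lborel (cball (0::'a) r)"
    unfolding X by (subst emeasure_distr) (auto intro!: arg_cong[where f = "emeasure lborel"])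
  have R: "emeasure (density lborel ?d) X = (\<integral>\<^sup>+s. ?d s * indicator {..r} s \<partial>lborel)"
    unfolding X by (rule emeasure_density) auto
  show "emeasure ?L X = emeasure (density lborel ?d) X"
  proof (cases "r \<ge> 0")
    case True
    have "(\<integral>\<^sup>+s. ?d s * indicator {..r} s \<partial>lborel) = (\<integral>\<^sup>+s. ennreal (real DIM('a) * ?V * s ^ (DIM('a) - 1)) * indicator {0..r} s \<partial>lborel)"
      by (intro nn_integral_cong) (auto simp: indicator_def)
    \<comment> \<open>The volume of a ball, as a function of its radius, is a primitive of the
      proposed density.\<close>
    also have "\<dots> = ennreal (?V * r ^ DIM('a) - ?V * 0 ^ DIM('a))"
    proof (rule nn_integral_FTC_Icc[OF _ _ _ True])
      show "DERIV (\<lambda>s. ?V * s ^ DIM('a)) s :> real DIM('a) * ?V * s ^ (DIM('a) - 1)" for s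
        by (auto intro!: derivative_eq_intros)
    qed auto
    finally show ?thesis unfolding L R using True by (simp add: emeasure_cball)
  next
    case False
    then have "(\<integral>\<^sup>+s. ?d s * indicator {..r} s \<partial>lborel) = (\<integral>\<^sup>+(s::real). 0 \<partial>lborel)"
      by (intro nn_integral_cong) (auto simp: indicator_def)
    then show ?thesis unfolding L R using False by simp
  qed
next
  fix n :: nat
  have "emeasure ?L {..real n} = emeasure lborel (cball (0::'a) (real n))"
    by (subst emeasure_distr) (auto intro!: arg_cong[where f = "emeasure lborel"])
  then show "emeasure ?L {..real n} \<noteq> \<infinity>" by (simp add: emeasure_cball)
next
  show "(\<Union>i. {..real i}) = UNIV" using real_arch_simple by auto
qed (auto simp: Int_stable_def borel_eq_atMost min_def)

lemma integral_radial:
  fixes g :: "real \<Rightarrow> complex"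
  assumes [measurable]: "g \<in> borel_measurable borel"
  shows "(\<integral>x. g (norm x) \<partial>(lborel :: 'a::euclidean_space measure)) =
    of_real (real DIM('a) * unit_ball_vol DIM('a)) * (\<integral>r. of_real (indicator {0..} r * r ^ (DIM('a) - 1)) * g r \<partial>lborel)"
proof -
  let ?V = "unit_ball_vol DIM('a)"
  have "(\<integral>x. g (norm x) \<partial>(lborel :: 'a measure)) = (\<integral>r. g r \<partial>distr (lborel :: 'a measure) borel norm)"
    by (rule integral_distr[symmetric]) auto
  also have "\<dots> = (\<integral>r. g r \<partial>density lborel (\<lambda>r. ennreal (real DIM('a) * ?V * (indicator {0..} r * r ^ (DIM('a) - 1)))))"
    unfolding distr_norm_lborel
    by (intro arg_cong2[where f = lebesgue_integral] density_cong) (auto simp: indicator_def)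
  also have "\<dots> = (\<integral>r. (real DIM('a) * ?V * (indicator {0..} r * r ^ (DIM('a) - 1))) *\<^sub>R g r \<partial>lborel)"
    by (rule integral_density) (auto simp: indicator_def)
  also have "\<dots> = (\<integral>r. of_real (real DIM('a) * ?V) * (of_real (indicator {0..} r * r ^ (DIM('a) - 1)) * g r) \<partial>lborel)"
    by (simp only: scaleR_conv_of_real of_real_mult mult.assoc)
  finally show ?thesis by (simp only: integral_mult_right_zero)
qed

text \<open>The factor \<open>norm x ^ k\<close> turns the radial Jacobian of dimension
  \<open>DIM('a)\<close> into that of dimension \<open>DIM('a) + k\<close>; the prefactors are areas
  of unit spheres. In this way the frequency response lifts an integral over offsets to one over the
  full space.\<close>

lemma integral_radial_change:
  fixes g :: "real \<Rightarrow> complex"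
  assumes [measurable]: "g \<in> borel_measurable borel" and d: "DIM('b::euclidean_space) = DIM('a::euclidean_space) + k"
  shows "of_real (real DIM('b) * unit_ball_vol DIM('b)) * (\<integral>x. of_real (norm x ^ k) * g (norm x) \<partial>(lborel :: 'a measure)) =
    of_real (real DIM('a) * unit_ball_vol DIM('a)) * (\<integral>x. g (norm x) \<partial>(lborel :: 'b measure))"
proof -
  have "(\<integral>r. of_real (indicator {0..} r * r ^ (DIM('a) - 1)) * (of_real (r ^ k) * g r) \<partial>lborel) =
      (\<integral>r. of_real (indicator {0..} r * r ^ (DIM('b) - 1)) * g r \<partial>lborel)"
  proof (intro Bochner_Integration.integral_cong refl)
    fix r :: real
    have "DIM('b) - 1 = (DIM('a) - 1) + k" using d DIM_positive[where 'a = 'a] by simp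
    then have "r ^ (DIM('b) - 1) = r ^ (DIM('a) - 1) * r ^ k" by (simp only: power_add)
    then show "of_real (indicator {0..} r * r ^ (DIM('a) - 1)) * (of_real (r ^ k) * g r) = of_real (indicator {0..} r * r ^ (DIM('b) - 1)) * g r"
      by (simp only: of_real_mult mult_ac)
  qed
  then show ?thesis
    using integral_radial[of "\<lambda>r. of_real (r ^ k) * g r", where 'a = 'a] integral_radial[of g, where 'a = 'b]
    by (simp add: mult_ac)
qed

section \<open>The inversion formula\<close>

lemma continuous_on_matrix_vector_mult:
  "continuous_on S f \<Longrightarrow> continuous_on S g \<Longrightarrow> continuous_on S (\<lambda>x. (f x :: real^'n^'m) *v g x)"
  unfolding matrix_vector_mult_def by (intro continuous_intros)

lemma continuous_on_matrix_transpose: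
  "continuous_on S f \<Longrightarrow> continuous_on S (\<lambda>x. transpose (f x :: real^'n^'m))"
  unfolding transpose_def by (intro continuous_intros)

lemma continuous_on_matrix_mult:
  "continuous_on S f \<Longrightarrow> continuous_on S g \<Longrightarrow> continuous_on S (\<lambda>x. (f x :: real^'n^'m) ** (g x :: real^'p^'n))"
  unfolding matrix_matrix_mult_def by (intro continuous_intros)

lemmas matrix_continuous_intros =
  continuous_on_matrix_vector_mult continuous_on_matrix_transpose continuous_on_matrix_mult

lemma closed_stiefel: "closed (stiefel :: (real^'d^'m) set)"
  unfolding stiefel_def by (intro closed_Collect_eq continuous_intros matrix_continuous_intros)

lemma stiefel_borel [measurable]: "stiefel \<in> sets borel"
  using closed_stiefel by (rule borel_closed)

lemma stiefel_mult_orthogonal: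
  fixes U :: "real^'d^'d"
  assumes "orthogonal_matrix U"
  shows "A ** U \<in> stiefel \<longleftrightarrow> A \<in> stiefel"
proof -
  have "(A ** U) ** transpose (A ** U) = A ** (U ** transpose U) ** transpose A"
    by (simp add: matrix_transpose_mul matrix_mul_assoc)
  also have "U ** transpose U = mat 1" using assms by (simp add: orthogonal_matrix_def)
  finally show ?thesis by (simp add: stiefel_def)
qed

lemma sphere_area_eq:
  assumes "1 \<le> n"
  shows "sphere_area (n - 1) = real n * unit_ball_vol (real n)"
proof -
  have n: "real (n - 1 + 1) = real n" using assms by simp
  have "Gamma (real n / 2 + 1) = real n / 2 * Gamma (real n / 2)"
    by (rule Gamma_plus1) (use assms in \<open>auto simp: nonpos_Ints_def\<close>)
  then show ?thesis unfolding sphere_area_def unit_ball_vol_def n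
    by (simp only:) (use assms in simp)
qed

lemma sphere_area_pos: "0 < sphere_area n"
  unfolding sphere_area_def by (intro divide_pos_pos mult_pos_pos Gamma_real_pos) auto

lemma kplane_const_pos: "0 < kplane_const d k"
  unfolding kplane_const_def
  by (intro mult_pos_pos divide_pos_pos) (auto intro!: prod_pos sphere_area_pos)

lemma fourier_translate:
  assumes [measurable]: "f \<in> borel_measurable borel"
  shows "fourier (\<lambda>t. f (t + x)) w = cis (w \<bullet> x) * fourier f w"
proof -
  have "fourier (\<lambda>t. f (t + x)) w = (\<integral>t. cis (w \<bullet> x) * (cis (- (w \<bullet> (t + x))) * f (t + x)) \<partial>lborel)"
    unfolding fourier_def
    by (intro Bochner_Integration.integral_cong refl) (simp add: inner_add_right mult.assoc[symmetric] cis_mult)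
  also have "\<dots> = (\<integral>t. cis (w \<bullet> x) * (cis (- (w \<bullet> t)) * f t) \<partial>lborel)"
    by (rule integral_translate[where f = "\<lambda>t. cis (w \<bullet> x) * (cis (- (w \<bullet> t)) * f t)"]) measurable
  finally show ?thesis by (simp add: fourier_def)
qed

lemma K_op_kplane:
  fixes \<phi> :: "real^'d \<Rightarrow> complex" and A :: "real^'d^'m"
  assumes A: "A \<in> stiefel" and \<phi>: "\<phi> \<in> schwartz"
  shows "K_op k (kplane \<phi>) (A, t) =
    inv_fourier (\<lambda>w. of_real (K_response CARD('d) k w) * fourier \<phi> (transpose A *v w)) t"
  unfolding K_op_def by (simp only: prod.case kplane_slice(3)[OF A \<phi>])

lemma K_op_off:
  assumes "A \<notin> stiefel"
  shows "K_op k (kplane \<phi>) (A, t) = 0"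
  using assms unfolding K_op_def by (simp add: fourier_def inv_fourier_def)

section \<open>Averages over the Haar measure\<close>

context
  fixes k :: nat and \<sigma> :: "(real^'d^'m) measure"
  assumes haar: "stiefel_haar k \<sigma>"
begin

lemma sets_haar [measurable_cong]: "sets \<sigma> = sets borel"
  using haar by (simp add: stiefel_haar_def)

lemma space_haar [simp]: "space \<sigma> = UNIV"
  using sets_eq_imp_space_eq[OF sets_haar] by simp

lemma AE_haar: "AE A in \<sigma>. A \<in> stiefel"
  by (rule AE_I[where N = "- stiefel"]) (use haar sets_haar in \<open>auto simp: stiefel_haar_def\<close>)

lemma emeasure_haar: "emeasure \<sigma> UNIV = ennreal (\<Prod>n=k+1..CARD('d). sphere_area (n - 1))"
proof -
  have "emeasure \<sigma> (stiefel \<union> - stiefel) = emeasure \<sigma> stiefel"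
    using haar sets_haar by (intro emeasure_Un_null_set) (auto simp: stiefel_haar_def null_sets_def)
  then show ?thesis using haar by (simp add: stiefel_haar_def)
qed

lemma finite_haar: "finite_measure \<sigma>"
  by (rule finite_measureI) (simp add: emeasure_haar)

interpretation haar: finite_measure \<sigma>
  by (rule finite_haar)

definition haar_mass :: real where "haar_mass = (\<Prod>n=k+1..CARD('d). sphere_area (n - 1))"

lemma measure_haar: "measure \<sigma> UNIV = haar_mass"
  unfolding measure_def emeasure_haar haar_mass_def
  by (intro enn2real_ennreal prod_nonneg) (auto intro: sphere_area_pos less_imp_le)

lemma haar_mass_pos: "haar_mass > 0"
  unfolding haar_mass_def by (intro prod_pos) (auto intro: sphere_area_pos)

lemma haar_measurable_pair:
  assumes "continuous_on UNIV (\<lambda>(A, y). f A y)"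
  shows "(\<lambda>(A, y). f A y) \<in> borel_measurable (\<sigma> \<Otimes>\<^sub>M (borel :: 'z::euclidean_space measure))"
    and "(\<lambda>(y, A). f A y) \<in> borel_measurable ((borel :: 'z::euclidean_space measure) \<Otimes>\<^sub>M \<sigma>)"
proof -
  have "(\<lambda>(A, y). f A y) \<in> borel_measurable (borel \<Otimes>\<^sub>M (borel :: 'z measure))"
    unfolding borel_prod using assms by (rule borel_measurable_continuous_onI)
  then show 1: "(\<lambda>(A, y). f A y) \<in> borel_measurable (\<sigma> \<Otimes>\<^sub>M (borel :: 'z measure))"
    using measurable_cong_sets[OF sets_pair_measure_cong[OF sets_haar refl] refl] by blast
  show "(\<lambda>(y, A). f A y) \<in> borel_measurable ((borel :: 'z measure) \<Otimes>\<^sub>M \<sigma>)"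
    using measurable_pair_swap[OF 1] by (simp add: case_prod_unfold)
qed

lemma haar_measurable:
  "continuous_on UNIV f \<Longrightarrow> f \<in> borel_measurable \<sigma>"
  using borel_measurable_continuous_onI measurable_cong_sets[OF sets_haar refl] by blast

lemma haar_invariant:
  fixes f :: "real^'d^'m \<Rightarrow> complex" and U :: "real^'d^'d"
  assumes U: "orthogonal_matrix U" and f: "continuous_on UNIV f"
  shows "(\<integral>A. f (A ** U) \<partial>\<sigma>) = (\<integral>A. f A \<partial>\<sigma>)"
proof -
  have "(\<integral>A. f A \<partial>\<sigma>) = (\<integral>A. f A \<partial>distr \<sigma> borel (\<lambda>A. A ** U))"
    using haar U by (simp add: stiefel_haar_def)
  also have "\<dots> = (\<integral>A. f (A ** U) \<partial>\<sigma>)"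
  proof (rule integral_distr)
    show "(\<lambda>A. A ** U) \<in> measurable \<sigma> borel"
      by (rule haar_measurable) (intro matrix_continuous_intros continuous_intros)
  qed (use f borel_measurable_continuous_onI in blast)
  finally show ?thesis ..
qed

text \<open>Moving \<open>A\<close> to the other side of the inner product shows this to be the
  Fourier transform in y of the image of \<sigma> under the map from A to
  \<open>transpose A *v w\<close>, a measure carried by the sphere of radius
  \<open>norm w\<close>.\<close>

definition haar_char :: "real^'m \<Rightarrow> real^'d \<Rightarrow> complex" where
  "haar_char w y = (\<integral>A. cis (- (w \<bullet> (A *v y))) \<partial>\<sigma>)"

lemma haar_char_scale: "haar_char (c *\<^sub>R w) y = haar_char w (c *\<^sub>R y)"
  by (simp add: haar_char_def matrix_vector_mult_scaleR)

text \<open>A rotation taking \<open>y\<close> to \<open>y'\<close> is absorbed into the matrix by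
  the right invariance of \<sigma>.\<close>

lemma haar_char_rotate:
  assumes "norm y = norm y'"
  shows "haar_char w y = haar_char w y'"
proof -
  obtain f where f: "orthogonal_transformation f" "f y = y'"
    using orthogonal_transformation_exists[OF assms] by blast
  then have o: "orthogonal_matrix (matrix f)" and l: "linear f"
    using orthogonal_transformation_matrix by blast+
  have "haar_char w y' = (\<integral>A. cis (- (w \<bullet> ((A ** matrix f) *v y))) \<partial>\<sigma>)"
    unfolding haar_char_def f(2)[symmetric] by (simp add: matrix_vector_mul_assoc[symmetric] matrix_vector_mul(2)[OF l, THEN fun_cong])
  also have "\<dots> = haar_char w y"
    unfolding haar_char_def
    by (rule haar_invariant[OF o, where f = "\<lambda>A. cis (- (w \<bullet> (A *v y)))"]) (intro continuous_intros matrix_continuous_intros)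
  finally show ?thesis ..
qed

lemma haar_fubini:
  fixes f :: "real^'d^'m \<Rightarrow> 'z::euclidean_space \<Rightarrow> complex"
  assumes "(\<lambda>(A, y). f A y) \<in> borel_measurable (\<sigma> \<Otimes>\<^sub>M borel)" and "integrable lborel g"
    and "\<And>A y. A \<in> stiefel \<Longrightarrow> norm (f A y) \<le> g y"
  shows "(\<integral>y. \<integral>A. f A y \<partial>\<sigma> \<partial>lborel) = (\<integral>A. \<integral>y. f A y \<partial>lborel \<partial>\<sigma>)"
proof (rule fubini_swap[where ?g1.0 = "\<lambda>_. 1" and ?g2.0 = g])
  show "(\<lambda>(A, y). f A y) \<in> borel_measurable (\<sigma> \<Otimes>\<^sub>M lborel)"
    using assms(1) by simp
  show "AE A in \<sigma>. \<forall>y\<in>space lborel. norm (f A y) \<le> 1 * g y"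
    using AE_haar by eventually_elim (use assms(3) in auto)
qed (use assms(2) in \<open>auto intro: haar.sigma_finite_measure_axioms lborel.sigma_finite_measure_axioms\<close>)

lemma haar_integral_AE_const:
  assumes "f \<in> borel_measurable \<sigma>" "\<And>A. A \<in> stiefel \<Longrightarrow> f A = (c :: complex)"
  shows "(\<integral>A. f A \<partial>\<sigma>) = of_real haar_mass * c"
proof -
  have "(\<integral>A. f A \<partial>\<sigma>) = (\<integral>A. c \<partial>\<sigma>)"
    by (rule integral_cong_AE) (use assms AE_haar in auto)
  then show ?thesis by (simp add: measure_haar scaleR_conv_of_real)
qed

text \<open>Exchanging the roles of two independent Stiefel matrices \<open>A\<close>, \<open>B\<close> in the double integral of
  \<open>cis (- (w \<bullet> A B\<^sup>T w'))\<close> replaces the missing invariance of the measure under left multiplication.\<close>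

lemma haar_char_exchange:
  assumes y: "norm y = norm w" and y': "norm y' = norm w'"
  shows "haar_char w y' = haar_char w' y"
proof -
  let ?F = "\<lambda>A B :: real^'d^'m. cis (- (w \<bullet> (A *v (transpose B *v w'))))"
  have c: "continuous_on UNIV (\<lambda>(A, B). ?F A B)"
    unfolding case_prod_unfold by (intro continuous_intros matrix_continuous_intros)
  have m: "(\<lambda>(A, B). ?F A B) \<in> borel_measurable (\<sigma> \<Otimes>\<^sub>M \<sigma>)"
    using haar_measurable_pair(1)[OF c] measurable_cong_sets[OF sets_pair_measure_cong[OF refl sets_haar] refl] by blast
  have eq: "?F A B = cis (- (w' \<bullet> (B *v (transpose A *v w))))" for A B
  proof -
    have "w \<bullet> (A *v (transpose B *v w')) = w' \<bullet> (B *v (transpose A *v w))"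
      by (metis inner_transpose inner_commute)
    then show ?thesis by (simp only:)
  qed
  have swap: "(\<integral>B. \<integral>A. ?F A B \<partial>\<sigma> \<partial>\<sigma>) = (\<integral>A. \<integral>B. ?F A B \<partial>\<sigma> \<partial>\<sigma>)"
    by (rule fubini_swap[where ?g1.0 = "\<lambda>_. 1" and ?g2.0 = "\<lambda>_. 1", OF _ _ m])
      (auto intro: haar.sigma_finite_measure_axioms)
  have mm: "(\<lambda>B. \<integral>A. ?F A B \<partial>\<sigma>) \<in> borel_measurable \<sigma>" "(\<lambda>A. \<integral>B. ?F A B \<partial>\<sigma>) \<in> borel_measurable \<sigma>"
    using measurable_pair_swap[OF m] m by (auto intro!: haar.borel_measurable_lebesgue_integral simp: case_prod_unfold)
  \<comment> \<open>For a Stiefel matrix B the inner integral is \<open>haar_char w\<close> at a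
    vector of norm \<open>norm w'\<close>, so it does not depend on B.\<close>
  have "(\<integral>B. \<integral>A. ?F A B \<partial>\<sigma> \<partial>\<sigma>) = of_real haar_mass * haar_char w y'"
    by (rule haar_integral_AE_const[OF mm(1)], unfold haar_char_def[symmetric], rule haar_char_rotate)
      (simp only: y' stiefel_norm)
  moreover have "(\<integral>A. \<integral>B. ?F A B \<partial>\<sigma> \<partial>\<sigma>) = of_real haar_mass * haar_char w' y"
    by (rule haar_integral_AE_const[OF mm(2)], unfold eq haar_char_def[symmetric], rule haar_char_rotate)
      (simp only: y stiefel_norm)
  ultimately show ?thesis using swap haar_mass_pos by simp
qed

text \<open>Up to a constant the kernel \<rho>^(1 - d/2) J_(d/2 - 1) (\<rho>), the Fourier transform
  of the surface measure of the unit sphere. The index \<open>undefined\<close> stands for some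
  coordinate; by \<open>haar_char_radial\<close> every other choice gives the same value.\<close>

definition haar_bessel :: "real \<Rightarrow> complex" where
  "haar_bessel \<rho> = haar_char (axis undefined 1) (\<rho> *\<^sub>R axis undefined 1)"

text \<open>\<open>haar_char_exchange\<close> replaces both arguments by multiples of coordinate
  vectors, with the norms swapped; the scalars are then collected in the second argument.\<close>

lemma haar_char_radial: "haar_char w y = haar_bessel (norm w * norm y)"
proof -
  let ?u = "axis undefined 1 :: real^'m" and ?v = "axis undefined 1 :: real^'d"
  have "haar_char w y = haar_char (norm y *\<^sub>R ?u) (norm w *\<^sub>R ?v)"
    by (rule haar_char_exchange) auto
  also have "\<dots> = haar_char ?u (norm y *\<^sub>R norm w *\<^sub>R ?v)"
    by (rule haar_char_scale)
  also have "\<dots> = haar_bessel (norm w * norm y)"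
    unfolding haar_bessel_def by (simp add: mult.commute)
  finally show ?thesis .
qed

lemma haar_bessel_measurable [measurable]: "haar_bessel \<in> borel_measurable borel"
  unfolding haar_bessel_def[abs_def] haar_char_def
proof (rule haar.borel_measurable_lebesgue_integral)
  let ?f = "\<lambda>(A :: real^'d^'m) \<rho> :: real. cis (- (axis undefined 1 \<bullet> (A *v (\<rho> *\<^sub>R axis undefined 1))))"
  have "continuous_on UNIV (\<lambda>(A, \<rho>). ?f A \<rho>)"
    unfolding case_prod_unfold by (intro continuous_intros matrix_continuous_intros)
  from haar_measurable_pair(2)[OF this]
  show "(\<lambda>(\<rho>, A). cis (- (axis undefined 1 \<bullet> (A *v (\<rho> *\<^sub>R axis undefined 1))))) \<in> borel_measurable (borel \<Otimes>\<^sub>M \<sigma>)" .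
qed

lemma haar_bessel_bound: "norm (haar_bessel \<rho>) \<le> haar_mass"
proof -
  have "norm (haar_bessel \<rho>) \<le> (\<integral>A. 1 \<partial>\<sigma>)"
    unfolding haar_bessel_def haar_char_def
    by (rule order_trans[OF integral_norm_bound]) simp
  then show ?thesis by (simp add: measure_haar)
qed

text \<open>A Hankel transform. By \<open>haar_average_fourier\<close> it integrates
  \<open>fourier \<psi>\<close> over the sphere of radius s, for s \<ge> 0, against the rotation
  invariant measure of the same mass as \<sigma>.\<close>

definition hankel :: "(real^'d \<Rightarrow> complex) \<Rightarrow> real \<Rightarrow> complex" where
  "hankel \<psi> s = (\<integral>y. \<psi> y * haar_bessel (s * norm y) \<partial>lborel)"

lemma hankel_measurable [measurable]:
  assumes "\<psi> \<in> schwartz"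
  shows "hankel \<psi> \<in> borel_measurable borel"
proof -
  note [measurable] = schwartz_measurable[OF assms]
  show ?thesis unfolding hankel_def[abs_def] by measurable
qed

lemma fourier_transpose_measurable:
  assumes "h \<in> schwartz"
  shows "(\<lambda>(A :: real^'d^'m, w). h (transpose A *v w)) \<in> borel_measurable (\<sigma> \<Otimes>\<^sub>M borel)"
  by (rule haar_measurable_pair(1)[where f = "\<lambda>A w. h (transpose A *v w)"], unfold case_prod_unfold)
    (intro continuous_on_compose2[OF schwartz_continuous[OF assms, of UNIV]] continuous_intros matrix_continuous_intros, auto)

text \<open>Fubini brings the average inside, where \<open>haar_char_radial\<close> leaves a kernel
  depending on norms alone. The result no longer remembers the dimension of \<open>w\<close>, which
  permits reading it on \<open>real^'d\<close> as well.\<close>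

lemma haar_average_fourier:
  fixes \<psi> :: "real^'d \<Rightarrow> complex"
  assumes \<psi>: "\<psi> \<in> schwartz"
  shows "(\<integral>A. fourier \<psi> (transpose A *v w) \<partial>\<sigma>) = hankel \<psi> (norm w)"
proof -
  note [measurable] = schwartz_measurable[OF \<psi>]
  have c: "continuous_on UNIV (\<lambda>(A :: real^'d^'m, y). cis (- (w \<bullet> (A *v y))) * \<psi> y)"
    unfolding case_prod_unfold
    by (intro continuous_intros matrix_continuous_intros continuous_on_compose2[OF schwartz_continuous[OF \<psi>, of UNIV]]) auto
  have "(\<integral>A. fourier \<psi> (transpose A *v w) \<partial>\<sigma>) = (\<integral>A. \<integral>y. cis (- (w \<bullet> (A *v y))) * \<psi> y \<partial>lborel \<partial>\<sigma>)"
    unfolding fourier_def inner_transpose ..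
  also have "\<dots> = (\<integral>y. \<integral>A. cis (- (w \<bullet> (A *v y))) * \<psi> y \<partial>\<sigma> \<partial>lborel)"
    by (rule haar_fubini[symmetric, where g = "\<lambda>y. norm (\<psi> y)"])
      (use haar_measurable_pair(1)[OF c] schwartz_integrable[OF \<psi>] in \<open>auto simp: norm_mult\<close>)
  also have "\<dots> = hankel \<psi> (norm w)"
    unfolding hankel_def haar_char_radial[symmetric] haar_char_def by (simp add: mult.commute)
  finally show ?thesis .
qed

text \<open>Decay is inherited from \<open>fourier \<psi>\<close>, since the average at radius
  \<open>norm \<xi>\<close> involves only its values at points of that norm.\<close>

lemma hankel_integrable:
  fixes \<psi> :: "real^'d \<Rightarrow> complex"
  assumes \<psi>: "\<psi> \<in> schwartz"
  shows "integrable lborel (\<lambda>\<xi> :: 'a::euclidean_space. hankel \<psi> (norm \<xi>))"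
proof -
  note [measurable] = hankel_measurable[OF \<psi>]
  obtain C where C: "0 \<le> C" "\<And>x. norm (fourier \<psi> x) \<le> C * inverse ((1 + norm x) ^ (2 * DIM('a) + 0))"
    using schwartz_decay[OF schwartz_fourier[OF \<psi>]] by blast
  have bd: "norm (hankel \<psi> (norm \<xi>)) \<le> haar_mass * (C * inverse ((1 + norm \<xi>) ^ (2 * DIM('a) + 0)))" for \<xi> :: 'a
  proof -
    \<comment> \<open>A vector of \<open>real^'m\<close> with the norm of \<xi>, so that
      \<open>haar_average_fourier\<close> applies although \<xi> lives in another space.\<close>
    let ?w = "norm \<xi> *\<^sub>R axis undefined 1 :: real^'m"
    have n: "norm ?w = norm \<xi>" by simp
    have "norm (hankel \<psi> (norm ?w)) \<le> (\<integral>A. norm (fourier \<psi> (transpose A *v ?w)) \<partial>\<sigma>)"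
      unfolding haar_average_fourier[OF \<psi>, symmetric] by (rule integral_norm_bound)
    also have "\<dots> \<le> (\<integral>A. C * inverse ((1 + norm \<xi>) ^ (2 * DIM('a) + 0)) \<partial>\<sigma>)"
    proof (rule integral_mono_AE')
      show "AE A in \<sigma>. norm (fourier \<psi> (transpose A *v ?w)) \<le> C * inverse ((1 + norm \<xi>) ^ (2 * DIM('a) + 0))"
        using AE_haar by eventually_elim (use C(2) stiefel_norm n in metis)
    qed (use C in auto)
    finally show ?thesis unfolding n by (simp add: measure_haar)
  qed
  show ?thesis
  proof (rule Bochner_Integration.integrable_bound)
    show "integrable lborel (\<lambda>\<xi> :: 'a. haar_mass * (C * inverse ((1 + norm \<xi>) ^ (2 * DIM('a) + 0))))"
      by (intro integrable_mult_right integrable_weight)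
  qed (use bd in \<open>auto intro!: AE_I2 order_trans[OF _ abs_ge_self]\<close>)
qed

text \<open>Averaging over spheres does not change the integral over a ball. To see this with
  \<sigma> alone, both sides are written as integrals of \<psi> against a kernel: the transform
  \<open>q\<close> of the ball is radial, hence its own average over the points
  \<open>transpose A *v w\<close>, and computing that average under the integral produces
  \<open>haar_bessel\<close>. The ball supplies the integrability in \<xi>, for
  \<open>haar_bessel\<close> is only known to be bounded.\<close>

lemma hankel_cball:
  fixes \<psi> :: "real^'d \<Rightarrow> complex"
  assumes \<psi>: "\<psi> \<in> schwartz"
  shows "of_real haar_mass * (\<integral>\<xi>. indicator (cball 0 R) \<xi> * fourier \<psi> \<xi> \<partial>lborel) =
    (\<integral>\<xi>. indicator (cball (0 :: real^'d) R) \<xi> * hankel \<psi> (norm \<xi>) \<partial>lborel)"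
proof -
  note [measurable] = schwartz_measurable[OF \<psi>]
  let ?I = "indicator (cball (0 :: real^'d) R) :: _ \<Rightarrow> complex"
  have "(\<lambda>\<xi>. norm (?I \<xi>)) = indicator (cball (0 :: real^'d) R)"
    by (auto simp: indicator_def fun_eq_iff)
  then have Ii: "integrable lborel (\<lambda>\<xi>. norm (?I \<xi>))"
    using emeasure_bounded_finite[OF bounded_cball, of "0 :: real^'d" R] by simp
  have [measurable]: "?I \<in> borel_measurable borel" by (intro borel_measurable_indicator) simp
  define q where "q y = (\<integral>\<xi>. ?I \<xi> * cis (- (\<xi> \<bullet> y)) \<partial>lborel)" for y
  have q_rot: "q y = q y'" if n: "norm y = norm y'" for y y'
  proof -
    obtain f where f: "orthogonal_transformation f" "f y = y'"
      using orthogonal_transformation_exists[OF n] by blast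
    have nf: "\<And>x. norm (f x) = norm x" and fi: "\<And>a b. f a \<bullet> f b = a \<bullet> b"
      using f(1) orthogonal_transformation orthogonal_transformation_def by blast+
    have "q y' = (\<integral>\<xi>. ?I (f \<xi>) * cis (- (f \<xi> \<bullet> f y)) \<partial>lborel)"
      unfolding q_def f(2)
      by (rule integral_rotate[OF f(1), symmetric, where f = "\<lambda>\<xi>. ?I \<xi> * cis (- (\<xi> \<bullet> y'))"]) measurable
    also have "\<dots> = q y"
      unfolding q_def fi by (simp add: indicator_def nf)
    finally show ?thesis ..
  qed
  have q: "of_real haar_mass * q y = (\<integral>\<xi>. ?I \<xi> * haar_bessel (norm \<xi> * norm y) \<partial>lborel)" for y
  proof -
    \<comment> \<open>Chosen so that \<open>transpose A *v ?w\<close> has the norm of y; there the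
      radial function \<open>q\<close> takes the value \<open>q y\<close>.\<close>
    let ?w = "norm y *\<^sub>R axis undefined 1 :: real^'m"
    have "continuous_on UNIV (\<lambda>(A :: real^'d^'m, \<xi> :: real^'d). cis (- (w \<bullet> (A *v \<xi>))))" for w
      unfolding case_prod_unfold by (intro continuous_intros matrix_continuous_intros)
    note [measurable] = haar_measurable_pair(1)[OF this]
    have m: "(\<lambda>(A :: real^'d^'m, \<xi>). ?I \<xi> * cis (- (?w \<bullet> (A *v \<xi>)))) \<in> borel_measurable (\<sigma> \<Otimes>\<^sub>M borel)"
    proof -
      have "(\<lambda>p. ?I (snd p) * (case p of (A :: real^'d^'m, \<xi> :: real^'d) \<Rightarrow> cis (- (?w \<bullet> (A *v \<xi>))))) \<in> borel_measurable (\<sigma> \<Otimes>\<^sub>M borel)"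
        by measurable
      then show ?thesis by (simp add: case_prod_unfold)
    qed
    have "(\<integral>A. \<integral>\<xi>. ?I \<xi> * cis (- (?w \<bullet> (A *v \<xi>))) \<partial>lborel \<partial>\<sigma>) = of_real haar_mass * q y"
    proof (rule haar_integral_AE_const)
      show "(\<lambda>A. \<integral>\<xi>. ?I \<xi> * cis (- (?w \<bullet> (A *v \<xi>))) \<partial>lborel) \<in> borel_measurable \<sigma>"
        using m by (intro lborel.borel_measurable_lebesgue_integral) simp
      fix A :: "real^'d^'m" assume "A \<in> stiefel"
      then have "norm (transpose A *v ?w) = norm y" by (simp only: stiefel_norm) simp
      then have "q (transpose A *v ?w) = q y" by (rule q_rot)
      then show "(\<integral>\<xi>. ?I \<xi> * cis (- (?w \<bullet> (A *v \<xi>))) \<partial>lborel) = q y"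
        unfolding q_def inner_commute[of _ "transpose A *v ?w"] inner_transpose .
    qed
    moreover have "(\<integral>A. \<integral>\<xi>. ?I \<xi> * cis (- (?w \<bullet> (A *v \<xi>))) \<partial>lborel \<partial>\<sigma>) = (\<integral>\<xi>. \<integral>A. ?I \<xi> * cis (- (?w \<bullet> (A *v \<xi>))) \<partial>\<sigma> \<partial>lborel)"
      by (rule haar_fubini[symmetric, where g = "\<lambda>\<xi>. norm (?I \<xi>)"]) (use m Ii in \<open>auto simp: norm_mult\<close>)
    moreover have "(\<integral>A. ?I \<xi> * cis (- (?w \<bullet> (A *v \<xi>))) \<partial>\<sigma>) = ?I \<xi> * haar_bessel (norm \<xi> * norm y)" for \<xi>
      using haar_char_radial[of ?w \<xi>] unfolding haar_char_def by (simp add: mult.commute)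
    ultimately show ?thesis by (simp only:)
  qed
  have "(\<integral>\<xi>. ?I \<xi> * fourier \<psi> \<xi> \<partial>lborel) = (\<integral>\<xi>. \<integral>y. ?I \<xi> * (cis (- (\<xi> \<bullet> y)) * \<psi> y) \<partial>lborel \<partial>lborel)"
    unfolding fourier_def by simp
  also have "\<dots> = (\<integral>y. \<integral>\<xi>. ?I \<xi> * (cis (- (\<xi> \<bullet> y)) * \<psi> y) \<partial>lborel \<partial>lborel)"
    by (rule fubini_swap[where ?g1.0 = "\<lambda>y. norm (\<psi> y)" and ?g2.0 = "\<lambda>\<xi>. norm (?I \<xi>)"])
      (use Ii schwartz_integrable[OF \<psi>] in \<open>auto simp: norm_mult mult.commute intro: lborel.sigma_finite_measure_axioms\<close>)
  also have "\<dots> = (\<integral>y. q y * \<psi> y \<partial>lborel)"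
    unfolding q_def mult.assoc[symmetric] by (simp only: integral_mult_left_zero)
  finally have "of_real haar_mass * (\<integral>\<xi>. ?I \<xi> * fourier \<psi> \<xi> \<partial>lborel) = (\<integral>y. (of_real haar_mass * q y) * \<psi> y \<partial>lborel)"
    by (simp only: integral_mult_right_zero mult.assoc)
  also have "\<dots> = (\<integral>y. \<integral>\<xi>. ?I \<xi> * haar_bessel (norm \<xi> * norm y) * \<psi> y \<partial>lborel \<partial>lborel)"
    unfolding q by (simp only: integral_mult_left_zero)
  also have "\<dots> = (\<integral>\<xi>. \<integral>y. ?I \<xi> * haar_bessel (norm \<xi> * norm y) * \<psi> y \<partial>lborel \<partial>lborel)"
  proof (rule fubini_swap[where ?g1.0 = "\<lambda>\<xi>. norm (?I \<xi>) * haar_mass" and ?g2.0 = "\<lambda>y. norm (\<psi> y)"])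
    show "AE \<xi> in lborel. \<forall>y\<in>space lborel. norm (?I \<xi> * haar_bessel (norm \<xi> * norm y) * \<psi> y) \<le> norm (?I \<xi>) * haar_mass * norm (\<psi> y)"
      by (intro AE_I2 ballI) (auto simp: norm_mult intro!: mult_right_mono mult_left_mono haar_bessel_bound)
  qed (use Ii schwartz_integrable[OF \<psi>] in \<open>auto intro: lborel.sigma_finite_measure_axioms\<close>)
  also have "\<dots> = (\<integral>\<xi>. ?I \<xi> * hankel \<psi> (norm \<xi>) \<partial>lborel)"
  proof -
    have "(\<integral>y. ?I \<xi> * haar_bessel (norm \<xi> * norm y) * \<psi> y \<partial>lborel) = ?I \<xi> * (\<integral>y. haar_bessel (norm \<xi> * norm y) * \<psi> y \<partial>lborel)" for \<xi>
      by (simp only: mult.assoc integral_mult_right_zero)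
    then show ?thesis unfolding hankel_def by (simp add: mult.commute)
  qed
  finally show ?thesis .
qed

text \<open>The cutoff of \<open>hankel_cball\<close> is removed by dominated convergence, both
  integrands being integrable over the whole space.\<close>

lemma hankel_integral:
  fixes \<psi> :: "real^'d \<Rightarrow> complex"
  assumes \<psi>: "\<psi> \<in> schwartz"
  shows "of_real haar_mass * (\<integral>\<xi>. fourier \<psi> \<xi> \<partial>lborel) = (\<integral>\<xi>. hankel \<psi> (norm \<xi>) \<partial>(lborel :: (real^'d) measure))"
proof -
  have lim: "(\<lambda>n. \<integral>\<xi>. indicator (cball (0::real^'d) (real n)) \<xi> * f \<xi> \<partial>lborel) \<longlonglongrightarrow> (\<integral>\<xi>. f \<xi> \<partial>lborel)"
    if f: "integrable lborel f" for f :: "real^'d \<Rightarrow> complex"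
  proof (rule integral_dominated_convergence[where w = "\<lambda>\<xi>. norm (f \<xi>)"])
    show "AE \<xi> in lborel. (\<lambda>n. indicator (cball (0::real^'d) (real n)) \<xi> * f \<xi>) \<longlonglongrightarrow> f \<xi>"
    proof (intro AE_I2)
      fix \<xi> :: "real^'d"
      obtain N where "norm \<xi> \<le> real N" using real_arch_simple by blast
      then have "\<forall>\<^sub>F n in sequentially. f \<xi> = indicator (cball (0::real^'d) (real n)) \<xi> * f \<xi>"
        unfolding eventually_sequentially by (intro exI[of _ N]) (auto simp: indicator_def)
      then show "(\<lambda>n. indicator (cball (0::real^'d) (real n)) \<xi> * f \<xi>) \<longlonglongrightarrow> f \<xi>"
        by (rule Lim_transform_eventually[rotated]) simp
    qed
  qed (use f in \<open>auto simp: norm_mult indicator_def\<close>)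
  have "(\<lambda>n. of_real haar_mass * (\<integral>\<xi>. indicator (cball (0::real^'d) (real n)) \<xi> * fourier \<psi> \<xi> \<partial>lborel)) \<longlonglongrightarrow> of_real haar_mass * (\<integral>\<xi>. fourier \<psi> \<xi> \<partial>lborel)"
    by (intro tendsto_intros lim schwartz_integrable schwartz_fourier \<psi>)
  moreover have "(\<lambda>n. of_real haar_mass * (\<integral>\<xi>. indicator (cball (0::real^'d) (real n)) \<xi> * fourier \<psi> \<xi> \<partial>lborel)) \<longlonglongrightarrow> (\<integral>\<xi>. hankel \<psi> (norm \<xi>) \<partial>(lborel :: (real^'d) measure))"
    unfolding hankel_cball[OF \<psi>] by (intro lim hankel_integrable \<psi>)
  ultimately show ?thesis by (rule LIMSEQ_unique)
qed

text \<open>Translation reduces the claim to the value at the origin.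
  \<open>integral_radial_change\<close> moves the averaged integral from dimension d - k to d,
  \<open>hankel_integral\<close> replaces the average by the Fourier transform itself, and Fourier
  inversion at 0 returns the function.\<close>

lemma kplane_inversion:
  fixes \<phi> :: "real^'d \<Rightarrow> complex"
  assumes k: "1 \<le> k" "k < CARD('d)" "CARD('m) = CARD('d) - k" and \<phi>: "\<phi> \<in> schwartz"
  shows "kplane_adj \<sigma> (K_op k (kplane \<phi>)) = \<phi>"
proof
  fix x :: "real^'d"
  let ?c = "kplane_const CARD('d) k" and ?M = "(2 * pi) ^ CARD('m) :: real"
  define \<psi> where "\<psi> y = \<phi> (y + x)" for y
  have \<psi>: "\<psi> \<in> schwartz" unfolding \<psi>_def by (rule schwartz_translate[OF \<phi>])
  note [measurable] = hankel_measurable[OF \<psi>]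
  have m: "(\<lambda>(A :: real^'d^'m, w). indicator stiefel A * (of_real (norm w ^ k) * fourier \<psi> (transpose A *v w))) \<in> borel_measurable (\<sigma> \<Otimes>\<^sub>M borel)"
  proof -
    note [measurable] = fourier_transpose_measurable[OF schwartz_fourier[OF \<psi>]]
    have "(\<lambda>p. indicator stiefel (fst p) * (of_real (norm (snd p) ^ k) * (case p of (A :: real^'d^'m, w) \<Rightarrow> fourier \<psi> (transpose A *v w)))) \<in> borel_measurable (\<sigma> \<Otimes>\<^sub>M borel)"
      by measurable
    then show ?thesis by (simp add: case_prod_unfold)
  qed
  \<comment> \<open>The phase of the evaluation point is absorbed into the transform of the
    translate \<open>\<psi>\<close>. The indicator makes the formula valid also off the Stiefel
    manifold, where both sides are 0.\<close>
  have K: "K_op k (kplane \<phi>) (A, A *v x) = of_real (?c / ?M) * (\<integral>w. indicator stiefel A * (of_real (norm w ^ k) * fourier \<psi> (transpose A *v w)) \<partial>lborel)" for A :: "real^'d^'m"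
  proof (cases "A \<in> stiefel")
    case True
    have "cis (w \<bullet> (A *v x)) * (of_real (?c * norm w ^ k) * fourier \<phi> (transpose A *v w)) =
        of_real ?c * (indicator stiefel A * (of_real (norm w ^ k) * fourier \<psi> (transpose A *v w)))" for w
      unfolding \<psi>_def fourier_translate[OF schwartz_measurable[OF \<phi>]] inner_transpose using True by (simp add: mult_ac)
    then show ?thesis
      unfolding K_op_kplane[OF True \<phi>] inv_fourier_def K_response_def
      by (simp only: integral_mult_right_zero DIM_cart) (simp add: mult_ac)
  qed (simp add: K_op_off)
  \<comment> \<open>The additional exponent k pays for the factor \<open>norm w ^ k\<close>.\<close>
  obtain C where C: "0 \<le> C" "\<And>x. norm (fourier \<psi> x) \<le> C * inverse ((1 + norm x) ^ (2 * DIM(real^'m) + k))"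
    using schwartz_decay[OF schwartz_fourier[OF \<psi>]] by blast
  have "kplane_adj \<sigma> (K_op k (kplane \<phi>)) x = of_real (?c / ?M) * (\<integral>A. \<integral>w. indicator stiefel A * (of_real (norm w ^ k) * fourier \<psi> (transpose A *v w)) \<partial>lborel \<partial>\<sigma>)"
    unfolding kplane_adj_def K by (simp only: integral_mult_right_zero)
  also have "(\<integral>A. \<integral>w. indicator stiefel A * (of_real (norm w ^ k) * fourier \<psi> (transpose A *v w)) \<partial>lborel \<partial>\<sigma>) =
     (\<integral>w. \<integral>A. indicator stiefel A * (of_real (norm w ^ k) * fourier \<psi> (transpose A *v w)) \<partial>\<sigma> \<partial>lborel)"
  proof (rule haar_fubini[symmetric, OF m])
    show "integrable lborel (\<lambda>w::real^'m. C * inverse ((1 + norm w) ^ (2 * DIM(real^'m) + 0)))"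
      by (intro integrable_mult_right integrable_weight)
    fix A :: "real^'d^'m" and w :: "real^'m" assume A: "A \<in> stiefel"
    have "norm (fourier \<psi> (transpose A *v w)) \<le> C * inverse ((1 + norm w) ^ (2 * DIM(real^'m) + k))"
      using C(2)[of "transpose A *v w"] unfolding stiefel_norm[OF A] .
    then have "norm w ^ k * norm (fourier \<psi> (transpose A *v w)) \<le> (1 + norm w) ^ k * (C * inverse ((1 + norm w) ^ (2 * DIM(real^'m) + k)))"
      by (intro mult_mono power_mono) auto
    also have "\<dots> = C * inverse ((1 + norm w) ^ (2 * DIM(real^'m) + 0))"
    proof -
      have "1 + norm w \<noteq> 0" by (smt (verit) norm_ge_zero)
      then show ?thesis by (simp add: power_add field_simps)
    qed
    finally show "norm (indicator stiefel A * (of_real (norm w ^ k) * fourier \<psi> (transpose A *v w))) \<le> C * inverse ((1 + norm w) ^ (2 * DIM(real^'m) + 0))"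
      using A by (simp add: norm_mult norm_power)
  qed
  also have "\<dots> = (\<integral>w. of_real (norm w ^ k) * hankel \<psi> (norm w) \<partial>(lborel :: (real^'m) measure))"
  proof (intro Bochner_Integration.integral_cong refl)
    fix w :: "real^'m"
    have m1: "(\<lambda>A :: real^'d^'m. fourier \<psi> (transpose A *v w)) \<in> borel_measurable \<sigma>"
      by (rule haar_measurable)
        (intro continuous_on_compose2[OF schwartz_continuous[OF schwartz_fourier[OF \<psi>], of UNIV]] continuous_intros matrix_continuous_intros, auto)
    have "(\<integral>A. indicator stiefel A * (of_real (norm w ^ k) * fourier \<psi> (transpose A *v w)) \<partial>\<sigma>) = (\<integral>A. of_real (norm w ^ k) * fourier \<psi> (transpose A *v w) \<partial>\<sigma>)"
    proof (rule integral_cong_AE)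
      show "AE A in \<sigma>. indicator stiefel A * (of_real (norm w ^ k) * fourier \<psi> (transpose A *v w)) = of_real (norm w ^ k) * fourier \<psi> (transpose A *v w)"
        using AE_haar by eventually_elim simp
    qed (use m1 in \<open>measurable\<close>)
    then show "(\<integral>A. indicator stiefel A * (of_real (norm w ^ k) * fourier \<psi> (transpose A *v w)) \<partial>\<sigma>) = of_real (norm w ^ k) * hankel \<psi> (norm w)"
      by (simp only: integral_mult_right_zero haar_average_fourier[OF \<psi>])
  qed
  finally have 1: "kplane_adj \<sigma> (K_op k (kplane \<phi>)) x = of_real (?c / ?M) * (\<integral>w. of_real (norm w ^ k) * hankel \<psi> (norm w) \<partial>(lborel :: (real^'m) measure))" .
  let ?Sd = "sphere_area (CARD('d) - 1)" and ?Sm = "sphere_area (CARD('m) - 1)"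
  have dm: "CARD('d) = CARD('m) + k" using k by simp
  have m0: "1 \<le> CARD('m)" using k by simp
  have 2: "of_real ?Sd * (\<integral>w. of_real (norm w ^ k) * hankel \<psi> (norm w) \<partial>(lborel :: (real^'m) measure)) = of_real ?Sm * (of_real haar_mass * (\<integral>\<xi>. fourier \<psi> \<xi> \<partial>lborel))"
  proof -
    have d: "DIM(real^'d) = DIM(real^'m) + k" using dm by simp
    have "1 \<le> CARD('d)" using k by simp
    from sphere_area_eq[OF this] sphere_area_eq[OF m0] integral_radial_change[OF hankel_measurable[OF \<psi>] d]
    show ?thesis unfolding hankel_integral[OF \<psi>] by simp
  qed
  have 3: "(\<integral>\<xi>. fourier \<psi> \<xi> \<partial>lborel) = of_real ((2 * pi) ^ CARD('d)) * \<phi> x"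
  proof -
    have "inv_fourier (fourier \<psi>) 0 = \<psi> 0" using inv_fourier_fourier[OF \<psi>] by simp
    then show ?thesis by (simp add: inv_fourier_def \<psi>_def field_simps)
  qed
  \<comment> \<open>\<open>kplane_const\<close> is made for this identity. The product of the
    factors \<open>sphere_area (n - 1)\<close> for n from k to d is split in two ways: into its
    first factor and the mass of \<sigma>, and into its last factor and the product in the
    denominator of \<open>kplane_const\<close>.\<close>
  have 4: "?c * ?Sm * haar_mass * (2 * pi) ^ CARD('d) = ?M * ?Sd"
  proof -
    let ?S = "\<lambda>n. sphere_area (n - 1)" and ?P = "\<Prod>n=k..CARD('d)-1. sphere_area (n - 1)"
    have Spos: "?S n > 0" for n by (rule sphere_area_pos)
    have P: "?P > 0" by (intro prod_pos) (auto intro: sphere_area_pos)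
    have "(\<Prod>n=k..CARD('d). ?S n) = ?S k * haar_mass"
      unfolding haar_mass_def using k by (subst prod.atLeast_Suc_atMost) auto
    moreover have "(\<Prod>n=k..CARD('d). ?S n) = ?P * ?Sd"
    proof -
      obtain e where e: "CARD('d) = Suc e" using k by (cases "CARD('d)") auto
      then have "k \<le> e" using k by simp
      then show ?thesis unfolding e by simp
    qed
    ultimately have e: "?S k * haar_mass = ?P * ?Sd" by simp
    have "(2 * pi) ^ CARD('d) = ?M * (2 * pi) ^ k" unfolding dm by (simp add: power_add)
    moreover have "?c * ?Sm * haar_mass * (2 * pi) ^ k = ?Sd"
    proof -
      have "?c * ?Sm * haar_mass * (2 * pi) ^ k = (?S k * haar_mass) / ?P"
        unfolding kplane_const_def k(3)[symmetric] using Spos[of "CARD('m)"] P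
        by (simp add: field_simps)
      also have "\<dots> = ?Sd" unfolding e by (rule nonzero_mult_div_cancel_left) (use P in linarith)
      finally show ?thesis .
    qed
    ultimately show ?thesis by (simp add: mult_ac)
  qed
  have "of_real ?Sd * (of_real ?M * kplane_adj \<sigma> (K_op k (kplane \<phi>)) x) = of_real ?c * (of_real ?Sd * (\<integral>w. of_real (norm w ^ k) * hankel \<psi> (norm w) \<partial>(lborel :: (real^'m) measure)))"
    unfolding 1 by (simp add: mult_ac)
  also have "\<dots> = of_real (?c * ?Sm * haar_mass * (2 * pi) ^ CARD('d)) * \<phi> x"
    unfolding 2 3 of_real_mult by (simp only: mult_ac)
  also have "\<dots> = of_real ?Sd * (of_real ?M * \<phi> x)"
    unfolding 4 of_real_mult by (simp only: mult_ac)
  finally show "kplane_adj \<sigma> (K_op k (kplane \<phi>)) x = \<phi> x"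
    using sphere_area_pos[of "CARD('d) - 1"] by simp
qed

end

section \<open>The inverse filter\<close>

lemma ddiff_sum:
  fixes f :: "'i \<Rightarrow> 'a::euclidean_space \<Rightarrow> complex"
  assumes "\<And>i. i \<in> I \<Longrightarrow> f i \<in> schwartz"
  shows "ddiff v (\<lambda>x. \<Sum>i\<in>I. a i * f i x) x = (\<Sum>i\<in>I. a i * ddiff v (f i) x)"
  by (rule ddiff_eq)
    (auto intro!: has_derivative_sum has_derivative_mult_right has_derivative_ddiff schwartz_differentiable assms)

lemma ddiff_expand:
  assumes "f \<in> schwartz"
  shows "ddiff v f = (\<lambda>x. \<Sum>b\<in>Basis. of_real (v \<bullet> b) * ddiff b f x)"
  using ddiff_basis[OF schwartz_differentiable[OF assms]] by blast

lemma norm_ddiff_le: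
  fixes f :: "'a::euclidean_space \<Rightarrow> complex"
  assumes "f \<in> schwartz"
  shows "norm (ddiff v f x) \<le> norm v * (\<Sum>b\<in>Basis. norm (ddiff b f x))"
  unfolding ddiff_expand[OF assms, of v] sum_distrib_left
  by (intro sum_norm_le) (auto simp: norm_mult intro!: mult_right_mono Basis_le_norm)

lemma norm_ddiff2_le:
  fixes f :: "'a::euclidean_space \<Rightarrow> complex"
  assumes "f \<in> schwartz"
  shows "norm (ddiff v (ddiff v f) x) \<le> (norm v)\<^sup>2 * (\<Sum>c\<in>Basis. \<Sum>b\<in>Basis. norm (ddiff b (ddiff c f) x))"
proof -
  have "ddiff v (ddiff v f) x = (\<Sum>c\<in>Basis. of_real (v \<bullet> c) * ddiff v (ddiff c f) x)"
    unfolding arg_cong[OF ddiff_expand[OF assms, of v], of "\<lambda>g. ddiff v g x"]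
    by (rule ddiff_sum) (rule schwartz_ddiff[OF assms])
  also have "norm \<dots> \<le> (\<Sum>c\<in>Basis. norm v * (norm v * (\<Sum>b\<in>Basis. norm (ddiff b (ddiff c f) x))))"
    by (intro sum_norm_le)
      (simp add: norm_mult mult_mono Basis_le_norm norm_ddiff_le[OF schwartz_ddiff[OF assms]])
  finally show ?thesis
    by (simp only: sum_distrib_left power2_eq_square mult.assoc)
qed

text \<open>The mean value inequality is used twice: for the even sum \<eta> on [0, 1], and for the
  first derivative on [-1, 1] in order to bound the derivative of \<eta>. The parameters s and -s
  are at distance at most 2, whence the factor.\<close>

lemma second_difference_le:
  fixes f :: "'a::euclidean_space \<Rightarrow> complex"
  assumes f: "f \<in> schwartz" and B: "\<And>s. \<bar>s\<bar> \<le> 1 \<Longrightarrow> norm (ddiff v (ddiff v f) (t + s *\<^sub>R v)) \<le> B"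
  shows "norm (2 * f t - f (t + v) - f (t - v)) \<le> 2 * B"
proof -
  have B0: "0 \<le> B" using order_trans[OF norm_ge_zero B[of 0]] by simp
  define \<eta> where "\<eta> s = f (t + s *\<^sub>R v) + f (t - s *\<^sub>R v)" for s :: real
  have d: "((\<lambda>s. g (t + (c * s) *\<^sub>R v)) has_vector_derivative of_real c * ddiff v g (t + (c * s) *\<^sub>R v)) (at s within S)"
    if g: "g \<in> schwartz" for g s c S
  proof -
    have "((\<lambda>s. g (t + (c * s) *\<^sub>R v)) has_vector_derivative ddiff (c *\<^sub>R v) g (t + (c * s) *\<^sub>R v)) (at s)"
      by (rule schwartz_has_vector_derivative[OF g, where \<gamma> = "\<lambda>s. t + (c * s) *\<^sub>R v"]) (auto intro!: derivative_eq_intros)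
    moreover have "ddiff (c *\<^sub>R v) g x = of_real c * ddiff v g x" for x
      using linear_cmul[OF has_derivative_linear[OF has_derivative_ddiff[OF schwartz_differentiable[OF g]]]]
      by (simp add: scaleR_conv_of_real)
    ultimately show ?thesis by (simp add: has_vector_derivative_at_within)
  qed
  have d1: "(\<eta> has_vector_derivative ddiff v f (t + s *\<^sub>R v) - ddiff v f (t - s *\<^sub>R v)) (at s within S)" for s S
    using has_vector_derivative_add[OF d[OF f, where c = 1 and s = s and S = S] d[OF f, where c = "-1" and s = s and S = S]]
    unfolding \<eta>_def[abs_def] by simp
  have b1: "norm (ddiff v f (t + s *\<^sub>R v) - ddiff v f (t - s *\<^sub>R v)) \<le> 2 * B" if s: "s \<in> {0..1}" for s
  proof -
    have "norm (ddiff v f (t + (1 * s) *\<^sub>R v) - ddiff v f (t + (1 * (- s)) *\<^sub>R v)) \<le> B * norm (s - (- s))"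
    proof (rule differentiable_bound[where S = "{-1..1}" and f' = "\<lambda>s h. h *\<^sub>R (ddiff v (ddiff v f) (t + s *\<^sub>R v))"])
      show "((\<lambda>s. ddiff v f (t + (1 * s) *\<^sub>R v)) has_derivative (\<lambda>h. h *\<^sub>R ddiff v (ddiff v f) (t + s *\<^sub>R v))) (at s within {-1..1})" for s
        using d[OF schwartz_ddiff[OF f], where c = 1 and s = s] unfolding has_vector_derivative_def by simp
      show "onorm (\<lambda>h. h *\<^sub>R ddiff v (ddiff v f) (t + s *\<^sub>R v)) \<le> B" if "s \<in> {-1..1}" for s :: real
        using that by (intro onorm_le) (use B[of s] in \<open>auto intro!: mult_left_mono simp: mult.commute[of B]\<close>)
    qed (use s in auto)
    also have "\<dots> \<le> B * 2" using s B0 by (intro mult_left_mono) auto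
    finally show ?thesis by simp
  qed
  have "norm (\<eta> 1 - \<eta> 0) \<le> 2 * B * norm (1 - 0 :: real)"
  proof (rule differentiable_bound[where S = "{0..1}" and f' = "\<lambda>s h. h *\<^sub>R (ddiff v f (t + s *\<^sub>R v) - ddiff v f (t - s *\<^sub>R v))"])
    show "(\<eta> has_derivative (\<lambda>h. h *\<^sub>R (ddiff v f (t + s *\<^sub>R v) - ddiff v f (t - s *\<^sub>R v)))) (at s within {0..1})" for s
      using d1 unfolding has_vector_derivative_def by blast
    show "onorm (\<lambda>h. h *\<^sub>R (ddiff v f (t + s *\<^sub>R v) - ddiff v f (t - s *\<^sub>R v))) \<le> 2 * B" if "s \<in> {0..1}" for s :: real
      using that by (intro onorm_le) (use b1[of s] in \<open>auto intro!: mult_left_mono simp: mult.commute[of "2 * B"]\<close>)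
  qed auto
  moreover have "norm (\<eta> 1 - \<eta> 0) = norm (2 * f t - f (t + v) - f (t - v))"
    unfolding \<eta>_def by (subst norm_minus_commute) (simp add: algebra_simps)
  ultimately show ?thesis by simp
qed

text \<open>For v = s z and the density 1 / s^2 the uniform bound yields convergence at infinity,
  and the quadratic bound, which uses two derivatives, yields it at 0. The constant is the sum of
  both so that it serves twice.\<close>

lemma second_difference_integral:
  fixes f :: "'a::euclidean_space \<Rightarrow> complex"
  assumes f: "f \<in> schwartz"
  obtains C where "0 \<le> C" "\<And>v. (\<integral>t. norm (2 * f t - f (t + v) - f (t - v)) \<partial>lborel) \<le> C"
    "\<And>v. norm v \<le> 1 \<Longrightarrow> (\<integral>t. norm (2 * f t - f (t + v) - f (t - v)) \<partial>lborel) \<le> C * (norm v)\<^sup>2"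
proof -
  let ?D = "\<lambda>v t. norm (2 * f t - f (t + v) - f (t - v))"
  let ?N = "2 * DIM('a) + 0"
  let ?W = "\<integral>t. inverse ((1 + norm (t::'a)) ^ ?N) \<partial>lborel"
  note [measurable] = schwartz_measurable[OF f]
  have Dsch: "(\<lambda>t. 2 * f t - f (t + v) - f (t - v)) \<in> schwartz" for v
    using schwartz_translate[OF f, of v] schwartz_translate[OF f, of "- v"] f
    by (intro schwartz_diff schwartz_scale) auto
  have Dint: "integrable lborel (?D v)" for v
    by (intro integrable_norm schwartz_integrable Dsch)
  have fint: "integrable lborel (\<lambda>t. norm (f (t + v)))" for v
    by (intro integrable_norm schwartz_integrable schwartz_translate f)
  have A: "(\<integral>t. ?D v t \<partial>lborel) \<le> 4 * (\<integral>t. norm (f t) \<partial>lborel)" for v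
  proof -
    have "(\<integral>t. ?D v t \<partial>lborel) \<le> (\<integral>t. (2 * norm (f t) + norm (f (t + v))) + norm (f (t + - v)) \<partial>lborel)"
    proof (intro integral_mono Dint)
      show "?D v t \<le> (2 * norm (f t) + norm (f (t + v))) + norm (f (t + - v))" for t
        using norm_triangle_ineq4[of "2 * f t - f (t + v)" "f (t - v)"] norm_triangle_ineq4[of "2 * f t" "f (t + v)"]
        by (simp add: norm_mult)
    qed (use fint[of 0] fint[of v] fint[of "- v"] in auto)
    also have "\<dots> = 2 * (\<integral>t. norm (f t) \<partial>lborel) + (\<integral>t. norm (f (t + v)) \<partial>lborel) + (\<integral>t. norm (f (t + - v)) \<partial>lborel)"
      using fint[of 0] fint[of v] fint[of "- v"] by simp
    also have "\<dots> = 4 * (\<integral>t. norm (f t) \<partial>lborel)"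
      using integral_translate[of "\<lambda>t. norm (f t)" v] integral_translate[of "\<lambda>t. norm (f t)" "- v"] by simp
    finally show ?thesis .
  qed
  have "\<exists>C. 0 \<le> C \<and> (\<forall>x. norm (ddiff b (ddiff c f) x) \<le> C * inverse ((1 + norm x) ^ ?N))" for b c
    using schwartz_decay[OF schwartz_ddiff[OF schwartz_ddiff[OF f]]] by metis
  then obtain K where K: "\<And>b c. 0 \<le> K b c" "\<And>b c x. norm (ddiff b (ddiff c f) x) \<le> K b c * inverse ((1 + norm x) ^ ?N)"
    by metis
  define K' where "K' = (\<Sum>c\<in>Basis. \<Sum>b\<in>Basis. K b (c::'a))"
  have K'0: "0 \<le> K'" unfolding K'_def by (intro sum_nonneg K)
  \<comment> \<open>For |s| \<le> 1 and |v| \<le> 1 the point t + s v stays within distance 1 of t,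
    so \<open>weight_translate\<close> costs only the factor 2^N.\<close>
  have pt: "?D v t \<le> (norm v)\<^sup>2 * (2 * K' * 2 ^ ?N) * inverse ((1 + norm t) ^ ?N)" if v: "norm v \<le> 1" for v t
  proof -
    have "?D v t \<le> 2 * ((norm v)\<^sup>2 * (K' * (2 ^ ?N * inverse ((1 + norm t) ^ ?N))))"
    proof (rule second_difference_le[OF f])
      fix s :: real assume s: "\<bar>s\<bar> \<le> 1"
      have "norm (s *\<^sub>R v) \<le> 1" using s v by (simp add: mult_le_one)
      then have "(1 + norm (s *\<^sub>R v)) ^ ?N \<le> 2 ^ ?N" by (intro power_mono) auto
      then have le: "(1 + norm t) ^ ?N \<le> 2 ^ ?N * (1 + norm (t + s *\<^sub>R v)) ^ ?N"
        using weight_translate[of t ?N "s *\<^sub>R v"] by (meson mult_right_mono order_trans zero_le_power add_nonneg_nonneg norm_ge_zero zero_le_one)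
      have pos: "(1 + norm t) ^ ?N > 0" "(1 + norm (t + s *\<^sub>R v)) ^ ?N > 0"
        by (auto intro!: zero_less_power add_pos_nonneg)
      have w: "inverse ((1 + norm (t + s *\<^sub>R v)) ^ ?N) \<le> 2 ^ ?N * inverse ((1 + norm t) ^ ?N)"
        using le pos by (simp add: divide_simps)
      have "norm (ddiff v (ddiff v f) (t + s *\<^sub>R v)) \<le> (norm v)\<^sup>2 * (\<Sum>c\<in>Basis. \<Sum>b\<in>Basis. norm (ddiff b (ddiff c f) (t + s *\<^sub>R v)))"
        by (rule norm_ddiff2_le[OF f])
      also have "\<dots> \<le> (norm v)\<^sup>2 * (\<Sum>c\<in>Basis. \<Sum>b\<in>Basis. K b c * inverse ((1 + norm (t + s *\<^sub>R v)) ^ ?N))"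
        by (intro mult_left_mono sum_mono K) auto
      also have "\<dots> = (norm v)\<^sup>2 * (K' * inverse ((1 + norm (t + s *\<^sub>R v)) ^ ?N))"
        unfolding K'_def by (simp only: sum_distrib_right)
      also have "\<dots> \<le> (norm v)\<^sup>2 * (K' * (2 ^ ?N * inverse ((1 + norm t) ^ ?N)))"
        by (intro mult_left_mono w K'0) auto
      finally show "norm (ddiff v (ddiff v f) (t + s *\<^sub>R v)) \<le> (norm v)\<^sup>2 * (K' * (2 ^ ?N * inverse ((1 + norm t) ^ ?N)))" .
    qed
    then show ?thesis by (simp only: mult_ac)
  qed
  have B: "(\<integral>t. ?D v t \<partial>lborel) \<le> (2 * K' * 2 ^ ?N * ?W) * (norm v)\<^sup>2" if v: "norm v \<le> 1" for v
  proof -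
    have "(\<integral>t. ?D v t \<partial>lborel) \<le> (\<integral>t. (norm v)\<^sup>2 * (2 * K' * 2 ^ ?N) * inverse ((1 + norm (t::'a)) ^ ?N) \<partial>lborel)"
      by (rule integral_mono[OF Dint integrable_mult_right[OF integrable_weight] pt[OF v]])
    also have "\<dots> = (norm v)\<^sup>2 * (2 * K' * 2 ^ ?N) * ?W"
      by (rule integral_mult_right_zero)
    finally show ?thesis by (simp only: mult_ac)
  qed
  have W0: "0 \<le> ?W" by (intro integral_nonneg_AE AE_I2) auto
  have F0: "0 \<le> (\<integral>t. norm (f t) \<partial>lborel)" by (intro integral_nonneg_AE AE_I2) auto
  let ?C = "4 * (\<integral>t. norm (f t) \<partial>lborel) + 2 * K' * 2 ^ ?N * ?W"
  show ?thesis
  proof (rule that[of ?C])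
    have P: "0 \<le> 2 * K' * 2 ^ ?N * ?W" using K'0 W0 by simp
    show "0 \<le> ?C" using P F0 by simp
    show "(\<integral>t. ?D v t \<partial>lborel) \<le> ?C" for v using A[of v] P by linarith
    show "(\<integral>t. ?D v t \<partial>lborel) \<le> ?C * (norm v)\<^sup>2" if "norm v \<le> 1" for v
    proof -
      have "(2 * K' * 2 ^ ?N * ?W) * (norm v)\<^sup>2 \<le> ?C * (norm v)\<^sup>2"
        using F0 by (intro mult_right_mono) auto
      then show ?thesis using B[OF that] by linarith
    qed
  qed
qed

section \<open>The norm as a superposition of cosines\<close>

definition vers_kernel :: "real \<Rightarrow> real \<Rightarrow> real" where
  "vers_kernel a s = indicator {0<..} s * (1 - cos (s * a)) / s\<^sup>2"

lemma vers_le: "1 - cos x \<le> x\<^sup>2 / 2" for x :: real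
proof -
  have "1 - cos x = 2 * (sin (x / 2))\<^sup>2"
    using cos_double_sin[of "x / 2"] by simp
  also have "(sin (x / 2))\<^sup>2 \<le> (x / 2)\<^sup>2"
    using abs_le_square_iff[of "sin (x / 2)" "x / 2"] abs_sin_x_le_abs_x[of "x / 2"] by blast
  finally show ?thesis by (simp add: power_divide)
qed

lemma vers_kernel_nonneg: "0 \<le> vers_kernel a s"
  unfolding vers_kernel_def by (auto simp: indicator_def)

text \<open>For s \<le> 1 the numerator is at most a^2 s^2 / 2, beyond 1 it is at most 2; and 4 / (1
  + s^2) is at least 1/2 in the first range and at least 2 / s^2 in the second.\<close>

lemma vers_kernel_le: "vers_kernel a s \<le> (1 + a\<^sup>2) * (4 * inverse (1 + s\<^sup>2))"
proof (cases "s > 0")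
  case True
  have p: "0 < 1 + s\<^sup>2" by (simp add: add_pos_nonneg)
  have "1 - cos (s * a) \<le> (1 + a\<^sup>2) * (4 * inverse (1 + s\<^sup>2)) * s\<^sup>2"
  proof (cases "s \<le> 1")
    case s: True
    have s2: "s\<^sup>2 \<le> 1" using s True by (simp add: power_le_one)
    have "1 - cos (s * a) \<le> a\<^sup>2 * s\<^sup>2 / 2" using vers_le[of "s * a"] by (simp add: power_mult_distrib mult.commute)
    also have "\<dots> \<le> (1 + a\<^sup>2) * (1 / 2) * s\<^sup>2" by (simp add: algebra_simps)
    also have "\<dots> \<le> (1 + a\<^sup>2) * (4 * inverse (1 + s\<^sup>2)) * s\<^sup>2"
    proof (intro mult_right_mono mult_left_mono)
      show "1 / 2 \<le> 4 * inverse (1 + s\<^sup>2)" using s2 p by (simp add: divide_simps)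
    qed auto
    finally show ?thesis .
  next
    case s: False
    then have s2: "1 \<le> s\<^sup>2" by (simp add: one_le_power)
    have "1 - cos (s * a) \<le> 2" using cos_ge_minus_one[of "s * a"] by linarith
    also have "2 \<le> 1 * (4 * inverse (1 + s\<^sup>2) * s\<^sup>2)" using s2 p by (simp add: divide_simps)
    also have "\<dots> \<le> (1 + a\<^sup>2) * (4 * inverse (1 + s\<^sup>2) * s\<^sup>2)"
      using p by (intro mult_right_mono) auto
    finally show ?thesis by (simp add: mult.assoc)
  qed
  moreover have "0 < s\<^sup>2" using True by simp
  ultimately have "(1 - cos (s * a)) / s\<^sup>2 \<le> (1 + a\<^sup>2) * (4 * inverse (1 + s\<^sup>2))"
    by (simp only: pos_divide_le_eq)
  then show ?thesis using True by (simp add: vers_kernel_def)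
qed (auto simp: vers_kernel_def add_nonneg_nonneg)

lemma vers_kernel_measurable [measurable]: "vers_kernel a \<in> borel_measurable borel"
  unfolding vers_kernel_def[abs_def] by measurable

lemma integrable_inverse_1_plus_sq: "integrable lborel (\<lambda>s::real. 4 * inverse (1 + s\<^sup>2))"
  using integrable_inverse_1_plus_square by (simp add: set_integrable_def)

lemma vers_kernel_integrable: "integrable lborel (vers_kernel a)"
  by (rule Bochner_Integration.integrable_bound[OF integrable_mult_right[OF integrable_inverse_1_plus_sq, of "1 + a\<^sup>2"]])
    (auto intro!: AE_I2 order_trans[OF _ abs_ge_self] vers_kernel_le simp: vers_kernel_nonneg)

text \<open>The classical value is pi / 2. The constant is divided out later, for which
  \<open>vers_const_pos\<close> suffices.\<close>

definition vers_const :: real where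
  "vers_const = (\<integral>s. vers_kernel 1 s \<partial>lborel)"

text \<open>Substituting |a| s for s pulls out the factor |a|; the kernel is even in a.\<close>

lemma vers_kernel_integral: "(\<integral>s. vers_kernel a s \<partial>lborel) = \<bar>a\<bar> * vers_const"
proof (cases "a = 0")
  case True
  then show ?thesis by (simp add: vers_kernel_def)
next
  case False
  have "vers_const = \<bar>\<bar>a\<bar>\<bar> *\<^sub>R (\<integral>s. vers_kernel 1 (0 + \<bar>a\<bar> * s) \<partial>lborel)"
    unfolding vers_const_def by (rule lborel_integral_real_affine) (use False in simp)
  also have "(\<lambda>s. vers_kernel 1 (0 + \<bar>a\<bar> * s)) = (\<lambda>s. inverse (a\<^sup>2) * vers_kernel a s)"
  proof
    fix s
    have "cos (\<bar>a\<bar> * s) = cos (s * a)"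
      by (cases "a \<ge> 0") (simp_all add: mult.commute)
    moreover have "0 < \<bar>a\<bar> * s \<longleftrightarrow> 0 < s" using False by (simp add: zero_less_mult_iff)
    ultimately show "vers_kernel 1 (0 + \<bar>a\<bar> * s) = inverse (a\<^sup>2) * vers_kernel a s"
      by (simp add: vers_kernel_def indicator_def power_mult_distrib divide_simps)
  qed
  also have "\<bar>\<bar>a\<bar>\<bar> *\<^sub>R (\<integral>s. inverse (a\<^sup>2) * vers_kernel a s \<partial>lborel) = (\<integral>s. vers_kernel a s \<partial>lborel) / \<bar>a\<bar>"
    using False by (simp add: power2_eq_square divide_simps abs_mult[symmetric])
  finally show ?thesis using False by (simp add: field_simps)
qed

lemma vers_const_pos: "vers_const > 0"
proof -
  have c1: "cos 1 < (1::real)"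
    using cos_monotone_0_pi[of 0 1] pi_gt3 by simp
  \<comment> \<open>On [1, 2] the cosine decreases and s^2 \<le> 4, so the kernel stays above (1 -
    cos 1) / 4.\<close>
  have "(\<integral>s. (1 - cos 1) / 4 * indicator {1..2::real} s \<partial>lborel) \<le> vers_const"
    unfolding vers_const_def
  proof (rule integral_mono)
    fix s :: real
    show "(1 - cos 1) / 4 * indicator {1..2} s \<le> vers_kernel 1 s"
    proof (cases "s \<in> {1..2}")
      case True
      then have "cos s \<le> cos 1" using cos_monotone_0_pi_le[of 1 s] pi_gt3 by simp
      moreover have "s\<^sup>2 \<le> 2\<^sup>2" using True by (intro power_mono) auto
      ultimately have "(1 - cos 1) * s\<^sup>2 \<le> (1 - cos s) * 4"
        using c1 by (intro mult_mono) auto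
      then show ?thesis using True by (simp add: vers_kernel_def divide_simps)
    qed (simp add: vers_kernel_nonneg)
  qed (auto intro: vers_kernel_integrable)
  then show ?thesis using c1 by simp
qed

lemma cball_measurable [measurable]: "cball a r \<in> sets borel"
  by simp

text \<open>Rotation invariance of the ball makes this proportional to \<open>norm w\<close>, see
  \<open>ball_moment_eq\<close>. It converts the one-dimensional representation of |w \<bullet> z|
  into one of the norm; a ball serves better than a sphere because Lebesgue measure is at hand on
  it.\<close>

definition ball_moment :: "real^'m \<Rightarrow> real" where
  "ball_moment w = (\<integral>z. indicator (cball 0 1) z * \<bar>w \<bullet> z\<bar> \<partial>lborel)"

lemma ball_moment_integrable:
  "integrable lborel (\<lambda>z. indicator (cball 0 1) z * \<bar>w \<bullet> (z :: real^'m)\<bar>)"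
proof (rule Bochner_Integration.integrable_bound)
  show "integrable lborel (\<lambda>z :: real^'m. norm w * indicator (cball 0 1) z)"
    using emeasure_bounded_finite[OF bounded_cball, of "0 :: real^'m" 1] by simp
  have "\<bar>w \<bullet> z\<bar> \<le> norm w" if "norm z \<le> 1" for z
    using Cauchy_Schwarz_ineq2[of w z] mult_left_mono[OF that, of "norm w"] by simp
  then show "AE z in lborel. norm (indicator (cball 0 1) z * \<bar>w \<bullet> z\<bar>) \<le> norm (norm w * indicator (cball 0 1) z)"
    by (intro AE_I2) (auto simp: indicator_def)
qed measurable

lemma ball_moment_eq:
  fixes w :: "real^'m"
  shows "ball_moment w = norm w * ball_moment (axis undefined 1 :: real^'m)"
proof -
  let ?u = "axis undefined 1 :: real^'m"
  have "norm (norm w *\<^sub>R ?u) = norm w" by simp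
  then obtain f where f: "orthogonal_transformation f" "f (norm w *\<^sub>R ?u) = w"
    using orthogonal_transformation_exists by blast
  have nf: "\<And>x. norm (f x) = norm x" and fi: "\<And>a b. f a \<bullet> f b = a \<bullet> b"
    using f(1) orthogonal_transformation orthogonal_transformation_def by blast+
  have "ball_moment w = (\<integral>z. indicator (cball 0 1) (f z) * \<bar>w \<bullet> f z\<bar> \<partial>lborel)"
    unfolding ball_moment_def
    by (rule integral_rotate[OF f(1), symmetric, where f = "\<lambda>z. indicator (cball 0 1) z * \<bar>w \<bullet> z\<bar>"]) measurable
  also have "\<dots> = (\<integral>z. norm w * (indicator (cball 0 1) z * \<bar>?u \<bullet> z\<bar>) \<partial>lborel)"
  proof (intro Bochner_Integration.integral_cong refl)
    fix z
    have "w \<bullet> f z = norm w * (?u \<bullet> z)" using fi[of "norm w *\<^sub>R ?u" z] f(2) by simp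
    then show "indicator (cball 0 1) (f z) * \<bar>w \<bullet> f z\<bar> = norm w * (indicator (cball 0 1) z * \<bar>?u \<bullet> z\<bar>)"
      by (simp add: indicator_def nf abs_mult)
  qed
  finally show ?thesis by (simp only: integral_mult_right_zero ball_moment_def)
qed

lemma ball_moment_pos: "ball_moment (axis undefined 1 :: real^'m) > 0"
proof -
  \<comment> \<open>\<open>?B\<close> lies in the unit ball, and |?u \<bullet> z| is at least 1/4 on
    it.\<close>
  let ?u = "axis undefined 1 :: real^'m" and ?B = "ball ((1/2) *\<^sub>R axis undefined 1) (1/4) :: (real^'m) set"
  have uu: "?u \<bullet> ?u = 1" by (simp add: inner_axis_axis)
  have fin: "emeasure lborel ?B < \<infinity>" by (rule emeasure_bounded_finite) simp
  have "(\<integral>z. (1/4) * indicator ?B z \<partial>lborel) \<le> ball_moment ?u"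
    unfolding ball_moment_def
  proof (rule integral_mono)
    fix z
    show "(1/4) * indicator ?B z \<le> indicator (cball 0 1) z * \<bar>?u \<bullet> z\<bar>"
    proof (cases "z \<in> ?B")
      case True
      then have d: "norm (z - (1/2) *\<^sub>R ?u) < 1/4" by (simp add: dist_norm norm_minus_commute)
      have "norm z \<le> norm (z - (1/2) *\<^sub>R ?u) + norm ((1/2) *\<^sub>R ?u)"
        using norm_triangle_ineq[of "z - (1/2) *\<^sub>R ?u" "(1/2) *\<^sub>R ?u"] by simp
      then have "norm z \<le> 1" using d by simp
      moreover have "\<bar>?u \<bullet> (z - (1/2) *\<^sub>R ?u)\<bar> \<le> 1/4"
        using Cauchy_Schwarz_ineq2[of ?u "z - (1/2) *\<^sub>R ?u"] d by simp
      then have "\<bar>?u \<bullet> z - 1/2\<bar> \<le> 1/4" using uu by (simp add: inner_diff_right)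
      then have "\<bar>?u \<bullet> z\<bar> \<ge> 1/4" by linarith
      ultimately show ?thesis by (simp add: indicator_def)
    qed simp
  qed (use fin ball_moment_integrable in auto)
  moreover have "(\<integral>z. (1/4) * indicator ?B z \<partial>lborel) = (1/4) * measure lborel ?B"
    using fin by simp
  moreover have "measure lborel ?B > 0" by (rule content_ball_pos) simp
  ultimately show ?thesis by linarith
qed

text \<open>The multiplier \<open>norm w\<close> is not smooth at the origin.  Writing it as a superposition of the
  multipliers \<open>1 - cos (s * (w \<bullet> z))\<close> turns the filtered function into a superposition of second
  differences, whose \<open>L\<^sup>1\<close> norms are controlled near \<open>s = 0\<close> and at infinity.\<close>

lemma inv_fourier_norm_integrable:
  fixes g :: "real^'m \<Rightarrow> complex"
  assumes g: "g \<in> schwartz"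
  shows "integrable lborel (inv_fourier (\<lambda>w. of_real (norm w) * g w))"
proof -
  let ?B = "cball (0 :: real^'m) 1"
  let ?c = "1 / (2 * pi) ^ DIM(real^'m)"
  define \<phi> where "\<phi> = inv_fourier g"
  have \<phi>: "\<phi> \<in> schwartz" unfolding \<phi>_def by (rule schwartz_inv_fourier[OF g])
  note [measurable] = schwartz_measurable[OF g] schwartz_measurable[OF \<phi>]
  define D where "D t v = 2 * \<phi> t - \<phi> (t + v) - \<phi> (t - v)" for t v
  \<comment> \<open>The density of the superposition. It is not integrable near s = 0; its products
    with 1 - cos or with the L1 norm of a second difference are, and multiples of \<open>b\<close>
    dominate them.\<close>
  define q where "q = (\<lambda>(s::real, z). indicator ?B z * (indicator {0<..} s / s\<^sup>2))"
  define b where "b = (\<lambda>(s::real, z). indicator ?B z * (4 * inverse (1 + s\<^sup>2)))"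
  have [measurable]: "q \<in> borel_measurable borel" "b \<in> borel_measurable borel"
    unfolding q_def b_def borel_prod[symmetric] by measurable
  have bi: "integrable lborel b"
    unfolding b_def lborel_prod[symmetric]
  proof (rule integrable_pair_bound[OF _ _ _ integrable_inverse_1_plus_sq, where ?g2.0 = "indicator ?B"])
    show "integrable lborel (indicator ?B :: real^'m \<Rightarrow> real)"
      using emeasure_bounded_finite[OF bounded_cball, of "0 :: real^'m" 1] by simp
  qed (auto intro: lborel.sigma_finite_measure_axioms)
  have b0: "0 \<le> b p" for p by (cases p) (auto simp: b_def intro!: mult_nonneg_nonneg)
  have qv: "q (s, z) * (1 - cos (s * (w \<bullet> z))) = indicator ?B z * vers_kernel (w \<bullet> z) s" for s z w
    by (simp add: q_def vers_kernel_def)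
  have qv_le: "q p * (1 - cos (fst p * (w \<bullet> snd p))) \<le> (1 + (norm w)\<^sup>2) * b p" for p w
  proof (cases p)
    case (Pair s z)
    have "indicator ?B z * vers_kernel (w \<bullet> z) s \<le> indicator ?B z * ((1 + (norm w)\<^sup>2) * (4 * inverse (1 + s\<^sup>2)))"
    proof (cases "z \<in> ?B")
      case True
      have "\<bar>w \<bullet> z\<bar> \<le> norm w"
        using Cauchy_Schwarz_ineq2[of w z] mult_left_mono[of "norm z" 1 "norm w"] True by simp
      then have "(w \<bullet> z)\<^sup>2 \<le> (norm w)\<^sup>2" by (simp add: abs_le_square_iff[symmetric])
      then have "(1 + (w \<bullet> z)\<^sup>2) * (4 * inverse (1 + s\<^sup>2)) \<le> (1 + (norm w)\<^sup>2) * (4 * inverse (1 + s\<^sup>2))"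
        by (intro mult_right_mono) (auto simp: add_nonneg_nonneg)
      then show ?thesis using vers_kernel_le[of "w \<bullet> z" s] True by simp
    qed simp
    then show ?thesis unfolding Pair fst_conv snd_conv qv by (simp add: b_def mult_ac)
  qed
  have q0: "0 \<le> q p" for p by (cases p) (auto simp: q_def indicator_def)
  have qv0: "0 \<le> q p * (1 - cos x)" for p x using q0 by (simp add: mult_nonneg_nonneg)
  have qi: "integrable lborel (\<lambda>p. q p * (1 - cos (fst p * (w \<bullet> snd p))))" for w
  proof (rule Bochner_Integration.integrable_bound[OF integrable_mult_right[OF bi, of "1 + (norm w)\<^sup>2"]])
    have [measurable]: "(\<lambda>p :: real \<times> (real^'m). cos (fst p * (w \<bullet> snd p))) \<in> borel_measurable borel"
      by (intro borel_measurable_continuous_onI continuous_intros)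
    show "(\<lambda>p. q p * (1 - cos (fst p * (w \<bullet> snd p)))) \<in> borel_measurable lborel"
      by measurable
    show "AE p in lborel. norm (q p * (1 - cos (fst p * (w \<bullet> snd p)))) \<le> norm ((1 + (norm w)\<^sup>2) * b p)"
      unfolding real_norm_def abs_of_nonneg[OF qv0] by (intro AE_I2 order_trans[OF qv_le abs_ge_self])
  qed
  let ?k = "vers_const * ball_moment (axis undefined 1 :: real^'m)"
  have k0: "?k > 0" using vers_const_pos ball_moment_pos by (rule mult_pos_pos)
  \<comment> \<open>Integration over s gives |w \<bullet> z| by \<open>vers_kernel_integral\<close>,
    and integration over z then gives the norm by \<open>ball_moment_eq\<close>.\<close>
  have rep: "(\<integral>p. q p * (1 - cos (fst p * (w \<bullet> snd p))) \<partial>lborel) = norm w * ?k" for w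
  proof -
    have "integrable (lborel \<Otimes>\<^sub>M lborel) (\<lambda>(s, z). indicator ?B z * vers_kernel (w \<bullet> z) s)"
      using qi[of w] unfolding lborel_prod by (rule back_subst[where P = "integrable lborel"]) (auto simp: fun_eq_iff qv)
    from lborel_pair.integral_snd[OF this]
    have "(\<integral>z. \<integral>s. indicator ?B z * vers_kernel (w \<bullet> z) s \<partial>lborel \<partial>lborel) = (\<integral>p. q p * (1 - cos (fst p * (w \<bullet> snd p))) \<partial>lborel)"
      unfolding lborel_prod by (simp add: case_prod_unfold qv[symmetric])
    moreover have "(\<integral>z. \<integral>s. indicator ?B z * vers_kernel (w \<bullet> z) s \<partial>lborel \<partial>lborel) = vers_const * ball_moment w"
      unfolding ball_moment_def
      by (simp only: integral_mult_right_zero vers_kernel_integral mult.assoc[symmetric] integral_mult_left_zero) (simp only: mult.commute)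
    ultimately show ?thesis unfolding ball_moment_eq[of w] by (simp only: mult_ac)
  qed
  \<comment> \<open>On the Fourier side 1 - cos (w \<bullet> v) is half a second difference, the
    cosine being the mean of the characters of v and -v. The constant undoes the normalization of
    \<open>inv_fourier\<close>.\<close>
  have inner: "(\<integral>w. cis (w \<bullet> t) * g w * of_real (1 - cos (w \<bullet> v)) \<partial>lborel) = of_real (1 / (2 * ?c)) * D t v" for t v
  proof -
    have ic: "integrable lborel (\<lambda>w. cis (w \<bullet> t) * g w)" for t
      using integrable_cis_mult(2)[OF schwartz_integrable[OF g], of t] by (simp add: inner_commute)
    have \<phi>e: "(\<integral>w. cis (w \<bullet> t) * g w \<partial>lborel) = of_real (1 / ?c) * \<phi> t" for t
      unfolding \<phi>_def inv_fourier_def by simp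
    have "cis (w \<bullet> t) * g w * of_real (1 - cos (w \<bullet> v)) =
        cis (w \<bullet> t) * g w - (1/2) * (cis (w \<bullet> (t + v)) * g w) - (1/2) * (cis (w \<bullet> (t - v)) * g w)" for w
    proof -
      have h1: "of_real (1 - cos (w \<bullet> v)) = 1 - (1/2) * cis (w \<bullet> v) - (1/2) * cis (- (w \<bullet> v))"
        by (simp add: complex_eq_iff)
      have h2: "cis (w \<bullet> (t + v)) = cis (w \<bullet> t) * cis (w \<bullet> v)" "cis (w \<bullet> (t - v)) = cis (w \<bullet> t) * cis (- (w \<bullet> v))"
        by (simp_all add: cis_mult inner_add_right inner_diff_right)
      show ?thesis unfolding h1 h2 by (simp add: algebra_simps)
    qed
    then have "(\<integral>w. cis (w \<bullet> t) * g w * of_real (1 - cos (w \<bullet> v)) \<partial>lborel) =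
      (\<integral>w. cis (w \<bullet> t) * g w \<partial>lborel) - (1/2) * (\<integral>w. cis (w \<bullet> (t + v)) * g w \<partial>lborel) - (1/2) * (\<integral>w. cis (w \<bullet> (t - v)) * g w \<partial>lborel)"
      by (simp only: Bochner_Integration.integral_diff Bochner_Integration.integrable_diff integrable_mult_right ic integral_mult_right_zero)
    also have "\<dots> = of_real (1 / (2 * ?c)) * D t v"
    proof -
      define Q :: complex where "Q = of_real (1 / (2 * ?c))"
      have Q: "of_real (1 / ?c) = 2 * Q" by (simp add: Q_def)
      show ?thesis unfolding \<phi>e Q Q_def[symmetric] D_def by (simp add: algebra_simps)
    qed
    finally show ?thesis .
  qed
  \<comment> \<open>The factor 1 + |w|^2 is the growth allowed by \<open>vers_kernel_le\<close>; the
    decay of \<open>g\<close> absorbs it.\<close>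
  have gi: "integrable lborel (\<lambda>w. norm (g w) * (1 + (norm w)\<^sup>2))"
  proof -
    have "integrable lborel (\<lambda>w. norm (g w) + (norm w)\<^sup>2 * norm (g w))"
      by (intro Bochner_Integration.integrable_add schwartz_mult_norm2_integrable[OF g] integrable_norm schwartz_integrable g)
    then show ?thesis by (simp add: distrib_left mult.commute)
  qed
  have F: "of_real ?k * inv_fourier (\<lambda>w. of_real (norm w) * g w) t = (\<integral>p. of_real (q p / 2) * D t (fst p *\<^sub>R snd p) \<partial>lborel)" for t
  proof -
    let ?f = "\<lambda>w p. cis (w \<bullet> t) * g w * of_real (q p * (1 - cos (fst p * (w \<bullet> snd p))))"
    have "of_real ?k * inv_fourier (\<lambda>w. of_real (norm w) * g w) t = of_real ?c * (\<integral>w. cis (w \<bullet> t) * g w * of_real (norm w * ?k) \<partial>lborel)"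
    proof -
      have "(\<integral>w. cis (w \<bullet> t) * g w * of_real (norm w * ?k) \<partial>lborel) = (\<integral>w. of_real ?k * (cis (w \<bullet> t) * (of_real (norm w) * g w)) \<partial>lborel)"
        by (intro Bochner_Integration.integral_cong refl) (simp only: of_real_mult mult_ac)
      also have "\<dots> = of_real ?k * (\<integral>w. cis (w \<bullet> t) * (of_real (norm w) * g w) \<partial>lborel)"
        by (rule integral_mult_right_zero)
      finally show ?thesis unfolding inv_fourier_def by (simp only: mult.left_commute)
    qed
    also have "\<dots> = of_real ?c * (\<integral>w. \<integral>p. ?f w p \<partial>lborel \<partial>lborel)"
      unfolding rep[symmetric] by (simp only: integral_mult_right_zero integral_complex_of_real)
    also have "(\<integral>w. \<integral>p. ?f w p \<partial>lborel \<partial>lborel) = (\<integral>p. \<integral>w. ?f w p \<partial>lborel \<partial>lborel)"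
    proof (rule fubini_swap[symmetric, OF _ _ _ gi bi])
      show "AE w in lborel. \<forall>p\<in>space lborel. norm (?f w p) \<le> norm (g w) * (1 + (norm w)\<^sup>2) * b p"
      proof (intro AE_I2 ballI)
        fix w p
        have "norm (?f w p) = norm (g w) * (q p * (1 - cos (fst p * (w \<bullet> snd p))))"
          by (simp only: norm_mult norm_cis norm_of_real abs_of_nonneg[OF qv0] mult_1_left)
        also have "\<dots> \<le> norm (g w) * ((1 + (norm w)\<^sup>2) * b p)"
          by (intro mult_left_mono qv_le) simp
        finally show "norm (?f w p) \<le> norm (g w) * (1 + (norm w)\<^sup>2) * b p" by (simp only: mult.assoc)
      qed
      have "continuous_on UNIV (\<lambda>x :: (real^'m) \<times> (real \<times> (real^'m)). cos (fst (snd x) * (fst x \<bullet> snd (snd x))))"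
        by (intro continuous_intros)
      then have [measurable]: "(\<lambda>x :: (real^'m) \<times> (real \<times> (real^'m)). cos (fst (snd x) * (fst x \<bullet> snd (snd x)))) \<in> borel_measurable (lborel \<Otimes>\<^sub>M lborel)"
        using borel_measurable_continuous_onI unfolding lborel_prod by simp
      show "(\<lambda>(w, p). ?f w p) \<in> borel_measurable (lborel \<Otimes>\<^sub>M lborel)"
        unfolding case_prod_unfold by measurable
    qed (auto intro: lborel.sigma_finite_measure_axioms)
    also have "of_real ?c * \<dots> = (\<integral>p. of_real (q p / 2) * D t (fst p *\<^sub>R snd p) \<partial>lborel)"
    proof -
      have "(\<integral>w. ?f w p \<partial>lborel) = of_real (1 / ?c) * (of_real (q p / 2) * D t (fst p *\<^sub>R snd p))" for p
      proof -
        have "(\<integral>w. ?f w p \<partial>lborel) = (\<integral>w. of_real (q p) * (cis (w \<bullet> t) * g w * of_real (1 - cos (w \<bullet> (fst p *\<^sub>R snd p)))) \<partial>lborel)"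
          by (intro Bochner_Integration.integral_cong refl) (simp only: of_real_mult inner_scaleR_right mult_ac)
        then show ?thesis unfolding integral_mult_right_zero inner by simp
      qed
      then have "of_real ?c * (\<integral>p. \<integral>w. ?f w p \<partial>lborel \<partial>lborel) = of_real ?c * (of_real (1 / ?c) * (\<integral>p. of_real (q p / 2) * D t (fst p *\<^sub>R snd p) \<partial>lborel))"
        by (simp only: integral_mult_right_zero)
      moreover have "of_real ?c * of_real (1 / ?c) = (1 :: complex)" by simp
      ultimately show ?thesis by (simp only: mult.assoc[symmetric] mult_1_left)
    qed
    finally show ?thesis .
  qed
  obtain C where C: "0 \<le> C" "\<And>v. (\<integral>t. norm (D t v) \<partial>lborel) \<le> C"
      "\<And>v. norm v \<le> 1 \<Longrightarrow> (\<integral>t. norm (D t v) \<partial>lborel) \<le> C * (norm v)\<^sup>2"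
    using second_difference_integral[OF \<phi>] unfolding D_def by blast
  have Dsch: "(\<lambda>t. D t v) \<in> schwartz" for v
    using schwartz_translate[OF \<phi>, of v] schwartz_translate[OF \<phi>, of "- v"] \<phi> unfolding D_def
    by (intro schwartz_diff schwartz_scale) auto
  \<comment> \<open>For s \<le> 1 the quadratic smallness of the L1 norm compensates 1 / s^2, for s
    > 1 its boundedness suffices; 4 / (1 + s^2) covers both ranges.\<close>
  have Dbd: "q p * (\<integral>t. norm (D t (fst p *\<^sub>R snd p)) \<partial>lborel) \<le> C * b p" for p
  proof (cases p)
    case (Pair s z)
    show ?thesis
    proof (cases "z \<in> ?B \<and> s > 0")
      case True
      then have z: "norm z \<le> 1" and s: "s > 0" by auto
      have p: "0 < 1 + s\<^sup>2" by (simp add: add_pos_nonneg)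
      have "(\<integral>t. norm (D t (s *\<^sub>R z)) \<partial>lborel) \<le> C * (4 * inverse (1 + s\<^sup>2)) * s\<^sup>2"
      proof (cases "s \<le> 1")
        case s1: True
        have s2: "s\<^sup>2 \<le> 1" using s1 s by (simp add: power_le_one)
        have n: "norm (s *\<^sub>R z) \<le> s" using z s by (simp add: mult_left_le)
        have "(\<integral>t. norm (D t (s *\<^sub>R z)) \<partial>lborel) \<le> C * (norm (s *\<^sub>R z))\<^sup>2" using n s1 by (intro C) simp
        also have "\<dots> \<le> C * 1 * s\<^sup>2" using n C(1) by (simp add: mult_left_mono power_mono)
        also have "\<dots> \<le> C * (4 * inverse (1 + s\<^sup>2)) * s\<^sup>2"
        proof (intro mult_right_mono mult_left_mono C(1))
          show "1 \<le> 4 * inverse (1 + s\<^sup>2)" using s2 p by (simp add: divide_simps)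
        qed auto
        finally show ?thesis .
      next
        case False
        then have s2: "1 \<le> s\<^sup>2" by (simp add: one_le_power)
        have "(\<integral>t. norm (D t (s *\<^sub>R z)) \<partial>lborel) \<le> C * 1" using C(2) by simp
        also have "\<dots> \<le> C * (4 * inverse (1 + s\<^sup>2) * s\<^sup>2)"
        proof (intro mult_left_mono C(1))
          show "1 \<le> 4 * inverse (1 + s\<^sup>2) * s\<^sup>2" using s2 p by (simp add: divide_simps)
        qed
        finally show ?thesis by (simp add: mult.assoc)
      qed
      then show ?thesis using True by (simp add: Pair q_def b_def divide_simps)
    next
      case False
      then show ?thesis using C(1) b0[of p] by (auto simp: Pair q_def)
    qed
  qed
  \<comment> \<open>Joint integrability in (p, t): integrating out p leaves, by \<open>F\<close>, a
    multiple of the filtered function, which is thereby integrable in t.\<close>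
  have "integrable (lborel \<Otimes>\<^sub>M lborel) (\<lambda>(p, t). of_real (q p / 2) * D t (fst p *\<^sub>R snd p))"
  proof (rule lborel_pair.Fubini_integrable)
    have "continuous_on UNIV (\<lambda>x :: (real \<times> (real^'m)) \<times> (real^'m). D (snd x) (fst (fst x) *\<^sub>R snd (fst x)))"
      unfolding D_def by (intro continuous_intros continuous_on_compose2[OF schwartz_continuous[OF \<phi>, of UNIV]]) auto
    then have [measurable]: "(\<lambda>x :: (real \<times> (real^'m)) \<times> (real^'m). D (snd x) (fst (fst x) *\<^sub>R snd (fst x))) \<in> borel_measurable (lborel \<Otimes>\<^sub>M lborel)"
      using borel_measurable_continuous_onI unfolding lborel_prod by simp
    show "(\<lambda>(p, t). of_real (q p / 2) * D t (fst p *\<^sub>R snd p)) \<in> borel_measurable (lborel \<Otimes>\<^sub>M lborel)"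
      unfolding case_prod_unfold by measurable
    then have m: "(\<lambda>p. \<integral>t. norm (case (p, t) of (p, t) \<Rightarrow> of_real (q p / 2) * D t (fst p *\<^sub>R snd p)) \<partial>lborel) \<in> borel_measurable lborel"
      by (intro lborel.borel_measurable_lebesgue_integral) (simp add: case_prod_unfold)
    show "integrable lborel (\<lambda>p. \<integral>t. norm (case (p, t) of (p, t) \<Rightarrow> of_real (q p / 2) * D t (fst p *\<^sub>R snd p)) \<partial>lborel)"
    proof (rule Bochner_Integration.integrable_bound[OF integrable_mult_right[OF bi, of "C / 2"] m], intro AE_I2)
      fix p
      have "(\<integral>t. norm (of_real (q p / 2) * D t (fst p *\<^sub>R snd p)) \<partial>lborel) = q p * (\<integral>t. norm (D t (fst p *\<^sub>R snd p)) \<partial>lborel) / 2"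
        using q0[of p] by (simp add: norm_mult)
      also have "\<dots> \<le> C / 2 * b p" using Dbd[of p] by simp
      finally show "norm (\<integral>t. norm (case (p, t) of (p, t) \<Rightarrow> of_real (q p / 2) * D t (fst p *\<^sub>R snd p)) \<partial>lborel) \<le> norm (C / 2 * b p)"
        using C(1) b0[of p] by (simp add: abs_mult)
    qed
    show "AE p in lborel. integrable lborel (\<lambda>t. case (p, t) of (p, t) \<Rightarrow> of_real (q p / 2) * D t (fst p *\<^sub>R snd p))"
      unfolding prod.case by (intro AE_I2 integrable_mult_right schwartz_integrable Dsch)
  qed
  from lborel_pair.integrable_snd[OF this]
  have "integrable lborel (\<lambda>t. of_real ?k * inv_fourier (\<lambda>w. of_real (norm w) * g w) t)"
    unfolding F .
  moreover have "inverse (of_real ?k) * (of_real ?k * x) = x" for x :: complex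
  proof -
    have "(of_real ?k :: complex) \<noteq> 0" using k0 unfolding of_real_eq_0_iff by linarith
    moreover have "inverse a * (a * x) = x" if "a \<noteq> 0" for a :: complex
      using that by simp
    ultimately show ?thesis by blast
  qed
  ultimately show ?thesis
    using integrable_mult_right[of "inverse (of_real ?k)" lborel "\<lambda>t. of_real ?k * inv_fourier (\<lambda>w. of_real (norm w) * g w) t"]
    by (simp only:)
qed

text \<open>Even powers of the norm are polynomials: each step multiplies by the sum of the squares
  of the coordinates.\<close>

lemma schwartz_norm_power:
  fixes h :: "'a::euclidean_space \<Rightarrow> complex"
  assumes "h \<in> schwartz"
  shows "(\<lambda>w. of_real (norm w ^ (2 * j)) * h w) \<in> schwartz"
proof (induction j)
  case 0
  then show ?case using assms by simp
next
  case (Suc j)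
  have "(\<lambda>w. \<Sum>b\<in>Basis. of_real (w \<bullet> b) * (of_real (w \<bullet> b) * (of_real (norm w ^ (2 * j)) * h w))) \<in> schwartz"
    by (intro schwartz_sum schwartz_mult_inner Suc) simp
  moreover have "(\<Sum>b\<in>Basis. of_real (w \<bullet> b) * (of_real (w \<bullet> b) * (of_real (norm w ^ (2 * j)) * h w))) = of_real (norm w ^ (2 * Suc j)) * h w" for w
  proof -
    have "(norm w)\<^sup>2 = (\<Sum>b\<in>Basis. (w \<bullet> b) * (w \<bullet> b))"
      unfolding power2_norm_eq_inner by (rule euclidean_inner)
    then have "of_real (norm w ^ (2 * Suc j)) * h w = of_real ((\<Sum>b\<in>Basis. (w \<bullet> b) * (w \<bullet> b)) * norm w ^ (2 * j)) * h w"
      by (simp only: power_add[symmetric] flip: \<open>(norm w)\<^sup>2 = _\<close>) simp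
    then show ?thesis by (simp only: of_real_mult of_real_sum sum_distrib_right mult.assoc)
  qed
  ultimately show ?case by simp
qed

text \<open>For even k the product with \<open>h\<close> is Schwartz. For odd k an even power is
  merged with \<open>h\<close> and a single factor \<open>norm w\<close> remains, the case of
  \<open>inv_fourier_norm_integrable\<close>.\<close>

lemma fourier_inv_fourier_norm_power:
  fixes h :: "real^'m \<Rightarrow> complex"
  assumes h: "h \<in> schwartz"
  shows "fourier (inv_fourier (\<lambda>w. of_real (norm w ^ k) * h w)) = (\<lambda>w. of_real (norm w ^ k) * h w)"
proof -
  obtain C where C: "0 \<le> C" "\<And>w. (1 + norm w) ^ k * norm (h w) \<le> C"
    using schwartz_bound[OF h] by blast
  have le: "norm (of_real (norm w ^ k) * h w) \<le> (1 + norm w) ^ k * norm (h w)" for w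
    by (auto simp: norm_mult norm_power intro!: mult_right_mono power_mono)
  have 1: "integrable lborel (\<lambda>w. of_real (norm w ^ k) * h w)"
    by (rule Bochner_Integration.integrable_bound[OF schwartz_integrable_weighted[OF h, of k]])
      (use schwartz_measurable[OF h] le in \<open>auto intro!: AE_I2 order_trans[OF le] abs_ge_self\<close>)
  have 2: "continuous_on UNIV (\<lambda>w. of_real (norm w ^ k) * h w)"
    by (intro continuous_intros schwartz_continuous[OF h])
  have 3: "norm (of_real (norm w ^ k) * h w) \<le> C" for w
    using le[of w] C(2)[of w] by linarith
  have 4: "integrable lborel (inv_fourier (\<lambda>w. of_real (norm w ^ k) * h w))"
  proof (cases "even k")
    case True
    then obtain j where "k = 2 * j" by blast
    then show ?thesis using schwartz_integrable[OF schwartz_inv_fourier[OF schwartz_norm_power[OF h, of j]]] by simp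
  next
    case False
    then obtain j where k: "k = 2 * j + 1" using oddE by blast
    have "(\<lambda>w. of_real (norm w ^ k) * h w) = (\<lambda>w. of_real (norm w) * (of_real (norm w ^ (2 * j)) * h w))"
      unfolding k by (simp add: fun_eq_iff mult_ac)
    then show ?thesis using inv_fourier_norm_integrable[OF schwartz_norm_power[OF h, of j]] by simp
  qed
  show ?thesis using fourier_inv_fourier_integrable[OF 1 2 3 4] by blast
qed

text \<open>The exceptional point matters for \<open>K_inv\<close>: for positive k the response
  vanishes at 0, and by \<open>inverse 0 = 0\<close> the response times its inverse is 0 instead of
  1 there.\<close>

lemma inv_fourier_cong_AE:
  fixes f g :: "'a::euclidean_space \<Rightarrow> complex"
  assumes "\<And>w. w \<noteq> 0 \<Longrightarrow> f w = g w" and [measurable]: "f \<in> borel_measurable borel" "g \<in> borel_measurable borel"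
  shows "inv_fourier f t = inv_fourier g t"
proof -
  have "AE w in lborel. w \<noteq> (0::'a)" by (rule AE_lborel_singleton)
  then have "AE w in lborel. cis (w \<bullet> t) * f w = cis (w \<bullet> t) * g w"
    by eventually_elim (use assms(1) in auto)
  then have "(\<integral>w. cis (w \<bullet> t) * f w \<partial>lborel) = (\<integral>w. cis (w \<bullet> t) * g w \<partial>lborel)"
    by (intro integral_cong_AE) auto
  then show ?thesis by (simp add: inv_fourier_def)
qed

lemma K_inv_K_op:
  fixes \<phi> :: "real^'d \<Rightarrow> complex" and A :: "real^'d^'m"
  assumes A: "A \<in> stiefel" and \<phi>: "\<phi> \<in> schwartz"
  shows "K_inv k (K_op k (kplane \<phi>)) (A, t) = kplane \<phi> (A, t)"
proof -
  let ?c = "kplane_const CARD('d) k"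
  define h where "h = (\<lambda>w. fourier \<phi> (transpose A *v w))"
  have h: "h \<in> schwartz"
    unfolding h_def by (intro schwartz_transpose A schwartz_fourier \<phi>)
  note [measurable] = schwartz_measurable[OF h]
  have "(\<lambda>s. K_op k (kplane \<phi>) (A, s)) = inv_fourier (\<lambda>w. of_real (norm w ^ k) * (of_real ?c * h w))"
    using K_op_kplane[OF A \<phi>, of k] by (simp add: fun_eq_iff h_def K_response_def mult_ac)
  then have f: "fourier (\<lambda>s. K_op k (kplane \<phi>) (A, s)) w = of_real (norm w ^ k) * (of_real ?c * h w)" for w
    using fourier_inv_fourier_norm_power[OF schwartz_scale[OF h, of "of_real ?c"], of k] by simp
  have "K_inv k (K_op k (kplane \<phi>)) (A, t) =
      inv_fourier (\<lambda>w. of_real (inverse (K_response CARD('d) k w)) * (of_real (norm w ^ k) * (of_real ?c * h w))) t"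
    unfolding K_inv_def by (simp only: prod.case f)
  also have "\<dots> = inv_fourier h t"
    by (rule inv_fourier_cong_AE)
      (use kplane_const_pos[of "CARD('d)" k] in \<open>auto simp: K_response_def field_simps\<close>)
  also have "\<dots> = kplane \<phi> (A, t)"
    using fun_cong[OF kplane_inv_fourier(1)[OF A \<phi>], of t] by (simp only: h_def)
  finally show ?thesis .
qed

section \<open>Smoothness of the transform\<close>

lemma inner_axis1: "(w :: real^'n) \<bullet> axis l 1 = w $ l"
  by (simp add: inner_axis)

text \<open>The transpose is what acts on frequencies: replacing \<open>A\<close> by
  \<open>A ** givens i j s\<close> applies \<open>transpose (givens i j s)\<close> to
  \<open>transpose A *v w\<close>.\<close>

lemma givens_transpose_component:
  assumes "i \<noteq> j"
  shows "(transpose (givens i j s) *v x) $ b =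
    (if b = i then cos s * x $ i + sin s * x $ j else if b = j then cos s * x $ j - sin s * x $ i else x $ b)"
proof -
  have s2: "(\<Sum>a\<in>UNIV. if a = i then p else if a = j then q else 0) = p + q" for p q :: real
  proof -
    have "(\<Sum>a\<in>UNIV. if a = i then p else if a = j then q else 0) = (\<Sum>a\<in>UNIV. (if a = i then p else 0) + (if a = j then q else 0))"
      using assms by (intro sum.cong) auto
    then show ?thesis by (simp add: sum.distrib)
  qed
  have "(transpose (givens i j s) *v x) $ b = (\<Sum>a\<in>UNIV. givens i j s $ a $ b * x $ a)"
    by (simp add: matrix_vector_mult_def transpose_def del: transpose_matrix_vector)
  also have "\<dots> = (if b = i then cos s * x $ i + sin s * x $ j else if b = j then cos s * x $ j - sin s * x $ i else x $ b)"
  proof -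
    consider "b = i" | "b = j" | "b \<noteq> i" "b \<noteq> j" by blast
    then show ?thesis
    proof cases
      case 1
      have "(\<Sum>a\<in>UNIV. givens i j s $ a $ b * x $ a) = (\<Sum>a\<in>UNIV. if a = i then cos s * x $ i else if a = j then sin s * x $ j else 0)"
        by (intro sum.cong) (use 1 assms in \<open>auto simp: givens_def\<close>)
      then show ?thesis using 1 by (simp add: s2)
    next
      case 2
      have "(\<Sum>a\<in>UNIV. givens i j s $ a $ b * x $ a) = (\<Sum>a\<in>UNIV. if a = i then - sin s * x $ i else if a = j then cos s * x $ j else 0)"
        by (intro sum.cong) (use 2 assms in \<open>auto simp: givens_def\<close>)
      then show ?thesis using 2 assms by (simp add: s2)
    next
      case 3
      have "(\<Sum>a\<in>UNIV. givens i j s $ a $ b * x $ a) = (\<Sum>a\<in>UNIV. if a = b then x $ a else 0)"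
        by (intro sum.cong) (use 3 assms in \<open>auto simp: givens_def\<close>)
      then show ?thesis using 3 by simp
    qed
  qed
  finally show ?thesis .
qed

lemma givens_same [simp]: "givens i i s = mat 1"
  by (simp add: givens_def mat_def)

lemma givens_zero [simp]: "givens i j 0 = mat 1"
proof -
  have "givens i j 0 $ a $ b = mat 1 $ a $ b" for a b
    by (cases "i = j"; cases "a = i"; cases "a = j"; cases "b = i"; cases "b = j")
      (simp_all add: givens_def mat_def)
  then show ?thesis by (simp add: vec_eq_iff)
qed

lemma transpose_givens: "transpose (givens i j s) = givens i j (- s)"
proof -
  have "givens i j s $ b $ a = givens i j (- s) $ a $ b" for a b
    by (cases "i = j"; cases "a = i"; cases "a = j"; cases "b = i"; cases "b = j")
      (simp_all add: givens_def mat_def)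
  then show ?thesis by (simp add: vec_eq_iff transpose_def)
qed

lemma orthogonal_givens: "orthogonal_matrix (givens i j s)"
proof (cases "i = j")
  case True
  then show ?thesis by (simp add: orthogonal_matrix_id)
next
  case False
  have "transpose (givens i j (- s)) *v (transpose (givens i j s) *v x) = x" for s x
  proof -
    have "a * (a * p + b * q) - b * (a * q - b * p) = (a * a + b * b) * p"
      "a * (a * q - b * p) + b * (a * p + b * q) = (a * a + b * b) * q" for a b p q :: real
      by (simp_all add: algebra_simps)
    from this[of "cos s" _ "sin s"]
    have "cos s * (cos s * p + sin s * q) - sin s * (cos s * q - sin s * p) = p"
      "cos s * (cos s * q - sin s * p) + sin s * (cos s * p + sin s * q) = q" for p q
      unfolding sin_cos_squared_add3 by simp_all
    then show ?thesis
      using False by (simp add: vec_eq_iff givens_transpose_component del: transpose_matrix_vector)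
  qed
  then have "transpose (givens i j (- s)) ** transpose (givens i j s) = mat 1" for s
    unfolding matrix_eq matrix_vector_mul_assoc[symmetric] matrix_vector_mul_lid by blast
  from this[of s] this[of "- s"] show ?thesis
    unfolding orthogonal_matrix_def by (simp add: transpose_givens)
qed

lemma givens_stiefel: "givens i j s \<in> stiefel"
  using orthogonal_givens[of i j s] by (simp add: stiefel_def orthogonal_matrix_def)

text \<open>The linear vector field generating the flow of \<open>transpose (givens i j s)\<close>.
  It vanishes for i = j, in agreement with \<open>givens i i s\<close> being the identity.\<close>

definition rot_gen :: "'d \<Rightarrow> 'd \<Rightarrow> real^'d \<Rightarrow> real^'d" where
  "rot_gen i j y = y $ j *\<^sub>R axis i 1 - y $ i *\<^sub>R axis j 1"

lemma givens_has_vector_derivative: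
  "((\<lambda>s. transpose (givens i j s) *v x) has_vector_derivative rot_gen i j (transpose (givens i j s) *v x)) (at s)"
proof (cases "i = j")
  case True
  then show ?thesis by (simp add: rot_gen_def del: transpose_matrix_vector)
next
  case False
  \<comment> \<open>The projection of x to the coordinate plane and its image under a quarter turn;
    the curve is a combination of the two with trigonometric coefficients.\<close>
  let ?p = "x $ i *\<^sub>R axis i 1 + x $ j *\<^sub>R axis j 1" and ?q = "x $ j *\<^sub>R axis i 1 - x $ i *\<^sub>R axis j 1"
  have "(\<lambda>s. transpose (givens i j s) *v x) = (\<lambda>s. x + (cos s - 1) *\<^sub>R ?p + sin s *\<^sub>R ?q)"
    using False by (auto simp: fun_eq_iff vec_eq_iff givens_transpose_component axis_def algebra_simps simp del: transpose_matrix_vector)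
  moreover have "((\<lambda>s. x + (cos s - 1) *\<^sub>R ?p + sin s *\<^sub>R ?q) has_vector_derivative (- sin s) *\<^sub>R ?p + cos s *\<^sub>R ?q) (at s)"
    by (auto intro!: derivative_eq_intros simp: has_real_derivative_iff_has_vector_derivative[symmetric])
  moreover have "(- sin s) *\<^sub>R ?p + cos s *\<^sub>R ?q = rot_gen i j (transpose (givens i j s) *v x)"
    using False by (auto simp: rot_gen_def vec_eq_iff givens_transpose_component axis_def algebra_simps simp del: transpose_matrix_vector)
  ultimately show ?thesis by simp
qed

text \<open>The angular momentum operator y_j \<partial>_i - y_i \<partial>_j. Its polynomial
  coefficients are why it preserves the Schwartz class.\<close>

definition rot_diff :: "'d \<Rightarrow> 'd \<Rightarrow> (real^'d \<Rightarrow> complex) \<Rightarrow> real^'d \<Rightarrow> complex" where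
  "rot_diff i j h y = ddiff (rot_gen i j y) h y"

lemma rot_diff_schwartz:
  assumes "h \<in> schwartz"
  shows "rot_diff i j h \<in> schwartz"
proof -
  have "rot_diff i j h y = of_real (y \<bullet> axis j 1) * ddiff (axis i 1) h y - of_real (y \<bullet> axis i 1) * ddiff (axis j 1) h y" for y
  proof -
    interpret linear "\<lambda>v. ddiff v h y"
      using has_derivative_ddiff[OF schwartz_differentiable[OF assms]] by (rule has_derivative_linear)
    show ?thesis unfolding rot_diff_def rot_gen_def inner_axis1
      by (simp only: diff scaleR) (simp only: scaleR_conv_of_real)
  qed
  then have "rot_diff i j h = (\<lambda>y. of_real (y \<bullet> axis j 1) * ddiff (axis i 1) h y - of_real (y \<bullet> axis i 1) * ddiff (axis j 1) h y)"
    by blast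
  then show ?thesis by (simp only: schwartz_diff schwartz_mult_inner schwartz_ddiff assms)
qed

section \<open>Plane waves and their derivatives\<close>

definition monomial :: "'m list \<Rightarrow> real^'m \<Rightarrow> complex" where
  "monomial ls w = (\<Prod>l\<leftarrow>ls. \<i> * of_real (w $ l))"

lemma monomial_simps [simp]: "monomial [] w = 1" "monomial (l # ls) w = \<i> * of_real (w $ l) * monomial ls w"
  by (simp_all add: monomial_def)

lemma monomial_bound: "norm (monomial ls w) \<le> (1 + norm w) ^ length ls"
proof (induction ls)
  case (Cons l ls)
  have "\<bar>w $ l\<bar> \<le> 1 + norm w" using component_le_norm_cart[of w l] by simp
  then have "\<bar>w $ l\<bar> * norm (monomial ls w) \<le> (1 + norm w) * (1 + norm w) ^ length ls"
    by (intro mult_mono Cons) auto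
  then show ?case by (simp add: norm_mult)
qed simp

lemma monomial_continuous: "continuous_on S (monomial ls)"
proof (induction ls)
  case (Cons l ls)
  have "continuous_on S (\<lambda>w. \<i> * of_real (w $ l) * monomial ls w)"
    by (intro continuous_intros Cons)
  then show ?case by (simp cong: continuous_on_cong)
qed (simp cong: continuous_on_cong)

lemma monomial_measurable [measurable]: "monomial ls \<in> borel_measurable borel"
  by (rule borel_measurable_continuous_onI[OF monomial_continuous])

lemma schwartz_monomial:
  assumes "g \<in> schwartz"
  shows "(\<lambda>w. monomial ls w * g w) \<in> schwartz"
proof (induction ls)
  case (Cons l ls)
  have "(\<lambda>w. \<i> * (of_real (w \<bullet> axis l 1) * (monomial ls w * g w))) \<in> schwartz"
    by (intro schwartz_scale schwartz_mult_inner Cons)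
  then show ?case by (simp add: inner_axis1 mult_ac)
qed (simp add: assms)

text \<open>Up to a constant, \<open>plane_wave [] (fourier \<phi>)\<close> is the transform of \<open>\<phi>\<close>.  The functions
  \<open>plane_wave ls h\<close> with \<open>h\<close> Schwartz are mapped to one another by the differential operators of \<open>\<Xi>\<^sub>k\<close>.\<close>

definition plane_wave :: "'m list \<Rightarrow> (real^'d \<Rightarrow> complex) \<Rightarrow> ('d::finite, 'm::finite) xi \<Rightarrow> complex" where
  "plane_wave ls h = (\<lambda>(A, t). if A \<in> stiefel
     then (\<integral>w. cis (w \<bullet> t) * (monomial ls w * h (transpose A *v w)) \<partial>lborel) else 0)"

lemma plane_wave_eq:
  "A \<in> stiefel \<Longrightarrow> plane_wave ls h (A, t) = (\<integral>w. cis (w \<bullet> t) * (monomial ls w * h (transpose A *v w)) \<partial>lborel)"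
  by (simp add: plane_wave_def)

lemma plane_wave_off: "A \<notin> stiefel \<Longrightarrow> plane_wave ls h (A, t) = 0"
  by (simp add: plane_wave_def)

lemma plane_wave_inv_fourier:
  fixes A :: "real^'d^'m"
  assumes "A \<in> stiefel"
  shows "plane_wave ls h (A, t) = of_real ((2 * pi) ^ CARD('m)) * inv_fourier (\<lambda>w. monomial ls w * h (transpose A *v w)) t"
  using assms by (simp add: plane_wave_eq inv_fourier_def del: transpose_matrix_vector)

lemma ddiff_inv_fourier:
  fixes g :: "'a::euclidean_space \<Rightarrow> complex"
  assumes g: "g \<in> schwartz"
  shows "ddiff v (inv_fourier g) t = inv_fourier (\<lambda>w. \<i> * (of_real (w \<bullet> v) * g w)) t"
proof -
  let ?c = "of_real (1 / (2 * pi) ^ DIM('a)) :: complex"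
  have s: "(\<lambda>x. ?c * fourier g x) \<in> schwartz"
    by (intro schwartz_scale schwartz_fourier g)
  have "inv_fourier g = (\<lambda>t. ?c * fourier g (- t + 0))"
    unfolding inv_fourier_eq_fourier[abs_def] by simp
  then have "ddiff v (inv_fourier g) t = ddiff (- v) (\<lambda>x. ?c * fourier g x) (- t)"
    using schwartz_affine(2)[OF s, of uminus v 0 t] by (simp add: linear_iff)
  also have "\<dots> = ?c * ddiff (- v) (fourier g) (- t)"
    by (rule ddiff_eq) (intro has_derivative_mult_right has_derivative_ddiff schwartz_differentiable schwartz_fourier g)
  also have "\<dots> = ?c * fourier (\<lambda>w. \<i> * (of_real (w \<bullet> v) * g w)) (- t)"
    unfolding ddiff_fourier[OF g] by simp
  finally show ?thesis by (simp only: inv_fourier_eq_fourier)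
qed

text \<open>As a function of t a plane wave is, up to a factor, an inverse Fourier transform, so a
  coordinate derivative multiplies the integrand by \<i> w_l, which \<open>monomial\<close>
  records.\<close>

lemma plane_wave_slice:
  fixes A :: "real^'d^'m"
  assumes h: "h \<in> schwartz"
  shows "(\<lambda>t. plane_wave ls h (A, t)) \<in> schwartz"
    and "ddiff (axis l 1) (\<lambda>t. plane_wave ls h (A, t)) = (\<lambda>t. plane_wave (l # ls) h (A, t))"
proof -
  have "(\<lambda>t. plane_wave ls h (A, t)) \<in> schwartz \<and> ddiff (axis l 1) (\<lambda>t. plane_wave ls h (A, t)) = (\<lambda>t. plane_wave (l # ls) h (A, t))"
  proof (cases "A \<in> stiefel")
    case True
    let ?g = "\<lambda>w. monomial ls w * h (transpose A *v w)" and ?c = "of_real ((2 * pi) ^ CARD('m)) :: complex"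
    have g: "?g \<in> schwartz" by (intro schwartz_monomial schwartz_transpose True h)
    have "ddiff (axis l 1) (\<lambda>t. ?c * inv_fourier ?g t) t = ?c * ddiff (axis l 1) (inv_fourier ?g) t" for t
      by (rule ddiff_eq) (intro has_derivative_mult_right has_derivative_ddiff schwartz_differentiable schwartz_inv_fourier g)
    moreover have "(\<lambda>w. \<i> * (of_real (w \<bullet> axis l 1) * ?g w)) = (\<lambda>w. monomial (l # ls) w * h (transpose A *v w))"
      by (simp add: inner_axis1 mult_ac del: transpose_matrix_vector)
    ultimately show ?thesis
      using schwartz_scale[OF schwartz_inv_fourier[OF g], of ?c] ddiff_inv_fourier[OF g]
      by (simp only: plane_wave_inv_fourier[OF True]) blast
  next
    case False
    then show ?thesis by (simp add: plane_wave_off schwartz_zero ddiff_def fun_eq_iff)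
  qed
  then show "(\<lambda>t. plane_wave ls h (A, t)) \<in> schwartz"
    "ddiff (axis l 1) (\<lambda>t. plane_wave ls h (A, t)) = (\<lambda>t. plane_wave (l # ls) h (A, t))" by blast+
qed

text \<open>\<open>x\<close> stands for \<open>transpose A *v w\<close>; asking only for its norm
  makes the bound uniform over the Stiefel manifold and along rotations. The exponent is raised by
  \<open>length ls\<close> to absorb the monomial.\<close>

lemma plane_wave_integrand_bound:
  fixes h :: "real^'d \<Rightarrow> complex" and ls :: "'m::finite list"
  assumes h: "h \<in> schwartz"
  obtains C where "0 \<le> C"
    "\<And>(w :: real^'m) x. norm x = norm w \<Longrightarrow> norm (monomial ls w * h x) \<le> C * inverse ((1 + norm w) ^ (2 * DIM(real^'m) + 0))"
proof -
  obtain C where C: "0 \<le> C" "\<And>x. norm (h x) \<le> C * inverse ((1 + norm x) ^ (2 * DIM(real^'m) + length ls))"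
    using schwartz_decay[OF h] by blast
  show ?thesis
  proof (rule that[OF C(1)])
    fix w :: "real^'m" and x :: "real^'d" assume x: "norm x = norm w"
    have "norm (monomial ls w * h x) \<le> (1 + norm w) ^ length ls * (C * inverse ((1 + norm w) ^ (2 * DIM(real^'m) + length ls)))"
      unfolding norm_mult using C(2)[of x] x by (intro mult_mono monomial_bound) auto
    also have "\<dots> = C * inverse ((1 + norm w) ^ (2 * DIM(real^'m) + 0))"
    proof -
      have "1 + norm w \<noteq> 0" by (smt (verit) norm_ge_zero)
      then show ?thesis by (simp add: power_add field_simps)
    qed
    finally show "norm (monomial ls w * h x) \<le> C * inverse ((1 + norm w) ^ (2 * DIM(real^'m) + 0))" .
  qed
qed

text \<open>Only the profile \<open>h\<close> sees the orientation, and rotating \<open>A\<close>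
  moves its argument along the field \<open>rot_gen\<close>. The domination is uniform in s because
  rotations preserve norms.\<close>

lemma plane_wave_rotate:
  fixes A :: "real^'d^'m"
  assumes h: "h \<in> schwartz" and A: "A \<in> stiefel"
  shows "((\<lambda>s. plane_wave ls h (A ** givens i j s, t)) has_vector_derivative plane_wave ls (rot_diff i j h) (A, t)) (at 0)"
proof -
  let ?g = "\<lambda>s x. transpose (givens i j s) *v x"
  have AG: "A ** givens i j s \<in> stiefel" for s
    using stiefel_mult_orthogonal[OF orthogonal_givens] A by blast
  have tr: "transpose (A ** givens i j s) *v w = ?g s (transpose A *v w)" for s w
    by (simp only: matrix_transpose_mul matrix_vector_mul_assoc)
  have n: "norm (?g s (transpose A *v w)) = norm w" for s w
    by (simp only: stiefel_norm[OF givens_stiefel] stiefel_norm[OF A])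
  note r = rot_diff_schwartz[OF h, of i j]
  obtain C where C: "0 \<le> C" "\<And>(w :: real^'m) x. norm x = norm w \<Longrightarrow> norm (monomial ls w * rot_diff i j h x) \<le> C * inverse ((1 + norm w) ^ (2 * DIM(real^'m) + 0))"
    using plane_wave_integrand_bound[OF r, where ls = ls] by blast
  have "((\<lambda>s. \<integral>w. cis (w \<bullet> t) * (monomial ls w * h (?g s (transpose A *v w))) \<partial>lborel) has_vector_derivative
      (\<integral>w. cis (w \<bullet> t) * (monomial ls w * rot_diff i j h (?g 0 (transpose A *v w))) \<partial>lborel)) (at 0)"
  proof (rule has_vector_derivative_integral[where g = "\<lambda>w. C * inverse ((1 + norm w) ^ (2 * DIM(real^'m) + 0))"])
    show "integrable lborel (\<lambda>w. cis (w \<bullet> t) * (monomial ls w * h (?g s (transpose A *v w))))" for s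
      using integrable_cis_mult(2)[OF schwartz_integrable[OF schwartz_monomial[OF schwartz_transpose[OF AG[of s] h], of ls]], of t]
      unfolding tr by (simp add: inner_commute del: transpose_matrix_vector)
    show "((\<lambda>s. cis (w \<bullet> t) * (monomial ls w * h (?g s (transpose A *v w)))) has_vector_derivative
        cis (w \<bullet> t) * (monomial ls w * rot_diff i j h (?g s (transpose A *v w)))) (at s)" for s w
      unfolding rot_diff_def
      by (intro has_vector_derivative_mult_right schwartz_has_vector_derivative[OF h] givens_has_vector_derivative)
    show "norm (cis (w \<bullet> t) * (monomial ls w * rot_diff i j h (?g s (transpose A *v w)))) \<le> C * inverse ((1 + norm w) ^ (2 * DIM(real^'m) + 0))" for s w
      using C(2)[OF n[of s w]] by (simp only: norm_mult[of "cis _"] norm_cis mult_1_left)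
    show "(\<lambda>w. cis (w \<bullet> t) * (monomial ls w * rot_diff i j h (?g 0 (transpose A *v w)))) \<in> borel_measurable lborel"
    proof -
      have [measurable]: "(\<lambda>w. rot_diff i j h (?g 0 (transpose A *v w))) \<in> borel_measurable borel"
        unfolding tr[symmetric] by (intro schwartz_measurable schwartz_transpose AG r)
      show ?thesis by measurable
    qed
    show "integrable lborel (\<lambda>w::real^'m. C * inverse ((1 + norm w) ^ (2 * DIM(real^'m) + 0)))"
      by (intro integrable_mult_right integrable_weight)
  qed
  then show ?thesis
    unfolding plane_wave_eq[OF AG] plane_wave_eq[OF A] tr
    by (simp only: givens_zero transpose_mat matrix_vector_mul_lid)
qed

text \<open>Flows preserve the complement of the Stiefel manifold, where plane waves vanish. Hence
  the derivative identities hold as equalities of total functions and can be iterated.\<close>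

lemma xi_flow_off:
  fixes A :: "real^'d^'m"
  assumes "A \<notin> stiefel"
  shows "fst (xi_flow D s (A, t)) \<notin> stiefel"
  using assms stiefel_mult_orthogonal[OF orthogonal_givens] by (cases D) auto

fun wave_index :: "('d, 'm) xi_dir \<Rightarrow> 'm list \<Rightarrow> 'm list" where
  "wave_index (Rotate i j) ls = ls"
| "wave_index (Shift l) ls = l # ls"

fun wave_profile :: "('d::finite, 'm) xi_dir \<Rightarrow> (real^'d \<Rightarrow> complex) \<Rightarrow> real^'d \<Rightarrow> complex" where
  "wave_profile (Rotate i j) h = rot_diff i j h"
| "wave_profile (Shift l) h = h"

lemma plane_wave_flow:
  fixes D :: "('d::finite, 'm::finite) xi_dir"
  assumes h: "h \<in> schwartz"
  shows "((\<lambda>s. plane_wave ls h (xi_flow D s p)) has_vector_derivative plane_wave (wave_index D ls) (wave_profile D h) p) (at 0)"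
proof (cases p)
  case (Pair A t)
  show ?thesis
  proof (cases "A \<in> stiefel")
    case A: True
    show ?thesis
    proof (cases D)
      case (Rotate i j)
      then show ?thesis using plane_wave_rotate[OF h A] by (simp add: Pair)
    next
      case (Shift l)
      have "((\<lambda>s. t + s *\<^sub>R axis l 1) has_vector_derivative axis l 1) (at 0)"
        by (auto intro!: derivative_eq_intros)
      from schwartz_has_vector_derivative[OF plane_wave_slice(1)[OF h, of ls A] this]
      show ?thesis unfolding plane_wave_slice(2)[OF h] by (simp add: Pair Shift)
    qed
  next
    case False
    have "plane_wave ls h (xi_flow D s (A, t)) = 0" for s
      using xi_flow_off[OF False, of D s t] plane_wave_off by (metis prod.collapse)
    then show ?thesis by (simp add: Pair plane_wave_off[OF False])
  qed
qed

lemma xi_diff_plane_wave: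
  assumes "h \<in> schwartz"
  shows "xi_diff D (plane_wave ls h) = plane_wave (wave_index D ls) (wave_profile D h)"
  unfolding xi_diff_def using vector_derivative_at[OF plane_wave_flow[OF assms]] by blast

lemma wave_profile_schwartz: "h \<in> schwartz \<Longrightarrow> wave_profile D h \<in> schwartz"
  by (cases D) (auto intro: rot_diff_schwartz)

lemma xi_partials_plane_wave:
  assumes "h \<in> schwartz"
  obtains ls' h' where "h' \<in> schwartz" "xi_partials Ds (plane_wave ls h) = plane_wave ls' h'"
proof -
  have "\<exists>ls' h'. h' \<in> schwartz \<and> xi_partials Ds (plane_wave ls h) = plane_wave ls' h'"
  proof (induction Ds)
    case Nil
    then show ?case using assms by (auto simp: xi_partials_def)
  next
    case (Cons D Ds)
    then obtain ls' h' where "h' \<in> schwartz" "xi_partials Ds (plane_wave ls h) = plane_wave ls' h'" by blast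
    then have "xi_partials (D # Ds) (plane_wave ls h) = plane_wave (wave_index D ls') (wave_profile D h')"
      using xi_diff_plane_wave by (simp add: xi_partials_def)
    then show ?case using wave_profile_schwartz \<open>h' \<in> schwartz\<close> by blast
  qed
  then show ?thesis using that by blast
qed

lemma xi_partials_shift:
  assumes "h \<in> schwartz"
  shows "xi_partials (map Shift ks) (plane_wave ls h) = plane_wave (ks @ ls) h"
  using assms by (induction ks) (auto simp: xi_partials_def xi_diff_plane_wave)

text \<open>With \<open>xi_partials_shift\<close> this identifies the Euclidean derivatives of a
  slice with derivatives on \<open>Xi\<close> along shifts, which is what bounds Schwartz seminorms
  of slices by \<open>xi_seminorm\<close>.\<close>

lemma partials_plane_wave:
  assumes "h \<in> schwartz"
  shows "partials (map (\<lambda>l. axis l 1) ks) (\<lambda>t. plane_wave ls h (A, t)) = (\<lambda>t. plane_wave (ks @ ls) h (A, t))"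
  using assms by (induction ks) (auto simp: plane_wave_slice(2))

lemma plane_wave_continuous:
  fixes h :: "real^'d \<Rightarrow> complex" and ls :: "'m::finite list"
  assumes h: "h \<in> schwartz"
  shows "continuous_on Xi (plane_wave ls h)"
proof -
  let ?f = "\<lambda>p (w :: real^'m). cis (w \<bullet> snd p) * (monomial ls w * h (transpose (fst p :: real^'d^'m) *v w))"
  have eq: "plane_wave ls h p = (\<integral>w. ?f p w \<partial>lborel)" if "p \<in> Xi" for p :: "('d, 'm) xi"
    using that by (cases p) (simp add: Xi_def plane_wave_eq del: transpose_matrix_vector)
  obtain C where C: "0 \<le> C" "\<And>(w :: real^'m) x. norm x = norm w \<Longrightarrow> norm (monomial ls w * h x) \<le> C * inverse ((1 + norm w) ^ (2 * DIM(real^'m) + 0))"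
    using plane_wave_integrand_bound[OF h, where ls = ls] by blast
  have "continuous_on Xi (\<lambda>p. \<integral>w. ?f p w \<partial>lborel)"
    unfolding continuous_on_def
  proof (intro ballI tendsto_integral_dominated[where g = "\<lambda>w. C * inverse ((1 + norm w) ^ (2 * DIM(real^'m) + 0))"])
    fix p :: "('d, 'm) xi" and w assume p: "p \<in> Xi"
    have "continuous_on Xi (\<lambda>p. ?f p w)"
      by (intro continuous_intros matrix_continuous_intros continuous_on_compose2[OF schwartz_continuous[OF h, of UNIV]]) auto
    then show "((\<lambda>p. ?f p w) \<longlongrightarrow> ?f p w) (at p within Xi)"
      using p unfolding continuous_on_def by blast
  next
    fix p :: "('d, 'm) xi" and w assume "p \<in> Xi"
    then have "fst p \<in> stiefel" by (auto simp: Xi_def)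
    then show "norm (?f p w) \<le> C * inverse ((1 + norm w) ^ (2 * DIM(real^'m) + 0))"
      using C(2)[OF stiefel_norm[of "fst p" w]] by (simp only: norm_mult[of "cis _"] norm_cis mult_1_left)
  next
    fix p :: "('d, 'm) xi" assume "p \<in> Xi"
    then have "fst p \<in> stiefel" by (auto simp: Xi_def)
    then have [measurable]: "(\<lambda>w. h (transpose (fst p) *v w)) \<in> borel_measurable borel"
      by (intro schwartz_measurable schwartz_transpose h)
    show "?f p \<in> borel_measurable lborel" by measurable
    then show "?f p \<in> borel_measurable lborel" .
  next
    show "integrable lborel (\<lambda>w::real^'m. C * inverse ((1 + norm w) ^ (2 * DIM(real^'m) + 0)))"
      by (intro integrable_mult_right integrable_weight)
  qed
  then show ?thesis using eq by (simp cong: continuous_on_cong)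
qed

lemma kplane_plane_wave:
  fixes \<phi> :: "real^'d \<Rightarrow> complex"
  assumes "\<phi> \<in> schwartz"
  shows "(kplane \<phi> :: ('d, 'm::finite) xi \<Rightarrow> complex) = plane_wave [] (\<lambda>x. of_real (1 / (2 * pi) ^ CARD('m)) * fourier \<phi> x)"
proof
  fix p :: "('d, 'm) xi"
  let ?c = "of_real (1 / (2 * pi) ^ CARD('m)) :: complex"
  obtain A t where p: "p = (A, t)" by (cases p)
  show "kplane \<phi> p = plane_wave [] (\<lambda>x. ?c * fourier \<phi> x) p"
  proof (cases "A \<in> stiefel")
    case True
    have "plane_wave [] (\<lambda>x. ?c * fourier \<phi> x) p = (\<integral>w. ?c * (cis (w \<bullet> t) * fourier \<phi> (transpose A *v w)) \<partial>lborel)"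
      unfolding p plane_wave_eq[OF True] monomial_simps
      by (intro Bochner_Integration.integral_cong refl) (simp only: mult_ac mult_1_left)
    also have "\<dots> = inv_fourier (\<lambda>w. fourier \<phi> (transpose A *v w)) t"
      by (simp only: integral_mult_right_zero inv_fourier_def DIM_cart) simp
    finally show ?thesis using fun_cong[OF kplane_inv_fourier(1)[OF True assms], of t] by (simp add: p)
  qed (simp add: p plane_wave_off)
qed

text \<open>The entries of row l are the coordinates of the unit vector
  \<open>transpose A *v axis l 1\<close>.\<close>

lemma stiefel_entry_le: "A \<in> stiefel \<Longrightarrow> \<bar>(A :: real^'d^'m) $ l $ j\<bar> \<le> 1"
proof -
  assume A: "A \<in> stiefel"
  have "(transpose A *v axis l 1) $ j = A $ l $ j"
    unfolding inner_axis1[symmetric, of "transpose A *v axis l 1"] inner_transpose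
    by (simp add: inner_commute[of "axis l 1"] inner_axis matrix_vector_mul_component inner_axis)
  moreover have "norm (transpose A *v (axis l 1 :: real^'m)) = 1" unfolding stiefel_norm[OF A] by simp
  ultimately show ?thesis using component_le_norm_cart[of "transpose A *v axis l 1" j] by metis
qed

text \<open>Decay in t, uniform in the orientation, is inherited from \<open>kplane_bound\<close>:
  without a monomial a plane wave is the transform of a Schwartz function. A factor w_l is moved
  into the profile by w = A (\<open>transpose A *v w\<close>), which writes w_l as a combination of
  the coordinates of \<open>transpose A *v w\<close> with coefficients bounded by 1.\<close>

lemma plane_wave_bound:
  fixes h :: "real^'d \<Rightarrow> complex" and ls :: "'m::finite list"
  assumes "h \<in> schwartz"
  shows "\<exists>C. \<forall>A\<in>stiefel. \<forall>t. (1 + norm t) ^ n * norm (plane_wave ls h (A, t)) \<le> C"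
  using assms
proof (induction ls arbitrary: h)
  case Nil
  \<comment> \<open>The power of 2 pi compensates the normalization in
    \<open>kplane_plane_wave\<close>.\<close>
  define \<phi> where "\<phi> = inv_fourier (\<lambda>x. of_real ((2 * pi) ^ CARD('m)) * h x)"
  have \<phi>: "\<phi> \<in> schwartz" unfolding \<phi>_def by (intro schwartz_inv_fourier schwartz_scale Nil)
  have "(\<lambda>x. of_real (1 / (2 * pi) ^ CARD('m)) * fourier \<phi> x) = h"
    unfolding \<phi>_def fourier_inv_fourier[OF schwartz_scale[OF Nil]] by simp
  then have eq: "plane_wave [] h = (kplane \<phi> :: ('d, 'm) xi \<Rightarrow> complex)"
    using kplane_plane_wave[OF \<phi>, where 'm = 'm] by simp
  obtain C where C: "0 \<le> C" "\<And>x. (1 + norm x) ^ (n + 2 * CARD('d)) * norm (\<phi> x) \<le> C"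
    using schwartz_bound[OF \<phi>] by blast
  show ?case unfolding eq using kplane_bound(1)[OF _ schwartz_measurable[OF \<phi>] C] by blast
next
  case (Cons l ls)
  let ?h = "\<lambda>j x. of_real (x \<bullet> axis j 1) * h x"
  have hj: "?h j \<in> schwartz" for j by (rule schwartz_mult_inner[OF Cons.prems])
  obtain C where C: "\<And>j A t. A \<in> stiefel \<Longrightarrow> (1 + norm t) ^ n * norm (plane_wave ls (?h j) (A :: real^'d^'m, t)) \<le> C j"
    using Cons.IH[OF hj] by metis
  have "(1 + norm t) ^ n * norm (plane_wave (l # ls) h (A, t)) \<le> (\<Sum>j\<in>UNIV. C j)" if A: "A \<in> stiefel" for A :: "real^'d^'m" and t
  proof -
    have w: "w $ l = (\<Sum>j\<in>UNIV. A $ l $ j * ((transpose A *v w) \<bullet> axis j 1))" for w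
      unfolding inner_axis1 by (subst stiefel_mult[OF A, symmetric]) (simp only: matrix_vector_mult_def vec_lambda_beta)
    have i: "integrable lborel (\<lambda>w. cis (w \<bullet> t) * (monomial ls w * ?h j (transpose A *v w)))" for j
      using integrable_cis_mult(2)[OF schwartz_integrable[OF schwartz_monomial[OF schwartz_transpose[OF A hj[of j]], of ls]], of t]
      by (simp add: inner_commute del: transpose_matrix_vector)
    have "plane_wave (l # ls) h (A, t) = (\<integral>w. (\<Sum>j\<in>UNIV. \<i> * of_real (A $ l $ j) * (cis (w \<bullet> t) * (monomial ls w * ?h j (transpose A *v w)))) \<partial>lborel)"
      unfolding plane_wave_eq[OF A]
    proof (intro Bochner_Integration.integral_cong refl)
      fix w
      have "\<i> * of_real (w $ l) * X = (\<Sum>j\<in>UNIV. \<i> * of_real (A $ l $ j) * (of_real ((transpose A *v w) \<bullet> axis j 1) * X))" for X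
        unfolding w by (simp only: of_real_sum of_real_mult sum_distrib_left sum_distrib_right mult.assoc)
      from this[of "cis (w \<bullet> t) * (monomial ls w * h (transpose A *v w))"]
      show "cis (w \<bullet> t) * (monomial (l # ls) w * h (transpose A *v w)) =
         (\<Sum>j\<in>UNIV. \<i> * of_real (A $ l $ j) * (cis (w \<bullet> t) * (monomial ls w * ?h j (transpose A *v w))))"
        unfolding monomial_simps by (simp only: mult_ac)
    qed
    also have "\<dots> = (\<Sum>j\<in>UNIV. \<i> * of_real (A $ l $ j) * plane_wave ls (?h j) (A, t))"
      unfolding plane_wave_eq[OF A] by (subst Bochner_Integration.integral_sum) (intro integrable_mult_right i, simp only: integral_mult_right_zero)
    finally have "norm (plane_wave (l # ls) h (A, t)) \<le> (\<Sum>j\<in>UNIV. norm (plane_wave ls (?h j) (A, t)))"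
      by (simp only:) (rule sum_norm_le, simp add: norm_mult mult_left_le_one_le stiefel_entry_le[OF A])
    then have "(1 + norm t) ^ n * norm (plane_wave (l # ls) h (A, t)) \<le> (1 + norm t) ^ n * (\<Sum>j\<in>UNIV. norm (plane_wave ls (?h j) (A, t)))"
      by (rule mult_left_mono) simp
    also have "\<dots> \<le> (\<Sum>j\<in>UNIV. C j)"
      unfolding sum_distrib_left by (intro sum_mono C A)
    finally show ?thesis .
  qed
  then show ?case by blast
qed

lemma plane_wave_xi_schwartz:
  fixes h :: "real^'d \<Rightarrow> complex" and ls :: "'m::finite list"
  assumes h: "h \<in> schwartz"
  shows "plane_wave ls h \<in> xi_schwartz"
proof -
  have "continuous_on Xi (xi_partials Ds (plane_wave ls h)) \<and>
      (\<forall>D. \<forall>p\<in>Xi. (\<lambda>s. xi_partials Ds (plane_wave ls h) (xi_flow D s p)) differentiable (at 0)) \<and>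
      (\<forall>n::nat. bdd_above ((\<lambda>(A, t). (1 + norm t) ^ n * norm (xi_partials Ds (plane_wave ls h) (A, t))) ` Xi))" for Ds :: "('d, 'm) xi_dir list"
  proof -
    obtain ls' h' where h': "h' \<in> schwartz" and eq: "xi_partials Ds (plane_wave ls h) = plane_wave ls' h'"
      using xi_partials_plane_wave[OF h] by blast
    have d: "(\<lambda>s. plane_wave ls' h' (xi_flow D s p)) differentiable (at 0)" for D and p :: "('d, 'm) xi"
      using plane_wave_flow[OF h', of ls' D p] by (meson differentiableI_vector)
    have b: "bdd_above ((\<lambda>(A, t). (1 + norm t) ^ n * norm (plane_wave ls' h' (A, t))) ` (Xi :: ('d, 'm) xi set))" for n
    proof -
      obtain C where "\<forall>A\<in>stiefel. \<forall>t. (1 + norm t) ^ n * norm (plane_wave ls' h' (A :: real^'d^'m, t)) \<le> C"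
        using plane_wave_bound[OF h'] by blast
      then show ?thesis by (intro bdd_aboveI2[of _ _ C]) (auto simp: Xi_def)
    qed
    show ?thesis unfolding eq using plane_wave_continuous[OF h'] d b by blast
  qed
  moreover have "plane_wave ls h p = 0" if "p \<notin> Xi" for p :: "('d, 'm) xi"
    using that by (cases p) (auto simp: Xi_def plane_wave_off)
  ultimately show ?thesis unfolding xi_schwartz_def by blast
qed

lemma S_k_subset: "S_k \<subseteq> xi_schwartz"
proof
  fix \<psi> :: "('d::finite, 'm::finite) xi \<Rightarrow> complex" assume "\<psi> \<in> S_k"
  then obtain \<phi> where \<phi>: "\<phi> \<in> schwartz" "\<psi> = kplane \<phi>" by (auto simp: S_k_def)
  show "\<psi> \<in> xi_schwartz"
    unfolding \<phi>(2) kplane_plane_wave[OF \<phi>(1)]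
    by (intro plane_wave_xi_schwartz schwartz_scale schwartz_fourier \<phi>(1))
qed

section \<open>Continuity of slices and duality\<close>

lemma topspace_seminorm_topology:
  assumes "P \<noteq> {}" "\<forall>p\<in>P. p (\<lambda>_. 0) = 0"
  shows "topspace (seminorm_topology V P) = V"
proof -
  obtain p where p: "p \<in> P" using assms(1) by blast
  let ?S = "{{g \<in> V. p (\<lambda>x. g x - f x) < e} | f p e. f \<in> V \<and> p \<in> P \<and> 0 < e}"
  have "f \<in> \<Union> ?S" if f: "f \<in> V" for f
  proof (rule UnionI)
    show "{g \<in> V. p (\<lambda>x. g x - f x) < 1} \<in> ?S"
      using f p by (intro CollectI exI[of _ f] exI[of _ p] exI[of _ 1]) simp
    show "f \<in> {g \<in> V. p (\<lambda>x. g x - f x) < 1}"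
      using f bspec[OF assms(2) p] by simp
  qed
  then have "V \<subseteq> \<Union> ?S" by (rule subsetI)
  moreover have "\<Union> ?S \<subseteq> V" by blast
  ultimately show ?thesis
    unfolding seminorm_topology_def topology_generated_by_topspace by (rule subset_antisym[rotated])
qed

lemma openin_seminorm_ball:
  assumes "f \<in> V" "p \<in> P" "0 < e"
  shows "openin (seminorm_topology V P) {g \<in> V. p (\<lambda>x. g x - f x) < e}"
  unfolding seminorm_topology_def using assms by (intro topology_generated_by_Basis) blast

lemma openin_seminorm_balls:
  assumes P: "P \<noteq> {}" "\<forall>p\<in>P. p (\<lambda>_. 0) = 0"
    and f: "f \<in> V" and e: "0 < e" and I: "finite I" "q ` I \<subseteq> P"
  shows "openin (seminorm_topology V P) {g \<in> V. \<forall>i\<in>I. q i (\<lambda>x. g x - f x) < e}"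
  using I
proof (induction I rule: finite_induct)
  case empty
  then show ?case using openin_topspace[of "seminorm_topology V P"] topspace_seminorm_topology[OF P] by simp
next
  case (insert i I)
  have "{g \<in> V. \<forall>j\<in>insert i I. q j (\<lambda>x. g x - f x) < e} =
      {g \<in> V. q i (\<lambda>x. g x - f x) < e} \<inter> {g \<in> V. \<forall>i\<in>I. q i (\<lambda>x. g x - f x) < e}" by blast
  then show ?case
    using insert openin_seminorm_ball[OF f _ e, of "q i" P] by (simp add: openin_Int)
qed

text \<open>Balls form a subbase of the target topology, so it suffices that preimages of single
  balls are open; around each point of a preimage finitely many source balls are intersected. The
  triangle inequality appears as a hypothesis because \<open>P'\<close> is an arbitrary set of
  real-valued functions.\<close>

lemma continuous_map_seminorm:
  assumes P: "P \<noteq> {}" "\<forall>p\<in>P. p (\<lambda>_. 0) = 0"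
    and P': "P' \<noteq> {}" "\<forall>p\<in>P'. p (\<lambda>_. 0) = 0"
    and W: "W \<subseteq> V" and L: "\<And>f. f \<in> W \<Longrightarrow> L f \<in> V'"
    and tri: "\<And>p u v w. p \<in> P' \<Longrightarrow> u \<in> V' \<Longrightarrow> v \<in> V' \<Longrightarrow> w \<in> V' \<Longrightarrow>
      p (\<lambda>x. u x - w x) \<le> p (\<lambda>x. u x - v x) + p (\<lambda>x. v x - w x)"
    and bd: "\<And>p. p \<in> P' \<Longrightarrow> \<exists>(I :: 'i set) q C. finite I \<and> q ` I \<subseteq> P \<and> 0 \<le> C \<and>
      (\<forall>f\<in>W. \<forall>g\<in>W. p (\<lambda>x. L g x - L f x) \<le> C * (\<Sum>i\<in>I. q i (\<lambda>x. g x - f x)))"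
  shows "continuous_map (subtopology (seminorm_topology V P) W) (seminorm_topology V' P') L"
  unfolding seminorm_topology_def[of V' P']
proof (rule continuous_on_generated_topo)
  have ts: "topspace (subtopology (seminorm_topology V P) W) = W"
    using topspace_seminorm_topology[OF P] W by (auto simp: topspace_subtopology)
  show "L ` topspace (subtopology (seminorm_topology V P) W) \<subseteq> \<Union> {{g \<in> V'. p (\<lambda>x. g x - f x) < e} | f p e. f \<in> V' \<and> p \<in> P' \<and> 0 < e}"
  proof -
    have "\<Union> {{g \<in> V'. p (\<lambda>x. g x - f x) < e} | f p e. f \<in> V' \<and> p \<in> P' \<and> 0 < e} = V'"
      using topspace_seminorm_topology[OF P', where V = V'] unfolding seminorm_topology_def topology_generated_by_topspace .
    then show ?thesis using L ts by auto
  qed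
  fix U assume "U \<in> {{g \<in> V'. p (\<lambda>x. g x - f x) < e} | f p e. f \<in> V' \<and> p \<in> P' \<and> 0 < e}"
  then obtain f0 p e where U: "U = {g \<in> V'. p (\<lambda>x. g x - f0 x) < e}" and f0: "f0 \<in> V'" and p: "p \<in> P'" by blast
  obtain I :: "'i set" and q C where I: "finite I" "q ` I \<subseteq> P" and C: "0 \<le> C"
    and le: "\<And>f g. f \<in> W \<Longrightarrow> g \<in> W \<Longrightarrow> p (\<lambda>x. L g x - L f x) \<le> C * (\<Sum>i\<in>I. q i (\<lambda>x. g x - f x))"
    using bd[OF p] by blast
  show "openin (subtopology (seminorm_topology V P) W) (L -` U \<inter> topspace (subtopology (seminorm_topology V P) W))"
    unfolding ts
  proof (subst openin_subopen, intro ballI)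
    fix f assume "f \<in> L -` U \<inter> W"
    then have f: "f \<in> W" and Lf: "p (\<lambda>x. L f x - f0 x) < e" by (auto simp: U)
    \<comment> \<open>The room left inside the ball, shared among the seminorms; the summand 1 keeps
      the denominator positive and the final estimate strict.\<close>
    define \<delta> where "\<delta> = (e - p (\<lambda>x. L f x - f0 x)) / (C * card I + 1)"
    have pos: "0 < C * card I + 1" using C by (simp add: add_nonneg_pos)
    have \<delta>: "\<delta> > 0" unfolding \<delta>_def using Lf pos by simp
    let ?T = "{g \<in> V. \<forall>i\<in>I. q i (\<lambda>x. g x - f x) < \<delta>} \<inter> W"
    have "openin (subtopology (seminorm_topology V P) W) ?T"
      unfolding openin_subtopology using openin_seminorm_balls[OF P _ \<delta> I, of f V] f W by blast
    moreover have "q i (\<lambda>_. 0) = 0" if "i \<in> I" for i using P(2) I(2) that by blast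
    then have "f \<in> ?T" using f W \<delta> by auto
    moreover have "?T \<subseteq> L -` U \<inter> W"
    proof
      fix g assume g: "g \<in> ?T"
      have "p (\<lambda>x. L g x - L f x) \<le> C * (\<Sum>i\<in>I. q i (\<lambda>x. g x - f x))" using le f g by blast
      also have "\<dots> \<le> C * (\<Sum>i\<in>I. \<delta>)" using g C by (intro mult_left_mono sum_mono) (auto intro: less_imp_le)
      also have "\<dots> < (C * card I + 1) * \<delta>" using \<delta> by (simp add: algebra_simps)
      also have "\<dots> = e - p (\<lambda>x. L f x - f0 x)" unfolding \<delta>_def using pos by simp
      finally have "p (\<lambda>x. L g x - f0 x) < e"
        using tri[OF p L L f0, of g f] f g by fastforce
      then show "g \<in> L -` U \<inter> W" using g L by (auto simp: U)
    qed
    ultimately show "\<exists>T. openin (subtopology (seminorm_topology V P) W) T \<and> f \<in> T \<and> T \<subseteq> L -` U \<inter> W" by blast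
  qed
qed

lemma dual_map_in_dual:
  assumes r: "r \<in> dual_space T'" and L: "continuous_map T T' L" and D: "topspace T = D"
    and D_lin: "\<And>f g a b. f \<in> D \<Longrightarrow> g \<in> D \<Longrightarrow> (\<lambda>x. a * f x + b * g x) \<in> D"
    and lin: "\<And>f g a b. f \<in> D \<Longrightarrow> g \<in> D \<Longrightarrow> L (\<lambda>x. a * f x + b * g x) = (\<lambda>x. a * L f x + b * L g x)"
  shows "dual_map D L r \<in> dual_space T"
proof -
  have LT: "L f \<in> topspace T'" if "f \<in> D" for f using L that D by (auto simp: continuous_map_def)
  have "continuous_map T euclidean (r \<circ> L)"
    using continuous_map_compose[OF L] r unfolding dual_space_def by blast
  then have "continuous_map T euclidean (dual_map D L r)"
    by (rule continuous_map_eq) (simp add: dual_map_def D)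
  then show ?thesis
    using r LT D_lin lin unfolding dual_space_def dual_map_def D by auto
qed

section \<open>Seminorms of the Schwartz space\<close>

lemma schwartz_seminorm_upper:
  assumes "f \<in> schwartz" "bs \<in> lists Basis"
  shows "(1 + norm x) ^ n * norm (partials bs f x) \<le> schwartz_seminorm n bs f"
  unfolding schwartz_seminorm_def
  by (rule cSUP_upper) (use assms in \<open>auto simp: schwartz_def\<close>)

lemma schwartz_seminorm_least:
  "(\<And>x. (1 + norm x) ^ n * norm (partials bs f x) \<le> C) \<Longrightarrow> schwartz_seminorm n bs f \<le> C"
  unfolding schwartz_seminorm_def by (rule cSUP_least) auto

lemma partials_sum:
  fixes f :: "'i \<Rightarrow> 'a::euclidean_space \<Rightarrow> complex"
  assumes "\<And>i. i \<in> I \<Longrightarrow> f i \<in> schwartz" "bs \<in> lists Basis"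
  shows "partials bs (\<lambda>x. \<Sum>i\<in>I. a i * f i x) = (\<lambda>x. \<Sum>i\<in>I. a i * partials bs (f i) x)"
  using assms(2)
proof (induction bs)
  case (Cons b bs)
  have "partials bs (f i) \<in> schwartz" if "i \<in> I" for i
    using Cons that by (intro schwartz_partials assms(1)) auto
  then show ?case using ddiff_sum[of I "\<lambda>i. partials bs (f i)" b a] Cons by simp
qed simp

lemma partials_lincomb:
  fixes f g :: "'a::euclidean_space \<Rightarrow> complex"
  assumes "f \<in> schwartz" "g \<in> schwartz" "bs \<in> lists Basis"
  shows "partials bs (\<lambda>x. a * f x + b * g x) = (\<lambda>x. a * partials bs f x + b * partials bs g x)"
  using partials_sum[of "UNIV :: bool set" "\<lambda>i. if i then f else g" bs "\<lambda>i. if i then a else b"] assms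
  by (simp add: UNIV_bool add.commute)

lemma partials_zero: "partials bs (\<lambda>_. 0) = (\<lambda>_. 0)"
  by (induction bs) (auto simp: ddiff_def)

lemma partials_translate:
  assumes "f \<in> schwartz" "bs \<in> lists Basis"
  shows "partials bs (\<lambda>x. f (x + a)) = (\<lambda>x. partials bs f (x + a))"
  using assms(2)
proof (induction bs)
  case (Cons b bs)
  then have IH: "partials bs (\<lambda>x. f (x + a)) = (\<lambda>x. partials bs f (x + a))" by blast
  have "ddiff b (\<lambda>x. partials bs f (x + a)) x = ddiff b (partials bs f) (x + a)" for x
    by (rule ddiff_translate[OF schwartz_partials[OF assms(1)]]) (use Cons in auto)
  then show ?case unfolding partials_Cons IH by blast
qed simp

lemma schwartz_seminorm_zero: "schwartz_seminorm n bs (\<lambda>_. 0) = 0"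
  by (simp add: schwartz_seminorm_def partials_zero)

lemma schwartz_seminorm_triangle:
  fixes u v w :: "'a::euclidean_space \<Rightarrow> complex"
  assumes "u \<in> schwartz" "v \<in> schwartz" "w \<in> schwartz" and bs: "bs \<in> lists Basis"
  shows "schwartz_seminorm n bs (\<lambda>x. u x - w x) \<le> schwartz_seminorm n bs (\<lambda>x. u x - v x) + schwartz_seminorm n bs (\<lambda>x. v x - w x)"
proof (rule schwartz_seminorm_least)
  fix x
  have s: "(\<lambda>x. u x - v x) \<in> schwartz" "(\<lambda>x. v x - w x) \<in> schwartz"
    using assms by (auto intro: schwartz_diff)
  have "partials bs (\<lambda>x. u x - w x) x = partials bs (\<lambda>x. u x - v x) x + partials bs (\<lambda>x. v x - w x) x"
    using fun_cong[OF partials_lincomb[OF s bs, of 1 1], of x] by simp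
  then have "(1 + norm x) ^ n * norm (partials bs (\<lambda>x. u x - w x) x) \<le>
      (1 + norm x) ^ n * (norm (partials bs (\<lambda>x. u x - v x) x) + norm (partials bs (\<lambda>x. v x - w x) x))"
    by (simp add: norm_triangle_ineq mult_left_mono)
  also have "\<dots> \<le> schwartz_seminorm n bs (\<lambda>x. u x - v x) + schwartz_seminorm n bs (\<lambda>x. v x - w x)"
    unfolding distrib_left by (intro add_mono schwartz_seminorm_upper s bs)
  finally show "(1 + norm x) ^ n * norm (partials bs (\<lambda>x. u x - w x) x) \<le> schwartz_seminorm n bs (\<lambda>x. u x - v x) + schwartz_seminorm n bs (\<lambda>x. v x - w x)" .
qed

lemma schwartz_seminorm_translate:
  assumes f: "f \<in> schwartz" and bs: "bs \<in> lists Basis"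
  shows "schwartz_seminorm n bs (\<lambda>x. f (x + a)) \<le> (1 + norm a) ^ n * schwartz_seminorm n bs f"
proof (rule schwartz_seminorm_least)
  fix x
  have "(1 + norm x) ^ n \<le> (1 + norm a) ^ n * (1 + norm (x + a)) ^ n" by (rule weight_translate)
  then have "(1 + norm x) ^ n * norm (partials bs f (x + a)) \<le> (1 + norm a) ^ n * (1 + norm (x + a)) ^ n * norm (partials bs f (x + a))"
    by (rule mult_right_mono) simp
  also have "\<dots> \<le> (1 + norm a) ^ n * schwartz_seminorm n bs f"
    unfolding mult.assoc by (intro mult_left_mono schwartz_seminorm_upper f bs) simp
  finally show "(1 + norm x) ^ n * norm (partials bs (\<lambda>x. f (x + a)) x) \<le> (1 + norm a) ^ n * schwartz_seminorm n bs f"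
    unfolding partials_translate[OF f bs] .
qed

lemma schwartz_foldr_ddiff: "f \<in> schwartz \<Longrightarrow> foldr ddiff vs f \<in> schwartz"
  by (induction vs) (auto intro: schwartz_ddiff)

text \<open>Derivatives of a slice are slices of derivatives along vectors
  \<open>transpose A *v b\<close>, which need not be basis vectors. Each direction is expanded in
  the basis and its summands are appended to \<open>bs\<close>; summing over all lists of bounded
  length keeps the right-hand side the same at every stage of the induction.\<close>

lemma schwartz_seminorm_directions:
  fixes vs bs :: "'a::euclidean_space list"
  assumes "bs \<in> lists Basis"
  shows "\<exists>C\<ge>0. \<forall>f\<in>schwartz. schwartz_seminorm n bs (foldr ddiff vs f) \<le>
    C * (\<Sum>cs | set cs \<subseteq> Basis \<and> length cs \<le> length bs + length vs. schwartz_seminorm n cs f)"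
  using assms
proof (induction vs arbitrary: bs)
  case Nil
  have "schwartz_seminorm n bs f \<le> (\<Sum>cs | set cs \<subseteq> Basis \<and> length cs \<le> length bs. schwartz_seminorm n cs f)"
    if f: "f \<in> schwartz" for f :: "'a \<Rightarrow> complex"
  proof (rule member_le_sum)
    fix cs :: "'a list" assume "cs \<in> {cs. set cs \<subseteq> Basis \<and> length cs \<le> length bs} - {bs}"
    then have "cs \<in> lists Basis" by (auto simp: in_lists_conv_set)
    from schwartz_seminorm_upper[OF f this, of 0 n]
    show "0 \<le> schwartz_seminorm n cs f" by (rule order_trans[rotated]) simp
  qed (use Nil finite_lists_length_le[OF finite_Basis] in \<open>auto simp: in_lists_conv_set\<close>)
  then show ?case by (intro exI[of _ 1]) auto
next
  case (Cons v vs)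
  let ?S = "\<lambda>f. \<Sum>cs | set cs \<subseteq> Basis \<and> length cs \<le> length bs + length (v # vs). schwartz_seminorm n cs (f :: 'a \<Rightarrow> complex)"
  have "\<forall>b\<in>Basis. \<exists>C\<ge>0. \<forall>f\<in>schwartz. schwartz_seminorm n (bs @ [b]) (foldr ddiff vs f) \<le> C * ?S f"
  proof
    fix b :: 'a assume "b \<in> Basis"
    then have "bs @ [b] \<in> lists Basis" using Cons.prems by auto
    from Cons.IH[OF this] show "\<exists>C\<ge>0. \<forall>f\<in>schwartz. schwartz_seminorm n (bs @ [b]) (foldr ddiff vs f) \<le> C * ?S f"
      by simp
  qed
  from bchoice[OF this] obtain C
    where "\<forall>b\<in>Basis. 0 \<le> C b \<and> (\<forall>f\<in>schwartz. schwartz_seminorm n (bs @ [b]) (foldr ddiff vs f) \<le> C b * ?S f)"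
    by blast
  then have C: "\<And>b. b \<in> Basis \<Longrightarrow> 0 \<le> C b"
      "\<And>b f. b \<in> Basis \<Longrightarrow> f \<in> schwartz \<Longrightarrow> schwartz_seminorm n (bs @ [b]) (foldr ddiff vs f) \<le> C b * ?S f"
    by blast+
  have "schwartz_seminorm n bs (foldr ddiff (v # vs) f) \<le> (\<Sum>b\<in>Basis. \<bar>v \<bullet> b\<bar> * C b) * ?S f" if f: "f \<in> schwartz" for f
  proof (rule schwartz_seminorm_least)
    fix x
    let ?G = "foldr ddiff vs f"
    have G: "?G \<in> schwartz" by (rule schwartz_foldr_ddiff[OF f])
    have "partials bs (ddiff v ?G) x = (\<Sum>b\<in>Basis. of_real (v \<bullet> b) * partials bs (ddiff b ?G) x)"
      by (subst ddiff_expand[OF G]) (simp only: partials_sum[OF schwartz_ddiff[OF G] Cons.prems])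
    also have "\<dots> = (\<Sum>b\<in>Basis. of_real (v \<bullet> b) * partials (bs @ [b]) ?G x)"
      by (simp add: partials_append)
    finally have "(1 + norm x) ^ n * norm (partials bs (ddiff v ?G) x) \<le> (1 + norm x) ^ n * (\<Sum>b\<in>Basis. \<bar>v \<bullet> b\<bar> * norm (partials (bs @ [b]) ?G x))"
      by (simp only:) (intro mult_left_mono sum_norm_le, auto simp: norm_mult)
    also have "\<dots> = (\<Sum>b\<in>Basis. \<bar>v \<bullet> b\<bar> * ((1 + norm x) ^ n * norm (partials (bs @ [b]) ?G x)))"
      by (simp add: sum_distrib_left mult_ac)
    also have "\<dots> \<le> (\<Sum>b\<in>Basis. \<bar>v \<bullet> b\<bar> * (C b * ?S f))"
    proof (intro sum_mono mult_left_mono)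
      fix b :: 'a assume b: "b \<in> Basis"
      then have "bs @ [b] \<in> lists Basis" using Cons.prems by auto
      from schwartz_seminorm_upper[OF G this, of x n] C(2)[OF b f]
      show "(1 + norm x) ^ n * norm (partials (bs @ [b]) ?G x) \<le> C b * ?S f" by linarith
    qed simp
    finally show "(1 + norm x) ^ n * norm (partials bs (foldr ddiff (v # vs) f) x) \<le> (\<Sum>b\<in>Basis. \<bar>v \<bullet> b\<bar> * C b) * ?S f"
      by (simp add: sum_distrib_right mult.assoc)
  qed
  moreover have "0 \<le> (\<Sum>b\<in>Basis. \<bar>v \<bullet> b\<bar> * C b)" using C(1) by (intro sum_nonneg) auto
  ultimately show ?case by blast
qed

definition schwartz_seminorms :: "(('a::euclidean_space \<Rightarrow> complex) \<Rightarrow> real) set" where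
  "schwartz_seminorms = {schwartz_seminorm n bs | n bs. bs \<in> lists Basis}"

lemma schwartz_seminorms:
  "schwartz_seminorms \<noteq> {}" "\<forall>p\<in>schwartz_seminorms. p (\<lambda>_. 0) = 0"
  unfolding schwartz_seminorms_def by (auto simp: schwartz_seminorm_zero intro: lists.Nil)

lemma schwartz_topology_eq: "schwartz_topology = seminorm_topology schwartz schwartz_seminorms"
  by (simp add: schwartz_topology_def schwartz_seminorms_def)

lemma topspace_schwartz [simp]: "topspace schwartz_topology = schwartz"
  unfolding schwartz_topology_eq by (rule topspace_seminorm_topology[OF schwartz_seminorms])

lemma continuous_map_into_schwartz:
  assumes P: "P \<noteq> {}" "\<forall>p\<in>P. p (\<lambda>_. 0) = 0"
    and W: "W \<subseteq> V" "\<And>f g. f \<in> W \<Longrightarrow> g \<in> W \<Longrightarrow> (\<lambda>x. g x - f x) \<in> W" and L: "\<And>f. f \<in> W \<Longrightarrow> L f \<in> schwartz"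
    and diff: "\<And>f g. f \<in> W \<Longrightarrow> g \<in> W \<Longrightarrow> L (\<lambda>x. g x - f x) = (\<lambda>x. L g x - L f x)"
    and bd: "\<And>n bs. bs \<in> lists Basis \<Longrightarrow> \<exists>(I :: 'i set) q C. finite I \<and> q ` I \<subseteq> P \<and> 0 \<le> C \<and>
      (\<forall>f\<in>W. schwartz_seminorm n bs (L f) \<le> C * (\<Sum>i\<in>I. q i f))"
  shows "continuous_map (subtopology (seminorm_topology V P) W) schwartz_topology L"
  unfolding schwartz_topology_eq
proof (rule continuous_map_seminorm[OF P schwartz_seminorms W(1)])
  show "L f \<in> schwartz" if "f \<in> W" for f by (rule L[OF that])
next
  fix p assume "p \<in> (schwartz_seminorms :: (('b \<Rightarrow> complex) \<Rightarrow> real) set)"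
  then obtain n bs where p: "p = schwartz_seminorm n bs" and bs: "bs \<in> lists Basis"
    by (auto simp: schwartz_seminorms_def)
  show "p (\<lambda>x. u x - w x) \<le> p (\<lambda>x. u x - v x) + p (\<lambda>x. v x - w x)"
    if "u \<in> schwartz" "v \<in> schwartz" "w \<in> schwartz" for u v w
    unfolding p by (rule schwartz_seminorm_triangle[OF that bs])
  obtain I :: "'i set" and q C where "finite I" "q ` I \<subseteq> P" "0 \<le> C"
    and le: "\<And>f. f \<in> W \<Longrightarrow> schwartz_seminorm n bs (L f) \<le> C * (\<Sum>i\<in>I. q i f)"
    using bd[OF bs] by metis
  moreover have "p (\<lambda>x. L g x - L f x) \<le> C * (\<Sum>i\<in>I. q i (\<lambda>x. g x - f x))" if "f \<in> W" "g \<in> W" for f g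
    using le[OF W(2)[OF that]] unfolding diff[OF that] p .
  ultimately show "\<exists>(I :: 'i set) q C. finite I \<and> q ` I \<subseteq> P \<and> 0 \<le> C \<and> (\<forall>f\<in>W. \<forall>g\<in>W. p (\<lambda>x. L g x - L f x) \<le> C * (\<Sum>i\<in>I. q i (\<lambda>x. g x - f x)))"
    by (intro exI[of _ I] exI[of _ q] exI[of _ C]) simp
qed

section \<open>Continuity of slices\<close>

definition xi_seminorms :: "((('d::finite, 'm::finite) xi \<Rightarrow> complex) \<Rightarrow> real) set" where
  "xi_seminorms = {xi_seminorm n Ds | n Ds. True}"

lemma xi_partials_zero: "xi_partials Ds (\<lambda>_. 0) = (\<lambda>_. 0)"
  by (induction Ds) (auto simp: xi_partials_def xi_diff_def)

text \<open>\<open>A0\<close> witnesses that \<open>Xi\<close> is not empty; over the empty set the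
  supremum in \<open>xi_seminorm\<close> would be an unspecified real number.\<close>

lemma xi_seminorms:
  fixes A0 :: "real^'d^'m"
  assumes "A0 \<in> stiefel"
  shows "(xi_seminorms :: ((('d, 'm) xi \<Rightarrow> complex) \<Rightarrow> real) set) \<noteq> {}"
    and "\<forall>p\<in>(xi_seminorms :: ((('d, 'm) xi \<Rightarrow> complex) \<Rightarrow> real) set). p (\<lambda>_. 0) = 0"
proof -
  have "(Xi :: ('d, 'm) xi set) \<noteq> {}" using assms by (auto simp: Xi_def)
  then have "xi_seminorm n Ds (\<lambda>_. 0) = 0" for n and Ds :: "('d, 'm) xi_dir list"
    by (simp add: xi_seminorm_def xi_partials_zero case_prod_unfold)
  then show "\<forall>p\<in>(xi_seminorms :: ((('d, 'm) xi \<Rightarrow> complex) \<Rightarrow> real) set). p (\<lambda>_. 0) = 0"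
    by (auto simp: xi_seminorms_def)
qed (auto simp: xi_seminorms_def)

lemma kplane_lincomb_fun:
  fixes \<phi> \<phi>' :: "real^'d \<Rightarrow> complex"
  assumes "\<phi> \<in> schwartz" "\<phi>' \<in> schwartz"
  shows "kplane (\<lambda>x. a * \<phi> x + b * \<phi>' x) = (\<lambda>p. a * kplane \<phi> p + b * kplane \<phi>' p)"
  using kplane_lincomb[OF assms] by blast

lemma S_k_lincomb:
  assumes "\<psi> \<in> S_k" "\<psi>' \<in> S_k"
  shows "(\<lambda>p. a * \<psi> p + b * \<psi>' p) \<in> S_k"
proof -
  obtain \<phi> \<phi>' where \<phi>: "\<phi> \<in> schwartz" "\<psi> = kplane \<phi>" "\<phi>' \<in> schwartz" "\<psi>' = kplane \<phi>'"
    using assms by (auto simp: S_k_def)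
  show ?thesis
    unfolding \<phi>(2,4) kplane_lincomb_fun[OF \<phi>(1,3), symmetric] S_k_def
    by (intro imageI schwartz_lincomb \<phi>(1,3))
qed

lemma Basis_list:
  fixes bs :: "(real^'m) list"
  assumes "bs \<in> lists Basis"
  obtains ls where "bs = map (\<lambda>l. axis l 1) ls"
proof -
  have "\<exists>ls. bs = map (\<lambda>l. axis l 1) ls"
    using assms
  proof (induction bs)
    case (Cons b bs)
    then obtain l ls where "b = axis l 1" "bs = map (\<lambda>l. axis l 1) ls" by (auto simp: Basis_vec_def)
    then show ?case by (intro exI[of _ "l # ls"]) simp
  qed simp
  then show ?thesis using that by blast
qed

lemma slice_seminorm_le:
  fixes A0 :: "real^'d^'m"
  assumes A0: "A0 \<in> stiefel" and \<psi>: "\<psi> \<in> S_k"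
  shows "schwartz_seminorm n (map (\<lambda>l. axis l 1) ls) (\<lambda>t. \<psi> (A0, t)) \<le> xi_seminorm n (map Shift ls) \<psi>"
proof -
  obtain \<phi> where \<phi>: "\<phi> \<in> schwartz" "\<psi> = kplane \<phi>" using \<psi> by (auto simp: S_k_def)
  define h where "h = (\<lambda>x. of_real (1 / (2 * pi) ^ CARD('m)) * fourier \<phi> x)"
  have h: "h \<in> schwartz" unfolding h_def by (intro schwartz_scale schwartz_fourier \<phi>(1))
  have \<psi>h: "\<psi> = plane_wave [] h" unfolding \<phi>(2) h_def by (rule kplane_plane_wave[OF \<phi>(1)])
  have bdd: "bdd_above ((\<lambda>(A, t). (1 + norm t) ^ n * norm (xi_partials (map Shift ls) \<psi> (A, t))) ` Xi)"
  proof -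
    have "\<psi> \<in> xi_schwartz" using S_k_subset \<psi> by blast
    then show ?thesis by (simp add: xi_schwartz_def)
  qed
  show ?thesis
  proof (rule schwartz_seminorm_least)
    fix t
    have "partials (map (\<lambda>l. axis l 1) ls) (\<lambda>t. \<psi> (A0, t)) t = xi_partials (map Shift ls) \<psi> (A0, t)"
      unfolding \<psi>h partials_plane_wave[OF h] xi_partials_shift[OF h] ..
    then show "(1 + norm t) ^ n * norm (partials (map (\<lambda>l. axis l 1) ls) (\<lambda>t. \<psi> (A0, t)) t) \<le> xi_seminorm n (map Shift ls) \<psi>"
      unfolding xi_seminorm_def using cSUP_upper[OF _ bdd, of "(A0, t)"] A0 by (simp add: Xi_def)
  qed
qed

lemma S_k_slice_schwartz:
  assumes "A0 \<in> stiefel" "\<psi> \<in> S_k"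
  shows "(\<lambda>t. \<psi> (A0, t)) \<in> schwartz"
  using assms kplane_inv_fourier(2) by (auto simp: S_k_def)

text \<open>Derivatives along shifts, at the one orientation \<open>A0\<close>, already control all
  Schwartz seminorms of the slice; translation by \<open>t0\<close> costs a power of
  \<open>1 + norm t0\<close>.\<close>

lemma continuous_slice:
  fixes A0 :: "real^'d^'m"
  assumes A0: "A0 \<in> stiefel"
  shows "continuous_map S_k_topology schwartz_topology (\<lambda>\<psi> t. \<psi> (A0, t + t0))"
  unfolding S_k_topology_def xi_schwartz_topology_def xi_seminorms_def[symmetric]
proof (rule continuous_map_into_schwartz[OF xi_seminorms[OF A0] S_k_subset])
  show "(\<lambda>x. g x - f x) \<in> S_k" if "f \<in> S_k" "g \<in> S_k" for f g :: "('d, 'm) xi \<Rightarrow> complex"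
    using S_k_lincomb[OF that(2,1), of 1 "-1"] by simp
  show "(\<lambda>t. f (A0, t + t0)) \<in> schwartz" if "f \<in> S_k" for f
    by (rule schwartz_translate[OF S_k_slice_schwartz[OF A0 that]])
  fix n :: nat and bs :: "(real^'m) list" assume bs: "bs \<in> lists Basis"
  then obtain ls where ls: "bs = map (\<lambda>l. axis l 1) ls" using Basis_list by blast
  have "schwartz_seminorm n bs (\<lambda>t. f (A0, t + t0)) \<le> (1 + norm t0) ^ n * (\<Sum>i\<in>{()}. xi_seminorm n (map Shift ls) f)" if f: "f \<in> S_k" for f
  proof -
    have "schwartz_seminorm n bs (\<lambda>t. f (A0, t + t0)) \<le> (1 + norm t0) ^ n * schwartz_seminorm n bs (\<lambda>t. f (A0, t))"
      by (rule schwartz_seminorm_translate[OF S_k_slice_schwartz[OF A0 f] bs])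
    also have "\<dots> \<le> (1 + norm t0) ^ n * xi_seminorm n (map Shift ls) f"
      unfolding ls by (intro mult_left_mono slice_seminorm_le A0 f) simp
    finally show ?thesis by simp
  qed
  then show "\<exists>(I :: unit set) q C. finite I \<and> q ` I \<subseteq> xi_seminorms \<and> 0 \<le> C \<and>
      (\<forall>f\<in>S_k. schwartz_seminorm n bs (\<lambda>t. f (A0, t + t0)) \<le> C * (\<Sum>i\<in>I. q i f))"
    by (intro exI[of _ "{()}"] exI[of _ "\<lambda>_. xi_seminorm n (map Shift ls)"] exI[of _ "(1 + norm t0) ^ n"])
      (auto simp: xi_seminorms_def)
qed simp

text \<open>On the Fourier side the derivative multiplies by \<i> (w \<bullet> v), and
  \<open>transpose A\<close> preserves this inner product.\<close>

lemma ddiff_kplane_slice: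
  fixes \<phi> :: "real^'d \<Rightarrow> complex" and A :: "real^'d^'m"
  assumes A: "A \<in> stiefel" and \<phi>: "\<phi> \<in> schwartz"
  shows "ddiff v (\<lambda>t. kplane \<phi> (A, t)) = (\<lambda>t. kplane (ddiff (transpose A *v v) \<phi>) (A, t))"
proof
  fix t
  have g: "(\<lambda>w. fourier \<phi> (transpose A *v w)) \<in> schwartz"
    by (intro schwartz_transpose A schwartz_fourier \<phi>)
  have "fourier (ddiff (transpose A *v v) \<phi>) (transpose A *v w) = \<i> * (of_real (w \<bullet> v) * fourier \<phi> (transpose A *v w))" for w
    unfolding fourier_ddiff[OF \<phi>] inner_transpose stiefel_mult[OF A] by simp
  then show "ddiff v (\<lambda>t. kplane \<phi> (A, t)) t = kplane (ddiff (transpose A *v v) \<phi>) (A, t)"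
    unfolding kplane_inv_fourier(1)[OF A \<phi>] ddiff_inv_fourier[OF g]
    using fun_cong[OF kplane_inv_fourier(1)[OF A schwartz_ddiff[OF \<phi>]], where x = t] by simp
qed

lemma partials_kplane_slice:
  fixes \<phi> :: "real^'d \<Rightarrow> complex" and A :: "real^'d^'m"
  assumes A: "A \<in> stiefel" and \<phi>: "\<phi> \<in> schwartz"
  shows "partials bs (\<lambda>t. kplane \<phi> (A, t)) = (\<lambda>t. kplane (foldr ddiff (map (\<lambda>b. transpose A *v b) bs) \<phi>) (A, t))"
proof (induction bs)
  case (Cons b bs)
  show ?case
    using ddiff_kplane_slice[OF A schwartz_foldr_ddiff[OF \<phi>]] by (simp only: partials_Cons Cons foldr.simps list.map o_apply)
qed simp

text \<open>Serves the second functional of the theorem: \<open>KR_topology\<close> is pulled back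
  from the Schwartz space, so continuity has to be measured by seminorms of \<phi> and not by those
  of functions on \<open>Xi\<close>.\<close>

lemma continuous_kplane_slice:
  fixes A0 :: "real^'d^'m"
  assumes A0: "A0 \<in> stiefel"
  shows "continuous_map schwartz_topology schwartz_topology (\<lambda>\<phi> t. kplane \<phi> (A0, t + t0))"
proof -
  have "continuous_map (subtopology (seminorm_topology schwartz schwartz_seminorms) schwartz) schwartz_topology (\<lambda>\<phi> t. kplane \<phi> (A0, t + t0))"
  proof (rule continuous_map_into_schwartz[OF schwartz_seminorms subset_refl])
    show "(\<lambda>x. g x - f x) \<in> schwartz" if "f \<in> schwartz" "g \<in> schwartz" for f g :: "real^'d \<Rightarrow> complex"
      by (rule schwartz_diff[OF that(2,1)])
    show "(\<lambda>t. kplane f (A0, t + t0)) \<in> schwartz" if "f \<in> schwartz" for f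
      by (rule schwartz_translate[OF kplane_inv_fourier(2)[OF A0 that]])
    show "(\<lambda>t. kplane (\<lambda>x. g x - f x) (A0, t + t0)) = (\<lambda>t. kplane g (A0, t + t0) - kplane f (A0, t + t0))"
      if "f \<in> schwartz" "g \<in> schwartz" for f g
      by (simp add: kplane_lincomb[OF that(2,1), of 1 "-1", simplified])
    fix n :: nat and bs :: "(real^'m) list" assume bs: "bs \<in> lists Basis"
    \<comment> \<open>\<open>?N\<close> is the weight consumed by \<open>kplane_bound\<close>, and
      \<open>?vs\<close> are the directions that the derivatives of the slice take under the plane
      integral.\<close>
    let ?N = "n + 2 * CARD('d)" and ?vs = "map (\<lambda>b. transpose A0 *v b) bs"
    let ?I = "{cs :: (real^'d) list. set cs \<subseteq> Basis \<and> length cs \<le> length ([] :: (real^'d) list) + length ?vs}"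
    obtain C where C: "0 \<le> C" "\<And>f. f \<in> schwartz \<Longrightarrow> schwartz_seminorm ?N [] (foldr ddiff ?vs f) \<le> C * (\<Sum>cs\<in>?I. schwartz_seminorm ?N cs f)"
      using schwartz_seminorm_directions[OF lists.Nil, where n = ?N and vs = ?vs] by blast
    have "schwartz_seminorm n bs (\<lambda>t. kplane f (A0, t + t0)) \<le> ((1 + norm t0) ^ n * (C * plane_const CARD('d))) * (\<Sum>cs\<in>?I. schwartz_seminorm ?N cs f)"
      if f: "f \<in> schwartz" for f
    proof -
      let ?g = "foldr ddiff ?vs f"
      have g: "?g \<in> schwartz" by (rule schwartz_foldr_ddiff[OF f])
      have b: "(1 + norm x) ^ ?N * norm (?g x) \<le> schwartz_seminorm ?N [] ?g" for x
        using schwartz_seminorm_upper[OF g lists.Nil, of x ?N] by simp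
      have b0: "0 \<le> schwartz_seminorm ?N [] ?g" using b[of 0] by (rule order_trans[rotated]) simp
      have 1: "schwartz_seminorm n bs (\<lambda>t. kplane f (A0, t + t0)) \<le> (1 + norm t0) ^ n * schwartz_seminorm n bs (\<lambda>t. kplane f (A0, t))"
        by (rule schwartz_seminorm_translate[OF kplane_inv_fourier(2)[OF A0 f] bs])
      have "schwartz_seminorm n bs (\<lambda>t. kplane f (A0, t)) \<le> schwartz_seminorm ?N [] ?g * plane_const CARD('d)"
        by (rule schwartz_seminorm_least, unfold partials_kplane_slice[OF A0 f])
          (rule kplane_bound(1)[OF A0 schwartz_measurable[OF g] b0 b])
      also have "\<dots> \<le> (C * (\<Sum>cs\<in>?I. schwartz_seminorm ?N cs f)) * plane_const CARD('d)"
        by (intro mult_right_mono C f plane_const_nonneg)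
      finally have "(1 + norm t0) ^ n * schwartz_seminorm n bs (\<lambda>t. kplane f (A0, t)) \<le>
          (1 + norm t0) ^ n * ((C * (\<Sum>cs\<in>?I. schwartz_seminorm ?N cs f)) * plane_const CARD('d))"
        by (rule mult_left_mono) simp
      with 1 show ?thesis by (simp only: mult_ac)
    qed
    moreover have "finite ?I" by (rule finite_lists_length_le) simp
    moreover have "schwartz_seminorm ?N ` ?I \<subseteq> schwartz_seminorms"
      by (auto simp: schwartz_seminorms_def in_lists_conv_set)
    moreover have "0 \<le> (1 + norm t0) ^ n * (C * plane_const CARD('d))"
      using C(1) plane_const_nonneg by simp
    ultimately show "\<exists>(I :: (real^'d) list set) q C. finite I \<and> q ` I \<subseteq> schwartz_seminorms \<and> 0 \<le> C \<and>
        (\<forall>f\<in>schwartz. schwartz_seminorm n bs (\<lambda>t. kplane f (A0, t + t0)) \<le> C * (\<Sum>i\<in>I. q i f))"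
      by (intro exI[of _ ?I] exI[of _ "schwartz_seminorm ?N"] exI[of _ "(1 + norm t0) ^ n * (C * plane_const CARD('d))"]) simp
  qed
  then show ?thesis
    unfolding schwartz_topology_eq[symmetric] using subtopology_topspace[of schwartz_topology] by (metis topspace_schwartz)
qed

section \<open>Restriction of functionals to complemented subspaces\<close>

lemma Metric_space_norm_dist:
  assumes "complex_banach V N"
  shows "Metric_space V (norm_dist V N)"
proof
  have sub: "\<And>f g a b. f \<in> V \<Longrightarrow> g \<in> V \<Longrightarrow> (\<lambda>x. a * f x + b * g x) \<in> V"
    and pos: "\<And>f. f \<in> V \<Longrightarrow> 0 \<le> N f" "\<And>f. f \<in> V \<Longrightarrow> N f = 0 \<longleftrightarrow> f = (\<lambda>_. 0)"
    and scale: "\<And>f a. f \<in> V \<Longrightarrow> N (\<lambda>x. a * f x) = norm a * N f"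
    and tri: "\<And>f g. f \<in> V \<Longrightarrow> g \<in> V \<Longrightarrow> N (\<lambda>x. f x + g x) \<le> N f + N g"
    using assms unfolding complex_banach_def complex_subspace_def by blast+
  have diff: "(\<lambda>x. f x - g x) \<in> V" if "f \<in> V" "g \<in> V" for f g
    using sub[OF that, of 1 "-1"] by simp
  show "0 \<le> norm_dist V N f g" for f g
    using diff pos(1) by (simp add: norm_dist_def)
  show "norm_dist V N f g = norm_dist V N g f" for f g
    using scale[OF diff, of g f "-1"] by (simp add: norm_dist_def)
  show "norm_dist V N f g = 0 \<longleftrightarrow> f = g" if "f \<in> V" "g \<in> V" for f g
    using that pos(2)[OF diff[OF that]] by (simp add: norm_dist_def fun_eq_iff)
  show "norm_dist V N f h \<le> norm_dist V N f g + norm_dist V N g h" if "f \<in> V" "g \<in> V" "h \<in> V" for f g h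
    using tri[OF diff[OF that(1,2)] diff[OF that(2,3)]] that by (simp add: norm_dist_def)
qed

lemma topspace_norm_topology:
  "complex_banach V N \<Longrightarrow> topspace (norm_topology V N) = V"
  unfolding norm_topology_def using Metric_space.topspace_mtopology[OF Metric_space_norm_dist] by blast

lemma norm_topology_inclusion:
  assumes X: "complex_banach X N" and Y: "complex_banach Y N" and "Y \<subseteq> X"
  shows "continuous_map (norm_topology Y N) (norm_topology X N) (\<lambda>f. f)"
proof -
  note mX = Metric_space_norm_dist[OF X] and mY = Metric_space_norm_dist[OF Y]
  have "openin (norm_topology Y N) {f \<in> Y. f \<in> U}" if U: "openin (norm_topology X N) U" for U
    unfolding norm_topology_def Metric_space.openin_mtopology[OF mY]
  proof (intro conjI allI impI)
    fix f assume f: "f \<in> {f \<in> Y. f \<in> U}"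
    then obtain e where e: "e > 0" "Metric_space.mball X (norm_dist X N) f e \<subseteq> U"
      using U unfolding norm_topology_def Metric_space.openin_mtopology[OF mX] by blast
    have "Metric_space.mball Y (norm_dist Y N) f e \<subseteq> {f \<in> Y. f \<in> U}"
    proof
      fix g assume "g \<in> Metric_space.mball Y (norm_dist Y N) f e"
      then have g: "g \<in> Y" "norm_dist Y N f g < e" using Metric_space.in_mball[OF mY] by blast+
      have "norm_dist X N f g = norm_dist Y N f g" using f g(1) \<open>Y \<subseteq> X\<close> by (auto simp: norm_dist_def)
      then have "g \<in> Metric_space.mball X (norm_dist X N) f e"
        using Metric_space.in_mball[OF mX] f g \<open>Y \<subseteq> X\<close> by auto
      then show "g \<in> {f \<in> Y. f \<in> U}" using e(2) g(1) by blast
    qed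
    then show "\<exists>r>0. Metric_space.mball Y (norm_dist Y N) f r \<subseteq> {f \<in> Y. f \<in> U}" using e(1) by blast
  qed auto
  then show ?thesis
    unfolding continuous_map_def topspace_norm_topology[OF X] topspace_norm_topology[OF Y]
    using \<open>Y \<subseteq> X\<close> by auto
qed

lemma dual_space_restrict:
  assumes X: "complex_banach X N" and Y: "complex_banach Y N" and "Y \<subseteq> X" and G: "G \<in> dual_space (norm_topology X N)"
  shows "dual_map Y (\<lambda>f. f) G \<in> dual_space (norm_topology Y N)"
  by (rule dual_map_in_dual[OF G norm_topology_inclusion[OF X Y \<open>Y \<subseteq> X\<close>] topspace_norm_topology[OF Y]])
    (use Y in \<open>auto simp: complex_banach_def complex_subspace_def\<close>)

text \<open>The components of a functional are its restrictions to the two summands; they are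
  continuous because the summands carry the norm of \<open>X\<close>.\<close>

lemma banach_direct_sum_restrict:
  assumes ds: "banach_direct_sum X N Y Z" and G: "G \<in> dual_space (norm_topology X N)"
  shows "dual_map Y (\<lambda>f. f) G \<in> dual_space (norm_topology Y N)"
    and "dual_component N Y Z G (dual_map Y (\<lambda>f. f) G)"
proof -
  have X: "complex_banach X N" and Y: "complex_banach Y N" and Z: "complex_banach Z N"
    and XYZ: "X = {\<lambda>x. u x + v x | u v. u \<in> Y \<and> v \<in> Z}"
    using ds by (auto simp: banach_direct_sum_def)
  have 0: "(\<lambda>_. 0) \<in> Y" "(\<lambda>_. 0) \<in> Z"
    using Y Z by (auto simp: complex_banach_def complex_subspace_def)
  have YX: "Y \<subseteq> X" unfolding XYZ using 0(2) by force
  have ZX: "Z \<subseteq> X" unfolding XYZ using 0(1) by force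
  show "dual_map Y (\<lambda>f. f) G \<in> dual_space (norm_topology Y N)"
    by (rule dual_space_restrict[OF X Y YX G])
  have "G (\<lambda>x. u x + v x) = dual_map Y (\<lambda>f. f) G u + dual_map Z (\<lambda>f. f) G v" if "u \<in> Y" "v \<in> Z" for u v
  proof -
    have "G (\<lambda>x. 1 * u x + 1 * v x) = 1 * G u + 1 * G v"
      using G that YX ZX unfolding dual_space_def topspace_norm_topology[OF X] by blast
    then show ?thesis using that by (simp add: dual_map_def)
  qed
  then show "dual_component N Y Z G (dual_map Y (\<lambda>f. f) G)"
    unfolding dual_component_def using dual_space_restrict[OF X Z ZX G] by blast
qed

section \<open>Evaluation of the functionals on test functions\<close>

lemma translate_dist_apply:
  "f \<in> schwartz \<Longrightarrow> translate_dist t0 r f = r (\<lambda>t. f (t + t0))"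
  by (simp add: translate_dist_def dual_map_def)

text \<open>\<open>translate_dist\<close> returns 0 off the Schwartz space, so this evaluation rests
  on the slice being Schwartz.\<close>

lemma ridge_apply:
  assumes "A0 \<in> stiefel" "\<phi> \<in> schwartz"
  shows "ridge (translate_dist t0 r) A0 \<phi> = r (\<lambda>t. kplane \<phi> (A0, t + t0))"
  using assms(2) translate_dist_apply[OF kplane_inv_fourier(2)[OF assms]] by (simp add: ridge_def dual_map_def)

lemma delta_ridge_apply:
  assumes "A0 \<in> stiefel" "\<psi> \<in> S_k"
  shows "delta_ridge A0 t0 r \<psi> = r (\<lambda>t. \<psi> (A0, t + t0))"
  using assms S_k_subset translate_dist_apply[OF S_k_slice_schwartz[OF assms]]
  by (auto simp: delta_ridge_def dual_map_def)

lemma S_k_dual_map: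
  fixes A0 :: "real^'d^'m"
  assumes "A0 \<in> stiefel" "r \<in> dual_space schwartz_topology"
  shows "dual_map S_k (\<lambda>\<psi> t. \<psi> (A0, t + t0)) r \<in> dual_space S_k_topology"
proof (rule dual_map_in_dual[OF assms(2) continuous_slice[OF assms(1)]])
  show "topspace S_k_topology = (S_k :: (('d, 'm) xi \<Rightarrow> complex) set)"
    unfolding S_k_topology_def xi_schwartz_topology_def xi_seminorms_def[symmetric] topspace_subtopology
      topspace_seminorm_topology[OF xi_seminorms[OF assms(1)]]
    using S_k_subset by blast
qed (auto intro: S_k_lincomb)

text \<open>Linearity rests on the integrability of \<open>norm w ^ k\<close> times the transform of
  a slice, which is why it is stated on transforms of Schwartz functions.\<close>

lemma K_op_lincomb:
  fixes \<phi> \<phi>' :: "real^'d \<Rightarrow> complex"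
  assumes "\<phi> \<in> schwartz" "\<phi>' \<in> schwartz"
  shows "(K_op k (kplane (\<lambda>x. a * \<phi> x + b * \<phi>' x)) :: ('d, 'm::finite) xi \<Rightarrow> complex) =
    (\<lambda>p. a * K_op k (kplane \<phi>) p + b * K_op k (kplane \<phi>') p)"
proof
  fix p :: "('d, 'm) xi"
  obtain A t where p: "p = (A, t)" by (cases p)
  show "K_op k (kplane (\<lambda>x. a * \<phi> x + b * \<phi>' x)) p = a * K_op k (kplane \<phi>) p + b * K_op k (kplane \<phi>') p"
  proof (cases "A \<in> stiefel")
    case True
    let ?f = "\<lambda>\<phi> w. of_real (K_response CARD('d) k w) * fourier \<phi> (transpose A *v w)"
    have i: "integrable lborel (\<lambda>w. cis (w \<bullet> t) * ?f f w)" if f: "f \<in> schwartz" for f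
    proof -
      have s: "(\<lambda>w. fourier f (transpose A *v w)) \<in> schwartz"
        by (intro schwartz_transpose True schwartz_fourier f)
      have "integrable lborel (\<lambda>w. of_real (norm w ^ k) * fourier f (transpose A *v w))"
        by (rule Bochner_Integration.integrable_bound[OF schwartz_integrable_weighted[OF s, of k]])
          (use schwartz_measurable[OF s] in \<open>auto intro!: AE_I2 mult_right_mono power_mono simp: norm_mult norm_power simp del: transpose_matrix_vector\<close>)
      from integrable_mult_right[OF this, of "of_real (kplane_const CARD('d) k)"]
      have "integrable lborel (?f f)"
        by (simp only: K_response_def of_real_mult mult.assoc)
      from integrable_cis_mult(2)[OF this, of t] show ?thesis by (simp only: inner_commute)
    qed
    have "fourier (\<lambda>x. a * \<phi> x + b * \<phi>' x) w = a * fourier \<phi> w + b * fourier \<phi>' w" for w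
      using fourier_add[of "\<lambda>x. a * \<phi> x" "\<lambda>x. b * \<phi>' x" w] assms
      by (simp add: fourier_scale schwartz_integrable)
    then have "cis (w \<bullet> t) * ?f (\<lambda>x. a * \<phi> x + b * \<phi>' x) w = a * (cis (w \<bullet> t) * ?f \<phi> w) + b * (cis (w \<bullet> t) * ?f \<phi>' w)" for w
      by (simp add: algebra_simps del: transpose_matrix_vector)
    then have "(\<integral>w. cis (w \<bullet> t) * ?f (\<lambda>x. a * \<phi> x + b * \<phi>' x) w \<partial>lborel) =
        a * (\<integral>w. cis (w \<bullet> t) * ?f \<phi> w \<partial>lborel) + b * (\<integral>w. cis (w \<bullet> t) * ?f \<phi>' w \<partial>lborel)"
      by (simp only: Bochner_Integration.integral_add[OF integrable_mult_right[OF i[OF assms(1)]] integrable_mult_right[OF i[OF assms(2)]]]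
          integral_mult_right_zero)
    then show ?thesis
      unfolding p K_op_kplane[OF True schwartz_lincomb[OF assms]] K_op_kplane[OF True assms(1)] K_op_kplane[OF True assms(2)] inv_fourier_def
      by (simp only: distrib_left mult.left_commute)
  qed (simp add: p K_op_off)
qed

theorem theorem9p4:
  fixes k :: nat
    and A0 :: "real^'d^'m" and t0 :: "real^'m"
    and r :: "(real^'m \<Rightarrow> complex) \<Rightarrow> complex"
    and \<sigma> :: "(real^'d^'m) measure"
  assumes "1 \<le> k" and "k < CARD('d)" and "CARD('m) = CARD('d) - k"
    and "stiefel_haar k \<sigma>"
    and "(A0, t0) \<in> Xi"
    and "r \<in> dual_space schwartz_topology"
  shows
    "(filtered_kplane_dist k \<sigma> (ridge (translate_dist t0 r) A0) = S_k_class (delta_ridge A0 t0 r) \<and>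
      filtered_kplane_dist k \<sigma> (ridge (translate_dist t0 r) A0) \<in> dual_space S_k_topology) \<and>
     (kplane_dist k \<sigma> (ridge (translate_dist t0 r) A0) = filtered_delta_ridge_class k A0 t0 r \<and>
      kplane_dist k \<sigma> (ridge (translate_dist t0 r) A0) \<in> dual_space (KR_topology k \<sigma>)) \<and>
     (\<forall>X N Xc G.
        xi_compatible \<sigma> X N \<longrightarrow>
        banach_direct_sum X N (X_k \<sigma> X N) Xc \<longrightarrow>
        G \<in> dual_space (norm_topology X N) \<longrightarrow>
        X_dual_embed \<sigma> G = delta_ridge A0 t0 r \<longrightarrow>
        filtered_kplane_dist k \<sigma> (ridge (translate_dist t0 r) A0) = Pk_star k \<sigma> (delta_ridge A0 t0 r) \<and>
        (\<exists>H\<in>dual_space (norm_topology (X_k \<sigma> X N) N).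
             dual_component N (X_k \<sigma> X N) Xc G H \<and>
             Pk_star k \<sigma> (delta_ridge A0 t0 r) = X_k_dual_embed \<sigma> H))"
proof (intro conjI allI impI)
  have A0: "A0 \<in> stiefel" using assms(5) by (simp add: Xi_def)
  note inv = kplane_inversion[OF assms(4,1-3)]
  let ?F = "filtered_kplane_dist k \<sigma> (ridge (translate_dist t0 r) A0)"
  let ?E = "kplane_dist k \<sigma> (ridge (translate_dist t0 r) A0)"
  \<comment> \<open>On \<psi> = \<open>kplane \<phi>\<close> the inversion formula returns \<phi>,
    whose slice at \<open>A0\<close> is that of \<psi> itself.\<close>
  have F: "?F = dual_map S_k (\<lambda>\<psi> t. \<psi> (A0, t + t0)) r"
    by (auto simp: fun_eq_iff filtered_kplane_dist_def dual_map_def S_k_def inv ridge_apply[OF A0])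
  also have "\<dots> = S_k_class (delta_ridge A0 t0 r)"
    by (auto simp: fun_eq_iff S_k_class_def dual_map_def delta_ridge_apply[OF A0])
  finally show FS: "?F = S_k_class (delta_ridge A0 t0 r)" .
  show "?F \<in> dual_space S_k_topology"
    unfolding F by (rule S_k_dual_map[OF A0 assms(6)])
  have E: "?E = dual_map (KR_range k) (\<lambda>\<psi> t. kplane (kplane_adj \<sigma> \<psi>) (A0, t + t0)) r"
    by (auto simp: fun_eq_iff kplane_dist_def dual_map_def KR_range_def inv ridge_apply[OF A0])
  \<comment> \<open>Both sides are tested on \<open>K_op k (kplane \<phi>)\<close>: the left one
    recovers the slice of \<open>kplane \<phi>\<close> through the inversion formula, the right one
    through \<open>K_inv_K_op\<close>.\<close>
  show "?E = filtered_delta_ridge_class k A0 t0 r"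
    unfolding E
    by (auto simp: fun_eq_iff filtered_delta_ridge_class_def dual_map_def KR_range_def inv K_inv_K_op[OF A0]
        translate_dist_apply[OF kplane_inv_fourier(2)[OF A0]])
  \<comment> \<open>Linearity of the dual transform on \<open>KR_range k\<close> is read off from
    the inversion formula, so no integrability in the orientation has to be checked.\<close>
  have KR_lin: "(\<lambda>x. a * f x + b * g x) \<in> KR_range k \<and> kplane_adj \<sigma> (\<lambda>x. a * f x + b * g x) = (\<lambda>x. a * kplane_adj \<sigma> f x + b * kplane_adj \<sigma> g x)"
    if fg: "f \<in> KR_range k" "g \<in> KR_range k" for f g :: "('d, 'm) xi \<Rightarrow> complex" and a b
  proof -
    obtain \<phi> \<phi>' where \<phi>: "\<phi> \<in> schwartz" "f = K_op k (kplane \<phi>)" "\<phi>' \<in> schwartz" "g = K_op k (kplane \<phi>')"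
      using fg by (auto simp: KR_range_def)
    let ?h = "\<lambda>x. a * \<phi> x + b * \<phi>' x"
    have h: "?h \<in> schwartz" by (rule schwartz_lincomb[OF \<phi>(1,3)])
    have eq: "(\<lambda>x. a * f x + b * g x) = K_op k (kplane ?h)"
      unfolding \<phi>(2,4) by (rule K_op_lincomb[OF \<phi>(1,3), symmetric])
    show ?thesis unfolding eq using h \<phi> by (auto simp: KR_range_def inv)
  qed
  have KR_sch: "kplane_adj \<sigma> f \<in> schwartz" if "f \<in> KR_range k" for f
    using that by (auto simp: KR_range_def inv)
  show "?E \<in> dual_space (KR_topology k \<sigma>)"
    unfolding E
  proof (rule dual_map_in_dual[OF assms(6)])
    show "continuous_map (KR_topology k \<sigma>) schwartz_topology (\<lambda>\<psi> t. kplane (kplane_adj \<sigma> \<psi>) (A0, t + t0))"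
      using continuous_map_pullback[OF continuous_kplane_slice[OF A0, of t0], of "KR_range k" "kplane_adj \<sigma>"]
      unfolding KR_topology_def o_def .
    show "topspace (KR_topology k \<sigma>) = KR_range k"
      unfolding KR_topology_def topspace_pullback_topology topspace_schwartz using KR_sch by blast
    show "(\<lambda>x. a * f x + b * g x) \<in> KR_range k" if "f \<in> KR_range k" "g \<in> KR_range k" for f g :: "('d, 'm) xi \<Rightarrow> complex" and a b
      using KR_lin[OF that] by blast
    show "(\<lambda>t. kplane (kplane_adj \<sigma> (\<lambda>x. a * f x + b * g x)) (A0, t + t0)) =
        (\<lambda>x. a * kplane (kplane_adj \<sigma> f) (A0, x + t0) + b * kplane (kplane_adj \<sigma> g) (A0, x + t0))"
      if "f \<in> KR_range k" "g \<in> KR_range k" for f g :: "('d, 'm) xi \<Rightarrow> complex" and a b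
      by (simp only: KR_lin[OF that, THEN conjunct2] kplane_lincomb[OF KR_sch[OF that(1)] KR_sch[OF that(2)]])
  qed
  \<comment> \<open>The dual transform of the Dirac ridge is the ridge itself, so
    \<open>Pk_star\<close> of the former is the filtered transform of the latter.\<close>
  have adj: "kplane_adj_dist (delta_ridge A0 t0 r) = ridge (translate_dist t0 r) A0"
  proof
    fix \<phi> :: "real^'d \<Rightarrow> complex"
    show "kplane_adj_dist (delta_ridge A0 t0 r) \<phi> = ridge (translate_dist t0 r) A0 \<phi>"
    proof (cases "\<phi> \<in> schwartz")
      case True
      then have "(kplane \<phi> :: ('d, 'm) xi \<Rightarrow> complex) \<in> S_k" by (simp add: S_k_def)
      then show ?thesis
        using True by (simp add: kplane_adj_dist_def dual_map_def ridge_apply[OF A0 True] delta_ridge_apply[OF A0])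
    qed (simp add: kplane_adj_dist_def ridge_def dual_map_def)
  qed
  then show P: "?F = Pk_star k \<sigma> (delta_ridge A0 t0 r)" by (simp add: Pk_star_def)
  fix X N Xc G
  assume comp: "xi_compatible \<sigma> X N" and ds: "banach_direct_sum X N (X_k \<sigma> X N) Xc"
    and G: "G \<in> dual_space (norm_topology X N)" and GE: "X_dual_embed \<sigma> G = delta_ridge A0 t0 r"
  \<comment> \<open>Projection along the dual of the complement is restriction to the first
    summand.\<close>
  let ?H = "dual_map (X_k \<sigma> X N) (\<lambda>f. f) G"
  have X: "complex_banach X N" and "xi_embed \<sigma> ` xi_schwartz \<subseteq> X"
    using comp by (auto simp: xi_compatible_def)
  then have "xi_embed \<sigma> ` S_k \<subseteq> topspace (norm_topology X N)"
    using S_k_subset unfolding topspace_norm_topology[OF X] by blast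
  \<comment> \<open>Embedded functions of \<open>S_k\<close> stay inside the first summand, so the
    restricted functional agrees with \<open>G\<close> on them.\<close>
  then have emb: "xi_embed \<sigma> ` S_k \<subseteq> X_k \<sigma> X N"
    unfolding X_k_def by (rule closure_of_subset)
  have "Pk_star k \<sigma> (delta_ridge A0 t0 r) = X_k_dual_embed \<sigma> ?H"
  proof
    fix \<psi> :: "('d, 'm) xi \<Rightarrow> complex"
    show "Pk_star k \<sigma> (delta_ridge A0 t0 r) \<psi> = X_k_dual_embed \<sigma> ?H \<psi>"
    proof (cases "\<psi> \<in> S_k")
      case True
      have "Pk_star k \<sigma> (delta_ridge A0 t0 r) \<psi> = X_dual_embed \<sigma> G \<psi>"
        unfolding P[symmetric] FS GE using True by (simp add: S_k_class_def dual_map_def)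
      also have "\<dots> = X_k_dual_embed \<sigma> ?H \<psi>"
        using True S_k_subset emb by (auto simp: X_dual_embed_def X_k_dual_embed_def dual_map_def)
      finally show ?thesis .
    qed (simp add: P[symmetric] FS S_k_class_def X_k_dual_embed_def dual_map_def)
  qed
  then show "\<exists>H\<in>dual_space (norm_topology (X_k \<sigma> X N) N).
      dual_component N (X_k \<sigma> X N) Xc G H \<and> Pk_star k \<sigma> (delta_ridge A0 t0 r) = X_k_dual_embed \<sigma> H"
    using banach_direct_sum_restrict[OF ds G] by blast
qed

end
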